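(* There is an algorithm that, given a connected graph $G$ with $n$ vertices and $m$ edges and an integer $k\ge 1$, runs in time $\mathcal O(n^2(n+m))$ and finds one of the following: (a) a path in $G$ with eccentricity less than $k$; or (b) an induced subgraph $H$ of $G$ isomorphic to $S_k$, to $T_k$, or to a graph in $\mathcal M_k$.
   Context: All graphs are finite and simple. For a connected graph $G$ and a path $P$ in $G$, the eccentricity of $P$ is the maximum over all vertices $v$ of $G$ of the distance from $v$ to $V(P)$. $S_k$ is the graph obtained from $K_{1,3}$ by replacing each edge by a path of length $k$; $T_k$ is obtained from a triangle $K_3$ by attaching to each of its vertices a new pendant path of length $k$ (length = number of edges). $\mathcal M$ is the class of graphs consisting of a path $P$ together with one additional vertex $a$ (the center) such that $a$ is nonadjacent to both endpoints of $P$ and $a$ has at least two neighbors on $P$; the extremities of such a graph are the two endpoints of $P$ and the center $a$. $\mathcal M_k$ is the family of graphs obtained from a graph $M\in\mathcal M$ by replacing each of its three extremities by an endpoint of a path $P_k$ on $k$ vertices, i.e., identifying each extremity with an endpoint of a new copy of $P_k$, these three paths being pairwise disjoint and otherwise disjoint from $M$. *)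

theory Defs
  imports "Graph_Theory.Graph_Theory"
begin

section \<open>Graphs\<close>

text \<open>
  A finite simple graph is a \<^locale>\<open>pair_graph\<close>: a finite, loop-free, symmetric set of vertex pairs.
  Every undirected edge is therefore present as two arcs, which \<^term>\<open>num_edges\<close> counts once.
\<close>

definition num_edges :: "'a pair_pre_digraph \<Rightarrow> nat" where
  "num_edges G = card ((\<lambda>(u, v). {u, v}) ` parcs G)"

definition gdist :: "'a pair_pre_digraph \<Rightarrow> 'a \<Rightarrow> 'a \<Rightarrow> nat" where
  "gdist G u v = (LEAST d. \<exists>p. vwalk p G \<and> hd p = u \<and> last p = v \<and> vwalk_length p = d)"

definition path_ecc :: "'a pair_pre_digraph \<Rightarrow> 'a vwalk \<Rightarrow> nat" where
  "path_ecc G p = Max ((\<lambda>v. Min ((\<lambda>u. gdist G v u) ` set p)) ` pverts G)"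

text \<open>
  \<open>attach_paths G X t\<close> glues to every \<open>x \<in> X\<close> a new path with \<open>t\<close> edges, i.e. it identifies \<open>x\<close> with
  an endpoint of a fresh path on \<open>t + 1\<close> vertices. The copy of \<open>G\<close> is at level \<open>0\<close>.
\<close>

definition attach_paths :: "'a pair_pre_digraph \<Rightarrow> 'a set \<Rightarrow> nat \<Rightarrow> ('a \<times> nat) pair_pre_digraph" where
  "attach_paths G X t = \<lparr>
     pverts = pverts G \<times> {0} \<union> X \<times> {1..t},
     parcs = {((u, 0), (v, 0)) |u v. (u, v) \<in> parcs G}
       \<union> symcl {((x, j), (x, Suc j)) |x j. x \<in> X \<and> j < t}\<rparr>"

text \<open>Centre \<open>(0, 0)\<close>; the edge to the \<open>i\<close>-th leaf of the claw becomes the path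
  \<open>(0, 0), (i, 1), \<dots>, (i, k)\<close> of length \<open>k\<close>.\<close>

definition S_graph :: "nat \<Rightarrow> (nat \<times> nat) pair_pre_digraph" where
  "S_graph k = \<lparr>
     pverts = {(0, 0)} \<union> {1, 2, 3} \<times> {1..k},
     parcs = symcl ({((0, 0), (i, 1)) |i. i \<in> {1, 2, 3}}
       \<union> {((i, j), (i, Suc j)) |i j. i \<in> {1, 2, 3} \<and> 1 \<le> j \<and> j < k})\<rparr>"

definition triangle :: "nat pair_pre_digraph" where
  "triangle = \<lparr>pverts = {0, 1, 2}, parcs = {(u, v). u \<in> {0, 1, 2} \<and> v \<in> {0, 1, 2} \<and> u \<noteq> v}\<rparr>"

definition T_graph :: "nat \<Rightarrow> (nat \<times> nat) pair_pre_digraph" where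
  "T_graph k = attach_paths triangle (pverts triangle) k"

text \<open>The path \<open>Some 0, \<dots>, Some l\<close> together with the centre \<open>None\<close>, whose neighbours on the path
  have the positions in \<open>N\<close>.\<close>

definition path_plus_centre :: "nat \<Rightarrow> nat set \<Rightarrow> nat option pair_pre_digraph" where
  "path_plus_centre l N = \<lparr>
     pverts = insert None (Some ` {0..l}),
     parcs = symcl ({(Some i, Some (Suc i)) |i. i < l} \<union> {(None, Some i) |i. i \<in> N})\<rparr>"

text \<open>The members of the class are listed together with their three extremities.\<close>

definition M_class :: "(nat option pair_pre_digraph \<times> nat option set) set" where
  "M_class = {(path_plus_centre l N, {Some 0, Some l, None}) |l N.
     N \<subseteq> {0..l} \<and> 0 \<notin> N \<and> l \<notin> N \<and> 2 \<le> card N}"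

text \<open>A path on \<open>k\<close> vertices has \<open>k - 1\<close> edges.\<close>

definition M_family :: "nat \<Rightarrow> (nat option \<times> nat) pair_pre_digraph set" where
  "M_family k = {attach_paths M X (k - 1) |M X. (M, X) \<in> M_class}"


section \<open>A random access machine\<close>

text \<open>
  Algorithms are programs of a WHILE language over finitely many natural-number registers and
  arrays. An array access takes a single step. The only arithmetic is the
  successor and truncated subtraction, so after \<open>t\<close> steps all numbers in
  the store are bounded by the largest input number plus \<open>(t + 1)\<close> times a constant of the program; hence numbers stay within logarithmically many bits in
  the input values and the running time, and the unit cost measure hides no arithmetic on long
  numbers. Each instruction is a constant number of steps of a RAM or word RAM, so running times
  carry over to these machines.
\<close>

type_synonym name = string
type_synonym store = "(name \<Rightarrow> nat) \<times> (name \<Rightarrow> nat \<Rightarrow> nat)"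

datatype aexp =
    Const nat
  | Var name
  | Read name aexp
  | Succ aexp
  | Minus aexp aexp

datatype bexp =
    Less aexp aexp
  | Not bexp
  | And bexp bexp

datatype com =
    Skip
  | Assign name aexp
  | Write name aexp aexp
  | Seq com com
  | Cond bexp com com
  | While bexp com

fun aval :: "aexp \<Rightarrow> store \<Rightarrow> nat" where
  "aval (Const i) s = i"
| "aval (Var x) s = fst s x"
| "aval (Read a e) s = snd s a (aval e s)"
| "aval (Succ e) s = Suc (aval e s)"
| "aval (Minus e f) s = aval e s - aval f s"

fun bval :: "bexp \<Rightarrow> store \<Rightarrow> bool" where
  "bval (Less e f) s = (aval e s < aval f s)"
| "bval (Not b) s = (\<not> bval b s)"
| "bval (And b c) s = (bval b s \<and> bval c s)"

text \<open>
  \<open>exec c s t s'\<close>: started in \<open>s\<close>, the program \<open>c\<close> halts after \<open>t\<close> steps in \<open>s'\<close>. Evaluating an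
  expression is not charged separately: the sizes of the expressions are bounded by the program.
\<close>

inductive exec :: "com \<Rightarrow> store \<Rightarrow> nat \<Rightarrow> store \<Rightarrow> bool" where
  Skip: "exec Skip s 1 s"
| Assign: "exec (Assign x e) s 1 ((fst s)(x := aval e s), snd s)"
| Write: "exec (Write a e f) s 1 (fst s, (snd s)(a := (snd s a)(aval e s := aval f s)))"
| Seq: "exec c s t s' \<Longrightarrow> exec d s' t' s'' \<Longrightarrow> exec (Seq c d) s (t + t') s''"
| CondTrue: "bval b s \<Longrightarrow> exec c s t s' \<Longrightarrow> exec (Cond b c d) s (Suc t) s'"
| CondFalse: "\<not> bval b s \<Longrightarrow> exec d s t s' \<Longrightarrow> exec (Cond b c d) s (Suc t) s'"
| WhileFalse: "\<not> bval b s \<Longrightarrow> exec (While b c) s 1 s"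
| WhileTrue: "bval b s \<Longrightarrow> exec c s t s' \<Longrightarrow> exec (While b c) s' t' s'' \<Longrightarrow>
    exec (While b c) s (Suc (t + t')) s''"

lemma exec_deterministic:
  "exec c s t s' \<Longrightarrow> exec c s u s'' \<Longrightarrow> t = u \<and> s' = s''"
proof (induction arbitrary: u s'' rule: exec.induct)
  case Skip
  then show ?case by (cases rule: exec.cases) auto
next
  case Assign
  then show ?case by (cases rule: exec.cases) auto
next
  case Write
  then show ?case by (cases rule: exec.cases) auto
next
  case Seq
  from Seq.prems show ?case by (cases rule: exec.cases) (use Seq.IH in blast)+
next
  case CondTrue
  from CondTrue.prems show ?case by (cases rule: exec.cases) (use CondTrue in blast)+
next
  case CondFalse
  from CondFalse.prems show ?case by (cases rule: exec.cases) (use CondFalse in blast)+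
next
  case WhileFalse
  from WhileFalse.prems WhileFalse.hyps show ?case by (cases rule: exec.cases) auto
next
  case WhileTrue
  from WhileTrue.prems show ?case by (cases rule: exec.cases) (use WhileTrue in blast)+
qed


section \<open>Input and output\<close>

text \<open>\<open>ls\<close> lists, in arbitrary order, the neighbours of each of the vertices \<open>0, \<dots>, n - 1\<close>.\<close>

definition adj_lists :: "nat pair_pre_digraph \<Rightarrow> nat list list \<Rightarrow> bool" where
  "adj_lists G ls \<longleftrightarrow> pverts G = {..<length ls} \<and>
     (\<forall>v < length ls. distinct (ls ! v) \<and> set (ls ! v) = {w. (v, w) \<in> parcs G})"

definition array_of :: "nat list \<Rightarrow> nat \<Rightarrow> nat" where
  "array_of xs i = (if i < length xs then xs ! i else 0)"

text \<open>
  The neighbours of \<open>v\<close> are the entries \<open>adj[i]\<close> with \<open>off[v] \<le> i < off[v + 1]\<close>. All registers and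
  array cells that do not hold the input are \<open>0\<close>.
\<close>

definition input_store :: "nat list list \<Rightarrow> nat \<Rightarrow> store" where
  "input_store ls k =
     ((\<lambda>_. 0)(''n'' := length ls, ''k'' := k),
      (\<lambda>_ _. 0)(''off'' := array_of (map (\<lambda>v. length (concat (take v ls))) [0..<Suc (length ls)]),
                ''adj'' := array_of (concat ls)))"

definition output_list :: "store \<Rightarrow> nat list" where
  "output_list s = map (snd s ''out'') [0..<fst s ''len'']"

text \<open>
  The register \<open>tag\<close> tells which outcome was found: \<open>0\<close> for a path, listed from one end to the
  other, and otherwise the vertices of an induced subgraph.
\<close>

definition is_solution :: "nat pair_pre_digraph \<Rightarrow> nat \<Rightarrow> store \<Rightarrow> bool" where
  "is_solution G k s \<longleftrightarrow>
     (if fst s ''tag'' = 0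
      then vpath (output_list s) G \<and> path_ecc G (output_list s) < k
      else distinct (output_list s) \<and> set (output_list s) \<subseteq> pverts G \<and>
        (let H = G \<restriction> set (output_list s)
         in digraph_iso H (S_graph k) \<or> digraph_iso H (T_graph k) \<or>
            (\<exists>M \<in> M_family k. digraph_iso H M)))"

end

(*
  The algorithm maintains a path P. Let the coverage of P be the set of vertices at distance less
  than k from P. If everything is covered, P is the answer. As long as dropping an end of P does not
  shrink the coverage, that end is dropped. Afterwards each end x of P has a private vertex, whose
  shortest path to P is a path with k - 1 edges hanging on x and not seen by the rest of P. Now take
  a vertex v at distance k from P, and the shortest path from v to P; its last vertex before P is q.
  If v reaches an end of P outside P, then P can be prolonged to v. If the two ends of P are joined
  outside P, then P closes to a cycle, which can be opened next to the component of v and prolonged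
  to v. In both cases the coverage grows, so this happens at most n times, with at most n deletions
  in between, and every step needs a constant number of breadth-first searches.

  Otherwise the three legs, hanging on the ends x, y of P and on q, are pairwise nonadjacent, x, y, q
  are pairwise nonadjacent, and the interior of P is a connected set in which x, y and q have
  neighbours. An inclusion-minimal connected set I of this kind is found by deleting vertices. If one
  of x, y, q has two neighbours in I, then I is an induced path joining the neighbours of the other
  two, and I with the legs is in the family M_k. Otherwise I with x, y, q is a subdivided claw or a
  triangle with three pendant paths, and cutting the prolonged legs at distance k from the centre or
  from the triangle leaves S_k or T_k.
*)
theory Submission
  imports Defs
begin

section \<open>Induced paths and connected sets in an abstract graph\<close>

section \<open>Induced paths and minimal connected sets\<close>

text \<open>Three points shape the development. (1) The obstructions share one normal form,
  \<open>branched\<close>: an induced path \<open>M\<close> and a second one, \<open>Z\<close>,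
  whose first vertex sees the positions \<open>N\<close> of \<open>M\<close>. The three kinds differ
  only in \<open>N\<close> and in the length of \<open>Z\<close>, so prolonging by legs is proved
  once. The program computes neither \<open>M\<close> nor \<open>Z\<close>; vertex sets and degrees
  tell it enough. (2) Feasibility is not monotone: a deletion may disconnect a set that is feasible
  again after a second deletion. A single pass over the vertices therefore need not end in a minimal
  set. The pass restarts after each success, which costs quadratically many tests of linear cost;
  this fits the bound because it happens only once, in the last round. (3) The legs are kept apart
  by searches that expand only some vertices: the region reached from \<open>v\<close> consists of
  its component outside the path and the neighbours of that component on the path, and a leg inside
  such a region cannot be adjacent to a leg that misses it.\<close>

locale ugraph =
  fixes E :: "'a \<Rightarrow> 'a \<Rightarrow> bool"
  assumes sym: "E u v \<Longrightarrow> E v u"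
    and irrefl: "\<not> E u u"
begin

definition ipath :: "'a list \<Rightarrow> bool" where
  "ipath xs \<longleftrightarrow> distinct xs \<and>
     (\<forall>i<length xs. \<forall>j<length xs. E (xs ! i) (xs ! j) \<longleftrightarrow> i = Suc j \<or> j = Suc i)"

text \<open>Phrased without walks, so that it serves directly as an induction principle through
  \<open>conn_closed\<close>. The empty set counts as connected; \<open>feasible\<close> excludes it
  by asking for neighbours.\<close>

definition conn :: "'a set \<Rightarrow> bool" where
  "conn I \<longleftrightarrow> (\<forall>X. X \<subseteq> I \<and> X \<noteq> {} \<and> (\<forall>u\<in>X. \<forall>w\<in>I. E u w \<longrightarrow> w \<in> X) \<longrightarrow> X = I)"

definition feasible :: "'a set \<Rightarrow> 'a \<Rightarrow> 'a \<Rightarrow> 'a \<Rightarrow> bool" where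
  "feasible I a b c \<longleftrightarrow> conn I \<and> (\<exists>u\<in>I. E a u) \<and> (\<exists>u\<in>I. E b u) \<and> (\<exists>u\<in>I. E c u)"

lemma E_commute: "E u v \<longleftrightarrow> E v u"
  using sym by blast

lemma ipath_distinct: "ipath xs \<Longrightarrow> distinct xs"
  by (simp add: ipath_def)

lemma ipath_edge:
  "ipath xs \<Longrightarrow> i < length xs \<Longrightarrow> j < length xs \<Longrightarrow> E (xs ! i) (xs ! j) \<longleftrightarrow> i = Suc j \<or> j = Suc i"
  by (auto simp: ipath_def)

lemma ipath_singleton: "ipath [a]"
  using irrefl by (auto simp: ipath_def)

lemma ipath_take: "ipath xs \<Longrightarrow> ipath (take m xs)"
  by (auto simp: ipath_def)

lemma ipath_drop: "ipath xs \<Longrightarrow> ipath (drop m xs)"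
  by (auto simp: ipath_def)

lemma ipath_rev: "ipath xs \<Longrightarrow> ipath (rev xs)"
  by (auto simp: ipath_def rev_nth)

lemma ipath_append:
  assumes "ipath xs" "ipath ys" "set xs \<inter> set ys = {}"
    and "\<And>a b. a < length xs \<Longrightarrow> b < length ys \<Longrightarrow> E (xs ! a) (ys ! b) \<longleftrightarrow> Suc a = length xs \<and> b = 0"
  shows "ipath (xs @ ys)"
  unfolding ipath_def
proof (intro conjI allI impI)
  show "distinct (xs @ ys)"
    using assms by (simp add: ipath_def)
  fix i j
  assume i: "i < length (xs @ ys)" and j: "j < length (xs @ ys)"
  consider "i < length xs" "j < length xs" | "i < length xs" "\<not> j < length xs"
    | "\<not> i < length xs" "j < length xs" | "\<not> i < length xs" "\<not> j < length xs"
    by blast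
  then show "E ((xs @ ys) ! i) ((xs @ ys) ! j) \<longleftrightarrow> i = Suc j \<or> j = Suc i"
  proof cases
    case 1
    then show ?thesis by (simp add: nth_append ipath_edge[OF assms(1)])
  next
    case 2
    then show ?thesis
      using assms(4)[of i "j - length xs"] j by (auto simp: nth_append)
  next
    case 3
    then show ?thesis
      using assms(4)[of j "i - length xs"] i E_commute[of "xs ! j"] by (auto simp: nth_append)
  next
    case 4
    then show ?thesis
      using ipath_edge[OF assms(2), of "i - length xs" "j - length xs"] i j
      by (auto simp: nth_append)
  qed
qed

lemma ipath_Cons:
  assumes "ipath ys" "a \<notin> set ys" "\<And>b. b < length ys \<Longrightarrow> E a (ys ! b) \<longleftrightarrow> b = 0"
  shows "ipath (a # ys)"
  using ipath_append[of "[a]" ys] assms ipath_singleton by auto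

lemma ipath_snoc:
  assumes "ipath ys" "a \<notin> set ys" "\<And>b. b < length ys \<Longrightarrow> E a (ys ! b) \<longleftrightarrow> Suc b = length ys"
  shows "ipath (ys @ [a])"
  using ipath_append[of ys "[a]"] assms ipath_singleton E_commute by auto

lemma ipath_successively: "ipath xs \<Longrightarrow> successively E xs"
  by (auto simp: ipath_def successively_conv_nth)

lemma conn_singleton: "conn {a}"
  by (auto simp: conn_def)

lemma conn_closed: "conn I \<Longrightarrow> X \<subseteq> I \<Longrightarrow> X \<noteq> {} \<Longrightarrow> (\<And>u w. u \<in> X \<Longrightarrow> w \<in> I \<Longrightarrow> E u w \<Longrightarrow> w \<in> X) \<Longrightarrow> X = I"
  unfolding conn_def by blast

text \<open>A closed part that meets one side swallows it, and the edge \<open>a b\<close> carries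
  it over to the other.\<close>

lemma conn_Un:
  assumes "conn J" "conn K" "a \<in> J" "b \<in> K" "E a b"
  shows "conn (J \<union> K)"
  unfolding conn_def
proof (intro allI impI, elim conjE)
  fix X
  assume X: "X \<subseteq> J \<union> K" "X \<noteq> {}" and cl: "\<forall>u\<in>X. \<forall>w\<in>J \<union> K. E u w \<longrightarrow> w \<in> X"
  have J: "J \<subseteq> X" if "X \<inter> J \<noteq> {}"
    using conn_closed[OF assms(1), of "X \<inter> J"] that cl by blast
  have K: "K \<subseteq> X" if "X \<inter> K \<noteq> {}"
    using conn_closed[OF assms(2), of "X \<inter> K"] that cl by blast
  have "b \<in> X" if "a \<in> X"
    using cl that assms by blast
  moreover have "a \<in> X" if "b \<in> X"
    using cl that assms sym by blast
  ultimately show "X = J \<union> K"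
    using J K X assms(3,4) by blast
qed

lemma conn_insert: "conn J \<Longrightarrow> a \<in> J \<Longrightarrow> E a w \<Longrightarrow> conn (insert w J)"
  using conn_Un[of J "{w}" a w] conn_singleton by simp

lemma conn_successively: "successively E xs \<Longrightarrow> conn (set xs)"
proof (induction xs rule: induct_list012)
  case (3 x y zs)
  then have "conn (set (y # zs))" "E y x"
    using sym by auto
  then show ?case
    using conn_insert[of "set (y # zs)" y x] by simp
qed (auto simp: conn_def)

lemma conn_ipath: "ipath xs \<Longrightarrow> conn (set xs)"
  by (simp add: conn_successively ipath_successively)

text \<open>The ends of the walks that start in \<open>a\<close> and stay in \<open>I\<close> form a
  closed set.\<close>

lemma walk_exists:
  assumes "conn I" "a \<in> I" "b \<in> I"
  obtains xs where "xs \<noteq> []" "successively E xs" "set xs \<subseteq> I" "hd xs = a" "last xs = b"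
proof -
  let ?X = "{w \<in> I. \<exists>xs. xs \<noteq> [] \<and> successively E xs \<and> set xs \<subseteq> I \<and> hd xs = a \<and> last xs = w}"
  have "?X = I"
  proof (rule conn_closed[OF assms(1)])
    have "a \<in> ?X"
      using assms(2) by (auto intro!: exI[of _ "[a]"])
    then show "?X \<noteq> {}" by blast
    fix u w
    assume "u \<in> ?X" and w: "w \<in> I" "E u w"
    then obtain xs where "xs \<noteq> []" "successively E xs" "set xs \<subseteq> I" "hd xs = a" "last xs = u"
      by blast
    then show "w \<in> ?X"
      using w by (auto simp: successively_append_iff intro!: exI[of _ "xs @ [w]"])
  qed blast
  then show thesis
    using assms(3) that by blast
qed

lemma successively_drop: "successively R xs \<Longrightarrow> successively R (drop m xs)"
  by (auto simp: successively_conv_nth)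

lemma successively_take: "successively R xs \<Longrightarrow> successively R (take m xs)"
  by (auto simp: successively_conv_nth)

lemma successively_shortcut:
  assumes "successively R xs" "i < j" "j < length xs" "R (xs ! i) (xs ! j)"
  shows "successively R (take (Suc i) xs @ drop j xs)"
proof -
  have "take (Suc i) xs \<noteq> []" "last (take (Suc i) xs) = xs ! i"
    using assms by (auto simp: take_Suc_conv_app_nth)
  then show ?thesis
    using assms successively_take[of R xs "Suc i"] successively_drop[of R xs j]
    by (simp add: successively_append_iff hd_drop_conv_nth)
qed

text \<open>A walk of least length in \<open>I\<close> from \<open>X\<close> to \<open>Y\<close> has
  all these properties at once: a chord, a repetition or an inner visit to \<open>X\<close> or
  \<open>Y\<close> would yield a shorter one.\<close>

lemma ipath_between:
  assumes I: "conn I" and X: "X \<inter> I \<noteq> {}" and Y: "Y \<inter> I \<noteq> {}"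
  obtains xs where "xs \<noteq> []" "ipath xs" "set xs \<subseteq> I"
    "\<And>i. i < length xs \<Longrightarrow> xs ! i \<in> X \<longleftrightarrow> i = 0"
    "\<And>i. i < length xs \<Longrightarrow> xs ! i \<in> Y \<longleftrightarrow> Suc i = length xs"
proof -
  let ?W = "\<lambda>xs. xs \<noteq> [] \<and> successively E xs \<and> set xs \<subseteq> I \<and> hd xs \<in> X \<and> last xs \<in> Y"
  obtain a b where "a \<in> X \<inter> I" "b \<in> Y \<inter> I" using X Y by blast
  then have "\<exists>xs. ?W xs"
    using walk_exists[OF I, of a b] by (metis IntE)
  then obtain xs where W: "?W xs" and min: "\<And>ys. ?W ys \<Longrightarrow> length xs \<le> length ys"
    using ex_has_least_nat[of ?W _ length] by blast
  have ne: "xs \<noteq> []" and suc: "successively E xs" and sub: "set xs \<subseteq> I"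
    and hd: "hd xs \<in> X" and last: "last xs \<in> Y"
    using W by auto
  have last_take: "last (take (Suc i) xs) = xs ! i" if "i < length xs" for i
    using that by (simp add: take_Suc_conv_app_nth)
  have hd_take: "hd (take (Suc i) xs) = hd xs" for i
    using ne by (cases xs) auto
  have sub_td: "set (take i xs @ drop j xs) \<subseteq> I" for i j
    using sub set_take_subset[of i xs] set_drop_subset[of j xs] by auto
  have chord: "j = Suc i" if "i < j" "j < length xs" "E (xs ! i) (xs ! j)" for i j
  proof -
    have "?W (take (Suc i) xs @ drop j xs)"
      using successively_shortcut[OF suc that] that hd last sub_td[of "Suc i" j] ne by auto
    from min[OF this] show ?thesis using that by auto
  qed
  \<comment> \<open>The edge that leaves the second occurrence would be a chord from the first one.
    If the second occurrence is the end of the walk, the walk may stop at the first.\<close>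
  have dist: "xs ! i \<noteq> xs ! j" if "i < j" "j < length xs" for i j
  proof
    assume eq: "xs ! i = xs ! j"
    show False
    proof (cases "Suc j < length xs")
      case True
      have "E (xs ! i) (xs ! Suc j)"
        using suc True eq by (auto simp: successively_conv_nth)
      then show False using chord[of i "Suc j"] True that by simp
    next
      case False
      then have "xs ! j = last xs"
        using that last_conv_nth[OF ne] by (metis Suc_lessI diff_Suc_1)
      then have "xs ! i \<in> Y"
        using eq last by simp
      then have "?W (take (Suc i) xs)"
        using that hd ne last_take[of i] hd_take[of i] sub_td[of "Suc i" "length xs"] successively_take[OF suc]
        by auto
      from min[OF this] show False using that by auto
    qed
  qed
  have "ipath xs"
    unfolding ipath_def
  proof (intro conjI allI impI)
    show "distinct xs"
      using dist by (simp add: distinct_conv_nth) (metis nat_neq_iff)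
    fix i j
    assume "i < length xs" "j < length xs"
    then show "E (xs ! i) (xs ! j) \<longleftrightarrow> i = Suc j \<or> j = Suc i"
      using chord[of i j] chord[of j i] suc sym irrefl
      by (cases i j rule: linorder_cases) (auto simp: successively_conv_nth)
  qed
  moreover have "i = 0" if "i < length xs" "xs ! i \<in> X" for i
  proof -
    have "?W (drop i xs)"
      using that last ne sub successively_drop[OF suc] set_drop_subset[of i xs]
      by (auto simp: hd_drop_conv_nth)
    from min[OF this] show ?thesis using that by auto
  qed
  moreover have "Suc i = length xs" if "i < length xs" "xs ! i \<in> Y" for i
  proof -
    have "?W (take (Suc i) xs)"
      using that hd ne sub successively_take[OF suc] set_take_subset[of "Suc i" xs] last_take hd_take
      by auto
    from min[OF this] show ?thesis using that by auto
  qed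
  moreover have "xs ! i \<in> X" if "i = 0" for i
    using hd ne that by (simp add: hd_conv_nth)
  moreover have "xs ! i \<in> Y" if "Suc i = length xs" for i
    using last ne by (simp add: last_conv_nth flip: that)
  ultimately show thesis
    using that[of xs] ne sub by blast
qed

end

lemma nth_mem_drop: "i < length xs \<Longrightarrow> xs ! i \<in> set (drop i xs)"
  by (metis drop_eq_Nil hd_drop_conv_nth hd_in_set not_le)

section \<open>Tripods: the shape of a minimal connected set with three terminals\<close>

context ugraph
begin

text \<open>The normal form shared by all obstructions. Since \<open>N\<close> avoids both ends of
  \<open>M\<close>, legs can be glued to the ends without touching the place where the two paths
  meet.\<close>

definition branched :: "'a list \<Rightarrow> 'a list \<Rightarrow> nat set \<Rightarrow> bool" where
  "branched M Z N \<longleftrightarrow> ipath M \<and> ipath Z \<and> Z \<noteq> [] \<and> set M \<inter> set Z = {} \<and>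
     (\<forall>i<length M. \<forall>j<length Z. E (M ! i) (Z ! j) \<longleftrightarrow> j = 0 \<and> i \<in> N) \<and>
     N \<subseteq> {0<..<length M - 1}"

text \<open>The alternatives lead to \<open>S_graph\<close>, \<open>T_graph\<close> and
  \<open>M_family\<close>, in this order. A triangle whose third corner is itself the end of
  \<open>Z\<close> belongs to the last one: that corner is a terminal with two neighbours on the
  path.\<close>

definition tripod :: "'a list \<Rightarrow> 'a list \<Rightarrow> nat set \<Rightarrow> bool" where
  "tripod M Z N \<longleftrightarrow> branched M Z N \<and>
     ((\<exists>m. N = {m}) \<or> (\<exists>m. N = {m, Suc m} \<and> 1 < length Z) \<or> length Z = 1 \<and> 2 \<le> card N)"

definition tripod_on :: "'a set \<Rightarrow> 'a \<Rightarrow> 'a \<Rightarrow> 'a \<Rightarrow> bool" where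
  "tripod_on I a b c \<longleftrightarrow> (\<exists>M Z N. tripod M Z N \<and> M \<noteq> [] \<and> hd M = a \<and> last M = b \<and> last Z = c \<and>
     set M \<union> set Z = I \<union> {a, b, c})"

lemma tripod_onI:
  "tripod M Z N \<Longrightarrow> set M \<union> set Z = I \<union> {a, b, c} \<Longrightarrow> M \<noteq> [] \<Longrightarrow> hd M = a \<Longrightarrow> last M = b \<Longrightarrow>
   last Z = c \<Longrightarrow> tripod_on I a b c"
  unfolding tripod_on_def by blast

lemma feasibleI:
  "conn J \<Longrightarrow> E a u \<Longrightarrow> u \<in> J \<Longrightarrow> E b v \<Longrightarrow> v \<in> J \<Longrightarrow> E c w \<Longrightarrow> w \<in> J \<Longrightarrow> feasible J a b c"
  by (auto simp: feasible_def)

lemma ipath_ends: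
  assumes "ipath Q" "Q \<noteq> []" "a \<notin> set Q" "b \<notin> set Q" "a \<noteq> b" "\<not> E a b"
    and a: "\<And>i. i < length Q \<Longrightarrow> E a (Q ! i) \<longleftrightarrow> i = 0"
    and b: "\<And>i. i < length Q \<Longrightarrow> E b (Q ! i) \<longleftrightarrow> Suc i = length Q"
  shows "ipath (a # Q @ [b])"
proof (rule ipath_Cons)
  show "ipath (Q @ [b])"
    using assms by (intro ipath_snoc) auto
  show "E a ((Q @ [b]) ! i) \<longleftrightarrow> i = 0" if "i < length (Q @ [b])" for i
    using that a[of i] assms by (auto simp: nth_append less_Suc_eq)
qed (use assms in auto)

text \<open>Here the branch consists of \<open>c\<close> alone. A single neighbour on the path gives
  the first alternative of \<open>tripod\<close>, several give the last.\<close>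

lemma tripod_centre:
  assumes Q: "ipath Q" "Q \<noteq> []" and dist: "a \<notin> set Q" "b \<notin> set Q" "c \<notin> set Q" "a \<noteq> b" "a \<noteq> c" "b \<noteq> c"
    and indep: "\<not> E a b" "\<not> E a c" "\<not> E b c"
    and a: "\<And>i. i < length Q \<Longrightarrow> E a (Q ! i) \<longleftrightarrow> i = 0"
    and b: "\<And>i. i < length Q \<Longrightarrow> E b (Q ! i) \<longleftrightarrow> Suc i = length Q"
    and c: "\<exists>u\<in>set Q. E c u"
  shows "tripod_on (set Q) a b c"
proof -
  \<comment> \<open>\<open>Suc\<close>, because \<open>a\<close> is put in front of
    \<open>Q\<close>.\<close>
  let ?M = "a # Q @ [b]" and ?N = "Suc ` {i. i < length Q \<and> E c (Q ! i)}"
  have "?N \<noteq> {}"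
    using c by (auto simp: in_set_conv_nth)
  then have "card ?N \<noteq> 0"
    by simp
  then have "card ?N = 1 \<or> 2 \<le> card ?N"
    by linarith
  then have "(\<exists>m. ?N = {m}) \<or> 2 \<le> card ?N"
    by (metis card_1_singletonE)
  moreover have "E (?M ! i) c \<longleftrightarrow> i \<in> ?N" if "i < length ?M" for i
  proof (cases i)
    case 0
    then show ?thesis using indep by auto
  next
    case (Suc j)
    then show ?thesis
      using that indep by (auto simp: nth_append less_Suc_eq E_commute[of c] image_iff)
  qed
  moreover have "ipath ?M"
    using assms by (intro ipath_ends) auto
  ultimately have "tripod ?M [c] ?N"
    using dist ipath_singleton[of c] by (auto simp: tripod_def branched_def)
  then show ?thesis
    by (rule tripod_onI) auto
qed

text \<open>The path \<open>Q\<close> and the branch \<open>W\<close>, which ends next to \<open>Q\<close>, make up a minimal set. If \<open>a\<close> sees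
  the branch too, then the branch must be attached to the end of \<open>Q\<close> next to \<open>a\<close>.\<close>

lemma tripod_attached_end:
  assumes Q: "ipath Q" "Q \<noteq> []" and W: "ipath W" "W \<noteq> []" and disj: "set Q \<inter> set W = {}"
    and notin: "{a, b, c} \<inter> (set Q \<union> set W) = {}" and dist: "a \<noteq> b" "a \<noteq> c" "b \<noteq> c"
    and indep: "\<not> E a b" "\<not> E a c" "\<not> E b c"
    and a: "\<And>i. i < length Q \<Longrightarrow> E a (Q ! i) \<longleftrightarrow> i = 0"
    and b: "\<And>i. i < length Q \<Longrightarrow> E b (Q ! i) \<longleftrightarrow> Suc i = length Q"
    and cQ: "\<not> (\<exists>u\<in>set Q. E c u)" and cW: "\<And>i. i < length W \<Longrightarrow> E c (W ! i) \<longleftrightarrow> i = 0"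
    and cross: "\<And>i j. i < length Q \<Longrightarrow> j < length W \<Longrightarrow> E (Q ! i) (W ! j) \<Longrightarrow> Suc j = length W"
    and l: "l < length Q" "E (Q ! l) (last W)"
    and min: "\<And>J. J \<subseteq> set Q \<union> set W \<Longrightarrow> feasible J a b c \<Longrightarrow> J = set Q \<union> set W"
    and aW: "w \<in> set W" "E a w"
  shows "tripod_on (set Q \<union> set W) c b a"
proof -
  have lastQ: "E b (last Q)" and hdW: "E c (hd W)"
    using b[of "length Q - 1"] cW[of 0] Q W by (auto simp: last_conv_nth hd_conv_nth)
  \<comment> \<open>Otherwise \<open>W\<close> with the part of \<open>Q\<close> from position
    \<open>i\<close> on is feasible, as \<open>a\<close> sees \<open>W\<close>, and it misses the
    first vertex of \<open>Q\<close>.\<close>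
  have l0: "i = 0" if i: "i < length Q" "E (Q ! i) (last W)" for i
  proof (rule ccontr)
    assume "i \<noteq> 0"
    let ?J = "set W \<union> set (drop i Q)"
    have "conn ?J"
      using i W conn_Un[of "set W" "set (drop i Q)" "last W" "Q ! i"] conn_ipath ipath_drop[OF Q(1)] sym
      by (auto simp: nth_mem_drop)
    moreover have "last Q \<in> set (drop i Q)"
      using i by (metis drop_eq_Nil last_drop last_in_set not_le)
    ultimately have "feasible ?J a b c"
      using lastQ hdW aW W hd_in_set[OF W(2)] by (intro feasibleI[of ?J a w b "last Q" c "hd W"]) auto
    from min[OF _ this] have "set Q \<subseteq> ?J"
      using set_drop_subset[of i Q] by blast
    then have "hd Q \<in> set (drop i Q)"
      using Q(2) disj hd_in_set by blast
    then show False
      using \<open>i \<noteq> 0\<close> ipath_distinct[OF Q(1)] Q(2)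
      by (cases Q; cases i) (auto dest: in_set_dropD)
  qed
  \<comment> \<open>If \<open>b\<close> saw the branch as well, \<open>W\<close> alone would be
    feasible.\<close>
  have bW: "\<not> E b u" if "u \<in> set W" for u
  proof
    assume "E b u"
    then have "feasible (set W) a b c"
      using feasibleI[OF conn_ipath[OF W(1)] aW(2,1) _ that hdW] W by simp
    from min[OF _ this] have "set Q \<subseteq> set W"
      by blast
    then show False
      using Q(2) disj hd_in_set[OF Q(2)] by blast
  qed
  have ip: "ipath (W @ Q)"
  proof (rule ipath_append[OF W(1) Q(1)])
    fix i j
    assume i: "i < length W" and j: "j < length Q"
    show "E (W ! i) (Q ! j) \<longleftrightarrow> Suc i = length W \<and> j = 0"
    proof
      assume "E (W ! i) (Q ! j)"
      then have "E (Q ! j) (W ! i)" using sym by blast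
      moreover from cross[OF j i this] have "W ! i = last W"
        using W by (simp add: last_conv_nth flip: \<open>Suc i = length W\<close>)
      ultimately show "Suc i = length W \<and> j = 0"
        using cross[OF j i] l0[OF j] by simp
    next
      assume "Suc i = length W \<and> j = 0"
      then show "E (W ! i) (Q ! j)"
        using l0[OF l] l W(2) sym by (metis diff_Suc_1 last_conv_nth)
    qed
  qed (use disj in auto)
  have cWQ: "E c ((W @ Q) ! i) \<longleftrightarrow> i = 0" if "i < length (W @ Q)" for i
    using that cW[of i] cQ W by (cases i) (auto simp: nth_append)
  have bWQ: "E b ((W @ Q) ! i) \<longleftrightarrow> Suc i = length (W @ Q)" if "i < length (W @ Q)" for i
    using that b[of "i - length W"] bW[of "W ! i"] Q by (auto simp: nth_append simp flip: length_greater_0_conv)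
  \<comment> \<open>The branch continues into \<open>Q\<close> as one induced path from the
    neighbour of \<open>c\<close> to the neighbour of \<open>b\<close>, so \<open>a\<close> takes
    the role of the centre.\<close>
  have "tripod_on (set (W @ Q)) c b a"
    using ip W notin dist indep aW cWQ bWQ E_commute by (intro tripod_centre) auto
  then show ?thesis
    by (simp add: Un_commute)
qed

text \<open>A shortest connection \<open>Q\<close> between neighbours of \<open>a\<close> and
  \<open>b\<close> and, if \<open>c\<close> does not see it, a shortest connection \<open>W\<close>
  from a neighbour of \<open>c\<close> to \<open>Q\<close> are together feasible, hence by
  minimality they are everything. The three alternatives differ in the terminal that ends the
  branch.\<close>

theorem minimal_tripod:
  assumes feas: "feasible I a b c"
    and min: "\<And>J. J \<subseteq> I \<Longrightarrow> feasible J a b c \<Longrightarrow> J = I"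
    and notin: "{a, b, c} \<inter> I = {}" and dist: "a \<noteq> b" "a \<noteq> c" "b \<noteq> c"
    and indep: "\<not> E a b" "\<not> E a c" "\<not> E b c"
  shows "tripod_on I a b c \<or> tripod_on I c b a \<or> tripod_on I c a b"
proof -
  have conn: "conn I" and nb: "{u. E a u} \<inter> I \<noteq> {}" "{u. E b u} \<inter> I \<noteq> {}" "{u. E c u} \<inter> I \<noteq> {}"
    using feas by (auto simp: feasible_def)
  from ipath_between[OF conn nb(1,2)] obtain Q where Q: "Q \<noteq> []" "ipath Q" "set Q \<subseteq> I"
    and a: "\<And>i. i < length Q \<Longrightarrow> E a (Q ! i) \<longleftrightarrow> i = 0"
    and b: "\<And>i. i < length Q \<Longrightarrow> E b (Q ! i) \<longleftrightarrow> Suc i = length Q"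
    by (metis (no_types, lifting) mem_Collect_eq)
  have hdQ: "E a (hd Q)" and lastQ: "E b (last Q)"
    using a[of 0] b[of "length Q - 1"] Q by (auto simp: last_conv_nth hd_conv_nth)
  show ?thesis
  proof (cases "\<exists>u\<in>set Q. E c u")
    case True
    then have "feasible (set Q) a b c"
      using hdQ lastQ Q conn_ipath[OF Q(2)] feasibleI[of "set Q" a "hd Q" b "last Q" c] by auto
    then have "I = set Q"
      using min Q by blast
    moreover have "tripod_on (set Q) a b c"
      using True Q a b notin dist indep by (intro tripod_centre) auto
    ultimately show ?thesis by simp
  next
    case cQ: False
    \<comment> \<open>The target is the closed neighbourhood of \<open>Q\<close> and not
      \<open>Q\<close> itself, so that \<open>W\<close> stops one step before \<open>Q\<close> and
      only its last vertex sees \<open>Q\<close>.\<close>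
    let ?Y = "{w. \<exists>q\<in>set Q. w = q \<or> E q w}"
    have "?Y \<inter> I \<noteq> {}"
      using Q hd_in_set[OF Q(1)] by blast
    from ipath_between[OF conn nb(3) this] obtain W where W: "W \<noteq> []" "ipath W" "set W \<subseteq> I"
      and c: "\<And>i. i < length W \<Longrightarrow> E c (W ! i) \<longleftrightarrow> i = 0"
      and y: "\<And>i. i < length W \<Longrightarrow> W ! i \<in> ?Y \<longleftrightarrow> Suc i = length W"
      by (metis (no_types, lifting) mem_Collect_eq)
    \<comment> \<open>A vertex of \<open>W\<close> on \<open>Q\<close> would have a predecessor that
      already lies in \<open>?Y\<close>; and the first vertex of \<open>W\<close> is a neighbour of
      \<open>c\<close>, which sees nothing on \<open>Q\<close>.\<close>
    have WQ: "W ! i \<notin> set Q" if i: "i < length W" for i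
    proof
      assume q: "W ! i \<in> set Q"
      show False
      proof (cases i)
        case 0
        then show False using c[OF i] cQ q by auto
      next
        case (Suc j)
        then have "E (W ! i) (W ! j)"
          using ipath_edge[OF W(2)] i by simp
        then have "W ! j \<in> ?Y"
          using q by blast
        then show False
          using y[of j] Suc i by simp
      qed
    qed
    then have disj: "set Q \<inter> set W = {}"
      by (metis disjoint_iff in_set_conv_nth)
    define z where "z = last W"
    have z: "z \<in> set W" "z = W ! (length W - 1)"
      using W by (auto simp: z_def last_conv_nth)
    have cross: "Suc j = length W" if "i < length Q" "j < length W" "E (Q ! i) (W ! j)" for i j
      using y[OF that(2)] that nth_mem[OF that(1)] by blast
    define D where "D = {i. i < length Q \<and> E (Q ! i) z}"
    have finD: "finite D" by (simp add: D_def)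
    have "D \<noteq> {}"
    proof -
      have "z \<in> ?Y"
        using y[of "length W - 1"] W z(2) by simp
      then obtain q where "q \<in> set Q" "E q z"
        using z disj by blast
      then show ?thesis
        by (force simp: D_def in_set_conv_nth)
    qed
    define f l where "f = Min D" and "l = Max D"
    have fD: "f \<in> D" and lD: "l \<in> D" and fl: "\<And>i. i \<in> D \<Longrightarrow> f \<le> i \<and> i \<le> l"
      using finD \<open>D \<noteq> {}\<close> by (auto simp: f_def l_def)
    have fQ: "f < length Q" "E (Q ! f) z" and lQ: "l < length Q" "E (Q ! l) z"
      using fD lD by (auto simp: D_def)
    have hdW: "E c (hd W)"
      using c[of 0] W by (simp add: hd_conv_nth)
    have IQW: "I = set Q \<union> set W"
    proof -
      have "conn (set Q \<union> set W)"
        using conn_Un[of "set Q" "set W" "Q ! f" z] conn_ipath Q W fQ z by simp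
      then have "feasible (set Q \<union> set W) a b c"
        using hdQ lastQ hdW Q W feasibleI[of "set Q \<union> set W" a "hd Q" b "last Q" c "hd W"] by auto
      then show ?thesis using min Q W by blast
    qed
    \<comment> \<open>If the branch saw two vertices of \<open>Q\<close> more than one step apart,
      the part of \<open>Q\<close> strictly between them could be left out, with the branch as a
      bridge.\<close>
    have lf: "l \<le> Suc f"
    proof (rule ccontr)
      assume "\<not> l \<le> Suc f"
      let ?A = "set (take (Suc f) Q)" and ?B = "set (drop l Q)"
      have Qf: "Q ! f \<in> ?A" and Ql: "Q ! l \<in> ?B"
        using fQ lQ nth_mem_drop by (auto simp: take_Suc_conv_app_nth)
      have "conn (?A \<union> set W)"
        using conn_Un[of ?A "set W" "Q ! f" z] Qf fQ z conn_ipath ipath_take Q W by blast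
      then have "conn (?A \<union> set W \<union> ?B)"
        using conn_Un[of "?A \<union> set W" ?B z "Q ! l"] Ql lQ z conn_ipath ipath_drop Q sym by blast
      moreover have "hd Q \<in> ?A" "last Q \<in> ?B"
        using lQ Q last_in_set[of "drop l Q"] by (cases Q; simp)+
      ultimately have "feasible (?A \<union> set W \<union> ?B) a b c"
        using hdQ lastQ hdW Q W feasibleI[of "?A \<union> set W \<union> ?B" a "hd Q" b "last Q" c "hd W"] by auto
      from min[OF _ this] have sub: "set Q \<subseteq> ?A \<union> set W \<union> ?B"
        using IQW set_take_subset[of "Suc f" Q] set_drop_subset[of l Q] by blast
      moreover have "Q ! Suc f \<in> set Q"
        using lQ \<open>\<not> l \<le> Suc f\<close> by simp
      ultimately have "Q ! Suc f \<in> ?A \<union> ?B"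
        using disj by blast
      then show False
        using ipath_distinct[OF Q(2)] lQ \<open>\<not> l \<le> Suc f\<close>
        by (force simp: in_set_conv_nth nth_eq_iff_index_eq)
    qed
    have notin': "{a, b, c} \<inter> (set Q \<union> set W) = {}"
      using notin IQW by simp
    consider (a) w where "w \<in> set W" "E a w" | (b) w where "w \<in> set W" "E b w"
      | (no) "\<And>w. w \<in> set W \<Longrightarrow> \<not> E a w \<and> \<not> E b w"
      by blast
    then show ?thesis
    proof cases
      case a: (a w)
      have "tripod_on (set Q \<union> set W) c b a"
        by (rule tripod_attached_end[of Q W a b c l w])
          (use Q W disj notin' dist indep \<open>\<And>i. i < length Q \<Longrightarrow> E a (Q ! i) \<longleftrightarrow> i = 0\<close> b cQ c cross lQ a
            min IQW in \<open>auto simp: z_def\<close>)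
      then show ?thesis using IQW by simp
    next
      \<comment> \<open>The mirror image of the previous case: \<open>Q\<close> is reversed and
        \<open>a\<close>, \<open>b\<close> are exchanged.\<close>
      case bw: (b w)
      have "tripod_on (set (rev Q) \<union> set W) c a b"
      proof (rule tripod_attached_end[of "rev Q" W b a c "length Q - 1 - f" w])
        show "E b (rev Q ! i) \<longleftrightarrow> i = 0" if "i < length (rev Q)" for i
          using that b[of "length Q - 1 - i"] by (auto simp: rev_nth)
        show "E a (rev Q ! i) \<longleftrightarrow> Suc i = length (rev Q)" if "i < length (rev Q)" for i
          using that a[of "length Q - 1 - i"] by (auto simp: rev_nth)
        show "Suc j = length W" if "i < length (rev Q)" "j < length W" "E (rev Q ! i) (W ! j)" for i j
          using that cross[of "length Q - 1 - i" j] by (auto simp: rev_nth)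
        show "E (rev Q ! (length Q - 1 - f)) (last W)"
          using fQ by (simp add: rev_nth z_def)
        show "J = set (rev Q) \<union> set W" if "J \<subseteq> set (rev Q) \<union> set W" "feasible J b a c" for J
          using min[of J] that IQW by (auto simp: feasible_def)
      qed (use Q W disj notin' dist indep cQ c bw fQ sym in \<open>auto simp: ipath_rev\<close>)
      then show ?thesis using IQW by simp
    next
      case no
      let ?M = "a # Q @ [b]" and ?Z = "rev W @ [c]" and ?N = "Suc ` D"
      have "ipath ?M"
        using Q a b notin' dist indep by (intro ipath_ends) auto
      moreover have "ipath ?Z"
        using W c notin' ipath_rev[OF ipath_Cons[of W c]] by auto
      moreover have "E (?M ! i) (?Z ! j) \<longleftrightarrow> j = 0 \<and> i \<in> ?N" if i: "i < length ?M" and j: "j < length ?Z" for i j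
      proof -
        have Zj: "?Z ! j = (if j < length W then W ! (length W - 1 - j) else c)"
          using j by (auto simp: nth_append rev_nth)
        have NL: "length Q \<notin> D" by (simp add: D_def)
        have Q': "E (Q ! i') (?Z ! j) \<longleftrightarrow> j = 0 \<and> i' \<in> D" if i': "i' < length Q" for i'
        proof (cases "j < length W")
          case True
          then have Z: "?Z ! j = W ! (length W - 1 - j)"
            using Zj by simp
          show ?thesis
            using cross[OF i', of "length W - 1 - j"] True W(1) i'
            unfolding Z by (cases "j = 0") (auto simp: D_def z(2))
        next
          case False
          then show ?thesis
            using i' W(1) cQ E_commute[of c] by (auto simp: Zj)
        qed
        have ab: "\<not> E a (?Z ! j)" "\<not> E b (?Z ! j)"
          using no[of "W ! (length W - 1 - j)"] indep by (auto simp: Zj)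
        show ?thesis
        proof (cases i)
          case 0
          then show ?thesis using ab by auto
        next
          case (Suc i')
          then show ?thesis
            using i ab Q'[of i'] NL by (cases "i' < length Q") (auto simp: nth_append less_Suc_eq image_iff)
        qed
      qed
      \<comment> \<open>\<open>W\<close> is nonempty, so \<open>?Z\<close> has a vertex before
        \<open>c\<close>; this is what the triangle alternative of \<open>tripod\<close> asks
        for.\<close>
      moreover have "(\<exists>m. ?N = {m}) \<or> (\<exists>m. ?N = {m, Suc m} \<and> 1 < length ?Z)"
      proof -
        have "D \<subseteq> {f, Suc f}"
          using fl lf by force
        then have "D = {f} \<or> D = {f, Suc f}"
          using fD by blast
        then show ?thesis using W(1) by auto
      qed
      moreover have "?N \<subseteq> {0<..<length ?M - 1}"
        by (auto simp: D_def)
      moreover have "set ?M \<inter> set ?Z = {}"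
        using disj notin' dist by auto
      moreover have "?Z \<noteq> []"
        by simp
      ultimately have "tripod ?M ?Z ?N"
        unfolding tripod_def branched_def by blast
      moreover have "set ?M \<union> set ?Z = I \<union> {a, b, c}"
        using IQW by auto
      ultimately have "tripod_on I a b c"
        by (rule tripod_onI) simp_all
      then show ?thesis by simp
    qed
  qed
qed

text \<open>Testing single deletions suffices although feasibility is not monotone. A feasible
  proper subset of the connected set \<open>I\<close> has a neighbour in the rest of
  \<open>I\<close>, and adding it keeps feasibility; a largest feasible proper subset above
  \<open>J\<close> therefore misses just one vertex.\<close>

lemma feasible_minimal:
  assumes fin: "finite I" and feas: "feasible I a b c"
    and del: "\<And>w. w \<in> I \<Longrightarrow> \<not> feasible (I - {w}) a b c"
    and J: "J \<subseteq> I" "feasible J a b c"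
  shows "J = I"
proof (rule ccontr)
  assume "J \<noteq> I"
  define P where "P K \<longleftrightarrow> J \<subseteq> K \<and> K \<subset> I \<and> feasible K a b c" for K
  have "P J"
    using J \<open>J \<noteq> I\<close> by (auto simp: P_def)
  have "card K < Suc (card I)" if "P K" for K
    using that fin card_mono[of I K] by (auto simp: P_def)
  then have "\<exists>K. P K \<and> (\<forall>L. P L \<longrightarrow> card L \<le> card K)"
    using ex_has_greatest_nat[of P J card "Suc (card I)"] \<open>P J\<close> by (simp add: less_imp_le)
  then obtain K where PK: "P K" and max: "\<And>L. P L \<Longrightarrow> card L \<le> card K"
    by auto
  then have K: "J \<subseteq> K" "K \<subset> I" "feasible K a b c"
    by (simp_all add: P_def)
  have "K \<noteq> {}"
    using K by (auto simp: feasible_def)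
  then obtain u w where uw: "u \<in> K" "w \<in> I" "E u w" "w \<notin> K"
    using K feas conn_closed[of I K] by (auto simp: feasible_def)
  have ins: "feasible (insert w K) a b c"
    using K uw conn_insert[of K u w] by (auto simp: feasible_def)
  have "finite K"
    using K fin by (auto intro: finite_subset)
  have "insert w K = I"
  proof (rule ccontr)
    assume "insert w K \<noteq> I"
    then have "P (insert w K)"
      using K uw ins by (auto simp: P_def)
    from max[OF this] show False
      using uw \<open>finite K\<close> by simp
  qed
  then have "K = I - {w}"
    using uw by blast
  then show False
    using del[OF uw(2)] K by simp
qed

end

text \<open>The map leads from the model into the host, because it is given by a formula in the
  coordinates of the model; the isomorphism is its inverse.\<close>

lemma digraph_isoI:
  fixes G :: "'a pair_pre_digraph" and H :: "'b pair_pre_digraph"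
  assumes G: "pair_wf_digraph G"
    and H: "\<And>p q. (p, q) \<in> parcs H \<Longrightarrow> p \<in> pverts H \<and> q \<in> pverts H"
    and inj: "inj_on f (pverts H)" and img: "f ` pverts H = U" and U: "U \<subseteq> pverts G"
    and arcs: "\<And>p q. p \<in> pverts H \<Longrightarrow> q \<in> pverts H \<Longrightarrow> (f p, f q) \<in> parcs G \<longleftrightarrow> (p, q) \<in> parcs H"
  shows "digraph_iso (with_proj G \<restriction> U) (with_proj H)"
proof -
  let ?g = "the_inv_into (pverts H) f"
  let ?G = "with_proj G \<restriction> U"
  let ?hom = "\<lparr>iso_verts = ?g, iso_arcs = map_prod ?g ?g, iso_head = snd, iso_tail = fst\<rparr>"
  have bij: "bij_betw ?g U (pverts H)"
    using inj img by (intro bij_betw_the_inv_into) (simp add: bij_betw_def)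
  have fg: "?g (f p) = p" if "p \<in> pverts H" for p
    using the_inv_into_f_f[OF inj that] .
  have gf: "f (?g u) = u" "?g u \<in> pverts H" if "u \<in> U" for u
    using f_the_inv_into_f[OF inj, of u] bij_betwE[OF bij] that img by auto
  have inj': "inj_on ?g U"
    using bij by (simp add: bij_betw_def)
  have wf: "wf_digraph ?G"
    by (rule wf_digraph.intro) auto
  have "inj_on (map_prod ?g ?g) (U \<times> U)"
    using map_prod_inj_on[OF inj' inj'] .
  then have "inj_on (map_prod ?g ?g) (arcs ?G)"
    by (rule inj_on_subset) auto
  then have "pre_digraph.digraph_isomorphism ?G ?hom"
    using wf inj' by (auto simp: pre_digraph.digraph_isomorphism_def)
  moreover have "with_proj H = app_iso ?hom ?G"
  proof -
    have "pverts H = ?g ` U"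
      using bij by (simp add: bij_betw_def)
    moreover have "parcs H = map_prod ?g ?g ` {e \<in> parcs G. fst e \<in> U \<and> snd e \<in> U}"
    proof (intro subset_antisym subsetI)
      fix e
      assume "e \<in> parcs H"
      then obtain p q where e: "e = (p, q)" "(p, q) \<in> parcs H"
        by (cases e) simp
      then have "(f p, f q) \<in> parcs G" "p \<in> pverts H" "q \<in> pverts H"
        using arcs H by blast+
      then show "e \<in> map_prod ?g ?g ` {e \<in> parcs G. fst e \<in> U \<and> snd e \<in> U}"
        using fg img e by (intro image_eqI[of _ _ "(f p, f q)"]) auto
    next
      fix e
      assume "e \<in> map_prod ?g ?g ` {e \<in> parcs G. fst e \<in> U \<and> snd e \<in> U}"
      then obtain u v where "e = (?g u, ?g v)" "(u, v) \<in> parcs G" "u \<in> U" "v \<in> U"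
        by auto
      then show "e \<in> parcs H"
        using arcs[of "?g u" "?g v"] gf by simp
    qed
    ultimately show ?thesis
      by (simp add: with_proj_def app_iso_def)
  qed
  ultimately show ?thesis
    unfolding digraph_iso_def by blast
qed

section \<open>Prolonging tripods by legs\<close>

context ugraph
begin

lemma ipath_attach:
  assumes M: "ipath M" "M \<noteq> []" and r: "ipath (last M # r)" "set r \<inter> set M = {}"
    and sep: "\<And>u w. u \<in> set r \<Longrightarrow> w \<in> set M \<Longrightarrow> w \<noteq> last M \<Longrightarrow> \<not> E u w"
  shows "ipath (M @ r)"
proof (rule ipath_append[OF M(1)])
  show "ipath r"
    using ipath_drop[OF r(1), of 1] by simp
  show "set M \<inter> set r = {}"
    using r by blast
  fix i j
  assume i: "i < length M" and j: "j < length r"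
  have "E (last M) (r ! j) \<longleftrightarrow> j = 0"
    using ipath_edge[OF r(1), of 0 "Suc j"] j by auto
  moreover have "M ! i = last M \<longleftrightarrow> Suc i = length M"
    using ipath_distinct[OF M(1)] M(2) i nth_eq_iff_index_eq[of M i "length M - 1"] by (auto simp: last_conv_nth)
  moreover have "\<not> E (M ! i) (r ! j)" if "M ! i \<noteq> last M"
    using sep[of "r ! j" "M ! i"] that i j sym by auto
  ultimately show "E (M ! i) (r ! j) \<longleftrightarrow> Suc i = length M \<and> j = 0"
    by auto
qed

text \<open>The edge from \<open>t\<close> to the first vertex of \<open>r\<close> is part of the
  induced path; the remaining conditions only forbid further contact with \<open>S\<close>. The list
  \<open>r\<close> may be empty, which happens for \<open>k = 1\<close>.\<close>

definition pendant :: "'a set \<Rightarrow> 'a \<Rightarrow> 'a list \<Rightarrow> bool" where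
  "pendant S t r \<longleftrightarrow> ipath (t # r) \<and> set r \<inter> S = {} \<and> (\<forall>u\<in>set r. \<forall>w\<in>S. w \<noteq> t \<longrightarrow> \<not> E u w)"

definition apart :: "'a set \<Rightarrow> 'a set \<Rightarrow> bool" where
  "apart X Y \<longleftrightarrow> X \<inter> Y = {} \<and> (\<forall>u\<in>X. \<forall>w\<in>Y. \<not> E u w)"

lemma apart_commute: "apart X Y \<longleftrightarrow> apart Y X"
  unfolding apart_def using sym by blast

text \<open>The legs only touch the ends of the two paths, so the meeting place is untouched. The
  leg at \<open>a\<close> is put in front of \<open>M\<close>, which shifts the positions in
  \<open>N\<close> by its length.\<close>

lemma branched_extend:
  assumes br: "branched M Z N" and M: "M \<noteq> []" "hd M = a" "last M = b" and Z: "last Z = c"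
    and S: "S = set M \<union> set Z"
    and pend: "pendant S a ra" "pendant S b rb" "pendant S c rc"
    and ap: "apart (set ra) (set rb)" "apart (set ra) (set rc)" "apart (set rb) (set rc)"
  shows "branched (rev ra @ M @ rb) (Z @ rc) ((+) (length ra) ` N)"
proof -
  have ipM: "ipath M" and ipZ: "ipath Z" "Z \<noteq> []" and disj: "set M \<inter> set Z = {}"
    and cross: "\<And>i j. i < length M \<Longrightarrow> j < length Z \<Longrightarrow> E (M ! i) (Z ! j) \<longleftrightarrow> j = 0 \<and> i \<in> N"
    and N: "N \<subseteq> {0<..<length M - 1}"
    using br by (auto simp: branched_def)
  have bM: "b \<in> set M" and aM: "a \<in> set M" and cZ: "c \<in> set Z"
    using M Z ipZ by auto
  have MS: "set M \<subseteq> S" "set Z \<subseteq> S"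
    using S by auto
  have p: "set r \<inter> S = {}" "ipath (t # r)" "\<And>u w. u \<in> set r \<Longrightarrow> w \<in> S \<Longrightarrow> w \<noteq> t \<Longrightarrow> \<not> E u w"
    if "pendant S t r" for t r
    using that by (auto simp: pendant_def)
  have "ipath (M @ rb)"
    using p[OF pend(2)] M ipM MS by (intro ipath_attach) auto
  then have "ipath (rev (M @ rb) @ ra)"
  proof (intro ipath_attach)
    show "\<not> E u w" if "u \<in> set ra" "w \<in> set (rev (M @ rb))" "w \<noteq> last (rev (M @ rb))" for u w
      using that p(3)[OF pend(1), of u w] ap(1) M MS by (auto simp: apart_def last_rev)
    show "set ra \<inter> set (rev (M @ rb)) = {}"
      using p(1)[OF pend(1)] MS ap(1) by (auto simp: apart_def)
    show "ipath (last (rev (M @ rb)) # ra)"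
      using p(2)[OF pend(1)] M by (simp add: last_rev)
  qed (use M ipath_rev[of "M @ rb"] in auto)
  then have "ipath (rev (rev (M @ rb) @ ra))"
    by (rule ipath_rev)
  then have ipM': "ipath (rev ra @ M @ rb)"
    by simp
  have ipZ': "ipath (Z @ rc)"
    using p[OF pend(3)] Z ipZ MS by (intro ipath_attach) auto
  have aZ: "a \<notin> set Z" "b \<notin> set Z" "c \<notin> set M"
    using disj aM bM cZ by auto
  have ab_Z: "\<not> E u w \<and> u \<noteq> w" if "u \<in> set ra \<union> set rb" "w \<in> set Z \<union> set rc" for u w
    using that p[OF pend(1)] p[OF pend(2)] aZ MS ap unfolding apart_def by blast
  have M_c: "\<not> E u w \<and> u \<noteq> w" if "u \<in> set M" "w \<in> set rc" for u w
    using that p[OF pend(3)] aZ MS sym by blast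
  have cross': "E ((rev ra @ M @ rb) ! i) ((Z @ rc) ! j) \<longleftrightarrow> j = 0 \<and> i \<in> (+) (length ra) ` N"
    if i: "i < length (rev ra @ M @ rb)" and j: "j < length (Z @ rc)" for i j
  proof -
    have Zj: "(Z @ rc) ! j \<in> set Z \<union> set rc"
      using nth_mem[OF j] by simp
    consider "i < length ra" | i' where "i = length ra + i'" "i' < length M"
      | i' where "i = length ra + length M + i'" "i' < length rb"
    proof (cases "i < length ra + length M")
      case True
      then show ?thesis
        using that(1) that(2)[of "i - length ra"] by (cases "i < length ra") auto
    next
      case False
      then show ?thesis
        using that(3)[of "i - length ra - length M"] i by auto
    qed
    then show ?thesis
    proof cases
      case 1
      then have "(rev ra @ M @ rb) ! i \<in> set ra"
        by (auto simp: nth_append rev_nth)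
      then show ?thesis
        using ab_Z[OF _ Zj] 1 by auto
    next
      case 2
      have "E (M ! i') ((Z @ rc) ! j) \<longleftrightarrow> j = 0 \<and> i' \<in> N"
      proof (cases "j < length Z")
        case True
        then show ?thesis using cross[OF 2(2) True] by (simp add: nth_append)
      next
        case False
        then have "(Z @ rc) ! j \<in> set rc"
          using j by (auto simp: nth_append)
        then show ?thesis
          using M_c[of "M ! i'"] 2 False ipZ by auto
      qed
      then show ?thesis
        using 2 by (auto simp: nth_append)
    next
      case 3
      then have "(rev ra @ M @ rb) ! i \<in> set rb"
        by (auto simp: nth_append)
      then show ?thesis
        using ab_Z[OF _ Zj] 3 subsetD[OF N, of "length M + i'"] by auto
    qed
  qed
  have "u \<notin> set (Z @ rc)" if "u \<in> set (rev ra @ M @ rb)" for u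
    using that ab_Z[of u u] M_c[of u u] disj by auto
  then have "set (rev ra @ M @ rb) \<inter> set (Z @ rc) = {}"
    by blast
  moreover have "(+) (length ra) ` N \<subseteq> {0<..<length (rev ra @ M @ rb) - 1}"
    by (auto dest!: subsetD[OF N])
  ultimately show ?thesis
    using ipM' ipZ' ipZ cross' unfolding branched_def by blast
qed

end

section \<open>Copies of the model graphs inside the host graph\<close>

text \<open>A list \<open>M\<close> is read off as the function \<open>i \<mapsto> M ! i\<close> on the vertices of the model graphs.\<close>

locale host = pair_graph G for G :: "'a pair_pre_digraph" +
  fixes E
  defines "E \<equiv> \<lambda>u v. (u, v) \<in> parcs G"
begin

sublocale ugraph E
proof
  show "E v u" if "E u v" for u v
    using that pair_sym_arcs by (auto simp: E_def symmetric_def elim: symE)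
  show "\<not> E u u" for u
    using pair_no_loops[of "(u, u)"] by (auto simp: E_def)
qed

text \<open>A full table of adjacency and equality, with both orientations, so that rewriting turns
  every question about vertices of \<open>M\<close> and \<open>Z\<close> into arithmetic on
  positions. The isomorphism proofs rest on it.\<close>

lemma branchedD:
  assumes "branched M Z N"
  shows "\<And>i j. i < length M \<Longrightarrow> j < length M \<Longrightarrow> (M ! i, M ! j) \<in> parcs G \<longleftrightarrow> i = Suc j \<or> j = Suc i"
    and "\<And>i j. i < length Z \<Longrightarrow> j < length Z \<Longrightarrow> (Z ! i, Z ! j) \<in> parcs G \<longleftrightarrow> i = Suc j \<or> j = Suc i"
    and "\<And>i j. i < length M \<Longrightarrow> j < length Z \<Longrightarrow> (M ! i, Z ! j) \<in> parcs G \<longleftrightarrow> j = 0 \<and> i \<in> N"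
    and "\<And>i j. i < length M \<Longrightarrow> j < length Z \<Longrightarrow> (Z ! j, M ! i) \<in> parcs G \<longleftrightarrow> j = 0 \<and> i \<in> N"
    and "\<And>i j. i < length M \<Longrightarrow> j < length M \<Longrightarrow> M ! i = M ! j \<longleftrightarrow> i = j"
    and "\<And>i j. i < length Z \<Longrightarrow> j < length Z \<Longrightarrow> Z ! i = Z ! j \<longleftrightarrow> i = j"
    and "\<And>i j. i < length M \<Longrightarrow> j < length Z \<Longrightarrow> M ! i \<noteq> Z ! j"
    and "\<And>i j. i < length M \<Longrightarrow> j < length Z \<Longrightarrow> Z ! j \<noteq> M ! i"
proof -
  have *: "ipath M" "ipath Z" "set M \<inter> set Z = {}"
    "\<And>i j. i < length M \<Longrightarrow> j < length Z \<Longrightarrow> E (M ! i) (Z ! j) \<longleftrightarrow> j = 0 \<and> i \<in> N"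
    using assms by (auto simp: branched_def)
  fix i j
  show "(M ! i, M ! j) \<in> parcs G \<longleftrightarrow> i = Suc j \<or> j = Suc i" if "i < length M" "j < length M"
    using ipath_edge[OF *(1)] that by (simp add: E_def)
  show "(Z ! i, Z ! j) \<in> parcs G \<longleftrightarrow> i = Suc j \<or> j = Suc i" if "i < length Z" "j < length Z"
    using ipath_edge[OF *(2)] that by (simp add: E_def)
  show "M ! i = M ! j \<longleftrightarrow> i = j" if "i < length M" "j < length M"
    using ipath_distinct[OF *(1)] that by (simp add: nth_eq_iff_index_eq)
  show "Z ! i = Z ! j \<longleftrightarrow> i = j" if "i < length Z" "j < length Z"
    using ipath_distinct[OF *(2)] that by (simp add: nth_eq_iff_index_eq)
  assume i: "i < length M" and j: "j < length Z"
  show e: "(M ! i, Z ! j) \<in> parcs G \<longleftrightarrow> j = 0 \<and> i \<in> N"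
    using *(4)[OF i j] by (simp add: E_def)
  show "(Z ! j, M ! i) \<in> parcs G \<longleftrightarrow> j = 0 \<and> i \<in> N"
    using e E_commute[of "M ! i"] by (simp add: E_def)
  have "M ! i \<in> set M" "Z ! j \<in> set Z"
    using i j by simp_all
  then show "M ! i \<noteq> Z ! j" "Z ! j \<noteq> M ! i"
    using *(3) by (metis disjoint_iff)+
qed

lemma S_iso:
  assumes br: "branched M Z {m}" and k: "1 \<le> k" "k \<le> m" "m + k < length M" "k \<le> length Z"
    and U: "U = (!) M ` {m - k..m + k} \<union> (!) Z ` {..<k}" and sub: "U \<subseteq> pverts G"
  shows "digraph_iso (with_proj G \<restriction> U) (S_graph k)"
proof (rule digraph_isoI)
  \<comment> \<open>The centre \<open>(0, 0)\<close> and the first arm share the formula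
    \<open>M ! (m - j)\<close>. The first vertex of \<open>Z\<close> is at distance 1 from the
    centre, hence \<open>j - 1\<close> on the third arm.\<close>
  let ?f = "\<lambda>(i, j). if i \<le> 1 then M ! (m - j) else if i = 2 then M ! (m + j) else Z ! (j - 1)"
  note D = branchedD[OF br]
  have V: "p \<in> pverts (S_graph k) \<longleftrightarrow> p = (0, 0) \<or> (\<exists>j. 1 \<le> j \<and> j \<le> k \<and> (p = (1, j) \<or> p = (2, j) \<or> p = (3, j)))" for p
    by (cases p) (auto simp: S_graph_def)
  have A: "((i, j), (i', j')) \<in> parcs (S_graph k) \<longleftrightarrow>
      i = 0 \<and> j = 0 \<and> i' \<in> {1, 2, 3} \<and> j' = 1 \<or> i' = 0 \<and> j' = 0 \<and> i \<in> {1, 2, 3} \<and> j = 1 \<or>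
      i = i' \<and> i \<in> {1, 2, 3} \<and> (1 \<le> j \<and> j < k \<and> j' = Suc j \<or> 1 \<le> j' \<and> j' < k \<and> j = Suc j')" for i j i' j'
    by (auto simp: S_graph_def symcl_def)
  show "inj_on ?f (pverts (S_graph k))"
    using k by (intro inj_onI) (auto simp: V D)
  show "?f ` pverts (S_graph k) = U"
  proof (intro set_eqI iffI)
    fix u assume "u \<in> ?f ` pverts (S_graph k)"
    moreover have "M ! (m - j) \<in> (!) M ` {m - k..m + k}" if "j \<le> k" for j
      using that by (intro imageI) (simp add: trans_le_add1 diff_le_mono2)
    ultimately show "u \<in> U"
      using k by (auto simp: V U)
  next
    fix u assume "u \<in> U"
    then consider i where "u = M ! i" "m - k \<le> i" "i < m" | "u = M ! m" | i where "u = M ! i" "m < i" "i \<le> m + k"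
      | i where "u = Z ! i" "i < k"
      by (auto simp: U) (metis nat_neq_iff)
    then show "u \<in> ?f ` pverts (S_graph k)"
    proof cases
      case 1
      then show ?thesis using k by (intro image_eqI[of _ _ "(1, m - i)"]) (auto simp: V)
    next
      case 2
      then show ?thesis by (intro image_eqI[of _ _ "(0, 0)"]) (auto simp: V)
    next
      case 3
      then show ?thesis by (intro image_eqI[of _ _ "(2, i - m)"]) (auto simp: V)
    next
      case 4
      then show ?thesis by (intro image_eqI[of _ _ "(3, Suc i)"]) (auto simp: V)
    qed
  qed
  show "p \<in> pverts (S_graph k) \<and> q \<in> pverts (S_graph k)" if "(p, q) \<in> parcs (S_graph k)" for p q
    using that k by (cases p; cases q) (auto simp: A V)
  fix p q
  assume p: "p \<in> pverts (S_graph k)" and q: "q \<in> pverts (S_graph k)"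
  show "(?f p, ?f q) \<in> parcs G \<longleftrightarrow> (p, q) \<in> parcs (S_graph k)"
    using p q k unfolding V 
    apply (elim disjE exE conjE; hypsubst)
    apply (simp_all only: split_beta fst_conv snd_conv option.case if_True if_False)
    apply (simp_all add: D A)
    apply linarith+
    done
qed (use sub pair_wf_digraph_axioms in auto)

lemma T_iso:
  assumes br: "branched M Z {m, Suc m}" and k: "1 \<le> k" "k \<le> m" "Suc m + k < length M" "k < length Z"
    and U: "U = (!) M ` {m - k..Suc m + k} \<union> (!) Z ` {..k}" and sub: "U \<subseteq> pverts G"
  shows "digraph_iso (with_proj G \<restriction> U) (T_graph k)"
proof (rule digraph_isoI)
  \<comment> \<open>Now \<open>Z ! 0\<close> is a corner of the triangle itself, so the third arm is
    not shifted and takes \<open>k + 1\<close> vertices of \<open>Z\<close>.\<close>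
  let ?f = "\<lambda>(i, j). if i = 0 then M ! (m - j) else if i = (1::nat) then M ! (Suc m + j) else Z ! j"
  note D = branchedD[OF br]
  have V: "p \<in> pverts (T_graph k) \<longleftrightarrow> (\<exists>j\<le>k. p = (0, j) \<or> p = (1, j) \<or> p = (2, j))" for p
    by (cases p) (auto simp: T_graph_def attach_paths_def triangle_def)
  have A: "((i, j), (i', j')) \<in> parcs (T_graph k) \<longleftrightarrow>
      i \<in> {0, 1, 2} \<and> i' \<in> {0, 1, 2} \<and> (if i = i' then j < k \<and> j' = Suc j \<or> j' < k \<and> j = Suc j'
        else j = 0 \<and> j' = 0)" for i j i' j'
    by (auto simp: T_graph_def attach_paths_def triangle_def symcl_def)
  show "inj_on ?f (pverts (T_graph k))"
    using k by (intro inj_onI) (auto simp: V D)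
  show "?f ` pverts (T_graph k) = U"
  proof (intro set_eqI iffI)
    fix u assume "u \<in> ?f ` pverts (T_graph k)"
    moreover have "M ! (m - j) \<in> (!) M ` {m - k..Suc m + k}" if "j \<le> k" for j
      using that by (intro imageI) (simp add: le_SucI trans_le_add1 diff_le_mono2)
    ultimately show "u \<in> U"
      using k by (auto simp: V U)
  next
    fix u assume "u \<in> U"
    then consider i where "u = M ! i" "m - k \<le> i" "i \<le> m" | i where "u = M ! i" "Suc m \<le> i" "i \<le> Suc m + k"
      | i where "u = Z ! i" "i \<le> k"
      by (auto simp: U) (metis not_less_eq_eq)
    then show "u \<in> ?f ` pverts (T_graph k)"
    proof cases
      case 1
      then show ?thesis using k by (intro image_eqI[of _ _ "(0, m - i)"]) (auto simp: V)
    next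
      case 2
      then show ?thesis by (intro image_eqI[of _ _ "(1, i - Suc m)"]) (auto simp: V)
    next
      case 3
      then show ?thesis by (intro image_eqI[of _ _ "(2, i)"]) (auto simp: V)
    qed
  qed
  show "p \<in> pverts (T_graph k) \<and> q \<in> pverts (T_graph k)" if "(p, q) \<in> parcs (T_graph k)" for p q
    using that k by (cases p; cases q) (auto simp: A V split: if_splits)
  fix p q
  assume p: "p \<in> pverts (T_graph k)" and q: "q \<in> pverts (T_graph k)"
  show "(?f p, ?f q) \<in> parcs G \<longleftrightarrow> (p, q) \<in> parcs (T_graph k)"
    using p q k unfolding V 
    apply (elim disjE exE conjE; hypsubst)
    apply (simp_all only: split_beta fst_conv snd_conv option.case if_True if_False)
    apply (simp_all add: D A)
    apply linarith+
    done
qed (use sub pair_wf_digraph_axioms in auto)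

text \<open>The outer \<open>k - 1\<close> edges at both ends of \<open>M\<close> serve as legs; the
  bounds on \<open>N\<close> say that the centre \<open>Z ! 0\<close> sees only inner vertices of
  the path that remains between them.\<close>

lemma M_iso:
  assumes br: "branched M Z N" and k: "1 \<le> k" "length Z = k" "2 \<le> card N"
    and N: "N \<subseteq> {k - 1<..<length M - k}" and sub: "set M \<union> set Z \<subseteq> pverts G"
  shows "\<exists>H\<in>M_family k. digraph_iso (with_proj G \<restriction> (set M \<union> set Z)) H"
proof -
  define t where "t = k - 1"
  define l where "l = length M - 1 - 2 * t"
  define N' where "N' = (\<lambda>i. i - t) ` N"
  let ?P = "path_plus_centre l N'" and ?X = "{Some 0, Some l, None}"
  let ?H = "attach_paths ?P ?X t"
  \<comment> \<open>Two different elements of \<open>N\<close> inside the bounds force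
    \<open>1 < l\<close>, so that the two ends of the inner path are different extremities.\<close>
  have "\<not> is_singleton N" "N \<noteq> {}"
    using k(3) by (auto simp: is_singleton_altdef)
  then obtain x y where "x \<in> N" "y \<in> N" "x \<noteq> y"
    using is_singletonI'[of N] by blast
  then obtain m1 m2 where m12: "m1 \<in> N" "m2 \<in> N" "m1 < m2"
    using that[of x y] that[of y x] by (cases x y rule: linorder_cases) auto
  then have "k - 1 < m1" "m2 < length M - k"
    using N by auto
  then have len: "length M = 2 * t + l + 1" "1 < l"
    using m12 k(1) by (auto simp: t_def l_def)
  have N'': "N \<subseteq> {t<..<t + l}"
    using k(1) len by (auto simp: t_def dest!: subsetD[OF N])
  have "card N' = card N"
    unfolding N'_def using N'' by (intro card_image inj_onI) (auto dest!: subsetD)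
  moreover have "N' \<subseteq> {0<..<l}"
    using N'' by (auto simp: N'_def dest!: subsetD)
  ultimately have "(?P, ?X) \<in> M_class"
    using k(3) unfolding M_class_def by fastforce
  then have fam: "?H \<in> M_family k"
    unfolding M_family_def t_def by blast
  have N'_iff: "i \<in> N' \<longleftrightarrow> i + t \<in> N" for i
    using N'' by (force simp: N'_def image_iff)
  have N'_l: "i < l" "0 < i" if "i \<in> N'" for i
    using that N'' unfolding N'_iff by auto
  have N'_edge: "0 \<notin> N'" "l \<notin> N'" "l + i \<notin> N'" "i \<in> N \<longleftrightarrow> t \<le> i \<and> i - t \<in> N'" for i
    using N'' N'_l[of "l + i"] N'_l[of l] by (auto simp: N'_iff dest: N'_l)
  note D = branchedD[OF br, unfolded len]
  have lZ: "length Z = Suc t"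
    using k by (simp add: t_def)
  have A: "((x, j), (y, j')) \<in> parcs ?H \<longleftrightarrow>
      j = 0 \<and> j' = 0 \<and> (case (x, y) of (Some i, Some i') \<Rightarrow> i < l \<and> i' = Suc i \<or> i' < l \<and> i = Suc i'
        | (None, Some i) \<Rightarrow> i \<in> N' | (Some i, None) \<Rightarrow> i \<in> N' | (None, None) \<Rightarrow> False)
      \<or> x = y \<and> x \<in> ?X \<and> (j < t \<and> j' = Suc j \<or> j' < t \<and> j = Suc j')" for x j y j'
    by (cases x; cases y) (auto simp: attach_paths_def path_plus_centre_def symcl_def)
  \<comment> \<open>The inner path and the leg behind its end \<open>Some l\<close> share the
    formula \<open>M ! (t + i + j)\<close>; the leg at \<open>Some 0\<close> runs backwards.\<close>
  let ?f = "\<lambda>(x, j). case x of None \<Rightarrow> Z ! j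
    | Some i \<Rightarrow> if i = 0 then M ! (t - j) else M ! (t + i + j)"
  have V: "p \<in> pverts ?H \<longleftrightarrow> (\<exists>j\<le>t. p = (None, j)) \<or> (\<exists>j\<le>t. p = (Some 0, j)) \<or> (\<exists>j\<le>t. p = (Some l, j))
      \<or> (\<exists>i. 0 < i \<and> i < l \<and> p = (Some i, 0))" for p
    using len by (cases p) (auto simp: attach_paths_def path_plus_centre_def)
  have "digraph_iso (with_proj G \<restriction> (set M \<union> set Z)) ?H"
  proof (rule digraph_isoI)
    show "inj_on ?f (pverts ?H)"
      using len lZ by (intro inj_onI) (auto simp: V D)
    show "?f ` pverts ?H = set M \<union> set Z"
    proof (intro set_eqI iffI)
      fix u assume "u \<in> ?f ` pverts ?H"
      then show "u \<in> set M \<union> set Z"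
        using len lZ by (auto simp: V)
    next
      fix u assume "u \<in> set M \<union> set Z"
      then consider i where "u = M ! i" "i \<le> t" | i where "u = M ! i" "t < i" "i < t + l"
        | i where "u = M ! i" "t + l \<le> i" "i \<le> t + l + t" | i where "u = Z ! i" "i \<le> t"
        using len lZ by (auto simp: in_set_conv_nth less_Suc_eq_le) (metis not_le add.commute add.left_commute mult_2)
      then show "u \<in> ?f ` pverts ?H"
      proof cases
        case 1
        then show ?thesis by (intro image_eqI[of _ _ "(Some 0, t - i)"]) (auto simp: V)
      next
        case 2
        then show ?thesis by (intro image_eqI[of _ _ "(Some (i - t), 0)"]) (auto simp: V)
      next
        case 3
        then show ?thesis using len by (intro image_eqI[of _ _ "(Some l, i - t - l)"]) (auto simp: V)
      next
        case 4
        then show ?thesis by (intro image_eqI[of _ _ "(None, i)"]) (auto simp: V)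
      qed
    qed
    show "p \<in> pverts ?H \<and> q \<in> pverts ?H" if "(p, q) \<in> parcs ?H" for p q
      using that len N'_l by (cases p; cases q) (force simp: A V split: option.splits)
    fix p q
    assume p: "p \<in> pverts ?H" and q: "q \<in> pverts ?H"
    show "(?f p, ?f q) \<in> parcs G \<longleftrightarrow> (p, q) \<in> parcs ?H"
      using p q len lZ unfolding V 
    apply (elim disjE exE conjE; hypsubst)
    apply (simp_all only: split_beta fst_conv snd_conv option.case if_True if_False)
    apply (simp_all add: D A N'_edge)
    apply linarith+
    done
  qed (use sub pair_wf_digraph_axioms in auto)
  then show ?thesis
    using fam by blast
qed

end

section \<open>Total correctness with exact step counts\<close>

section \<open>Weakest preconditions with running times\<close>

text \<open>It asks for one halting run; execution is deterministic, so this is the only run. That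
  is also why the rules below are equations and can be used for rewriting.\<close>

definition wp :: "com \<Rightarrow> (nat \<Rightarrow> store \<Rightarrow> bool) \<Rightarrow> store \<Rightarrow> bool" where
  "wp c Q s \<longleftrightarrow> (\<exists>t s'. exec c s t s' \<and> Q t s')"

inductive_cases exec_SeqE: "exec (Seq c d) s t s'"
inductive_cases exec_CondE: "exec (Cond b c d) s t s'"

lemma wp_Skip [simp]: "wp Skip Q = Q 1"
  unfolding wp_def fun_eq_iff by (metis exec.Skip exec_deterministic)

lemma wp_Assign [simp]: "wp (Assign x e) Q = (\<lambda>s. Q 1 ((fst s)(x := aval e s), snd s))"
  unfolding wp_def fun_eq_iff by (metis exec.Assign exec_deterministic)

lemma wp_Write [simp]:
  "wp (Write a e f) Q = (\<lambda>s. Q 1 (fst s, (snd s)(a := (snd s a)(aval e s := aval f s))))"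
  unfolding wp_def fun_eq_iff by (metis exec.Write exec_deterministic)

lemma wp_Seq [simp]: "wp (Seq c d) Q = wp c (\<lambda>t. wp d (\<lambda>t'. Q (t + t')))"
  unfolding wp_def fun_eq_iff by (blast elim: exec_SeqE intro: exec.Seq)

lemma wp_Cond [simp]:
  "wp (Cond b c d) Q = (\<lambda>s. if bval b s then wp c (\<lambda>t. Q (Suc t)) s else wp d (\<lambda>t. Q (Suc t)) s)"
  unfolding wp_def fun_eq_iff
  by (rule allI, rename_tac s, case_tac "bval b s"; simp; blast elim: exec_CondE intro: exec.CondTrue exec.CondFalse)

lemma wp_mono: "wp c Q s \<Longrightarrow> (\<And>t s'. Q t s' \<Longrightarrow> R t s') \<Longrightarrow> wp c R s"
  unfolding wp_def by blast

text \<open>The measure pays for time and termination at once: each pass takes its body and one test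
  out of it. The final \<open>Suc\<close> is the test that fails.\<close>

lemma wp_While:
  assumes inv: "I s"
    and step: "\<And>s. I s \<Longrightarrow> bval b s \<Longrightarrow> wp c (\<lambda>t s'. I s' \<and> Suc t + \<Phi> s' \<le> \<Phi> s) s"
    and post: "\<And>t s'. I s' \<Longrightarrow> \<not> bval b s' \<Longrightarrow> t \<le> Suc (\<Phi> s) \<Longrightarrow> Q t s'"
  shows "wp (While b c) Q s"
proof -
  have "\<exists>t s'. exec (While b c) s t s' \<and> I s' \<and> \<not> bval b s' \<and> t \<le> Suc (\<Phi> s)"
    using inv
  proof (induction "\<Phi> s" arbitrary: s rule: less_induct)
    case less
    show ?case
    proof (cases "bval b s")
      case True
      then obtain t s' where c: "exec c s t s'" "I s'" "Suc t + \<Phi> s' \<le> \<Phi> s"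
        using step[OF less.prems] by (auto simp: wp_def)
      then obtain u s'' where "exec (While b c) s' u s''" "I s''" "\<not> bval b s''" "u \<le> Suc (\<Phi> s')"
        using less.hyps[of s'] by auto
      then show ?thesis
        using c True exec.WhileTrue[OF True c(1)] by (intro exI[of _ "Suc (t + u)"] exI[of _ s'']) auto
    next
      case False
      then show ?thesis
        using less.prems exec.WhileFalse[of b s c] by fastforce
    qed
  qed
  then show ?thesis
    unfolding wp_def using post by blast
qed

primrec wregs :: "com \<Rightarrow> name set" where
  "wregs Skip = {}"
| "wregs (Assign x e) = {x}"
| "wregs (Write a e f) = {}"
| "wregs (Seq c d) = wregs c \<union> wregs d"
| "wregs (Cond b c d) = wregs c \<union> wregs d"
| "wregs (While b c) = wregs c"

primrec warrs :: "com \<Rightarrow> name set" where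
  "warrs Skip = {}"
| "warrs (Assign x e) = {}"
| "warrs (Write a e f) = {a}"
| "warrs (Seq c d) = warrs c \<union> warrs d"
| "warrs (Cond b c d) = warrs c \<union> warrs d"
| "warrs (While b c) = warrs c"

definition same_except :: "name set \<Rightarrow> name set \<Rightarrow> store \<Rightarrow> store \<Rightarrow> bool" where
  "same_except X A s s' \<longleftrightarrow> (\<forall>x. x \<notin> X \<longrightarrow> fst s' x = fst s x) \<and> (\<forall>a. a \<notin> A \<longrightarrow> snd s' a = snd s a)"

lemma same_exceptD:
  "same_except X A s s' \<Longrightarrow> x \<notin> X \<Longrightarrow> fst s' x = fst s x"
  "same_except X A s s' \<Longrightarrow> a \<notin> A \<Longrightarrow> snd s' a = snd s a"
  by (simp_all add: same_except_def)

lemma exec_frame: "exec c s t s' \<Longrightarrow> same_except (wregs c) (warrs c) s s'"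
  by (induction rule: exec.induct) (auto simp: same_except_def)

text \<open>Specifications of program pieces state only what is achieved. That all other registers
  and arrays keep their contents is added here, from the names that occur on the left of
  writes.\<close>

lemma wp_call:
  assumes "wp c P s" "\<And>t s'. P t s' \<Longrightarrow> same_except (wregs c) (warrs c) s s' \<Longrightarrow> Q t s'"
  shows "wp c Q s"
  using assms exec_frame unfolding wp_def by blast

section \<open>Array loops and their costs\<close>

section \<open>Loop patterns\<close>

definition For :: "name \<Rightarrow> aexp \<Rightarrow> com \<Rightarrow> com" where
  "For i e c = Seq (Assign i (Const 0)) (While (Less (Var i) e) (Seq c (Assign i (Succ (Var i)))))"

abbreviation reg :: "name \<Rightarrow> nat \<Rightarrow> store \<Rightarrow> store" where
  "reg x v s \<equiv> ((fst s)(x := v), snd s)"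

text \<open>A pass costs \<open>T\<close>, the test and the increment; the other 2 steps are the
  initialisation and the last test. The limit \<open>e\<close> is evaluated anew in each pass, so
  the invariant has to fix its value.\<close>

lemma wp_For:
  assumes init: "J 0 (reg i 0 s)"
    and bound: "\<And>j s'. J j s' \<Longrightarrow> aval e s' = m"
    and step: "\<And>j s'. j < m \<Longrightarrow> fst s' i = j \<Longrightarrow> J j s' \<Longrightarrow>
      wp c (\<lambda>t s''. t \<le> T \<and> fst s'' i = j \<and> J (Suc j) (reg i (Suc j) s'')) s'"
    and post: "\<And>t s'. J m s' \<Longrightarrow> fst s' i = m \<Longrightarrow> t \<le> m * (T + 2) + 2 \<Longrightarrow> Q t s'"
  shows "wp (For i e c) Q s"
proof -
  have "wp (While (Less (Var i) e) (Seq c (Assign i (Succ (Var i))))) (\<lambda>t. Q (Suc t)) (reg i 0 s)"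
  proof (rule wp_While[where I = "\<lambda>s'. J (fst s' i) s' \<and> fst s' i \<le> m" and \<Phi> = "\<lambda>s'. (m - fst s' i) * (T + 2)"])
    show "J (fst (reg i 0 s) i) (reg i 0 s) \<and> fst (reg i 0 s) i \<le> m"
      using init by simp
  next
    fix s' :: store
    assume J: "J (fst s' i) s' \<and> fst s' i \<le> m" and b: "bval (Less (Var i) e) s'"
    then have lt: "fst s' i < m"
      using bound[OF conjunct1[OF J]] by simp
    have "wp c (\<lambda>t s''. t \<le> T \<and> fst s'' i = fst s' i \<and> J (Suc (fst s' i)) (reg i (Suc (fst s' i)) s'')) s'"
      using step[OF lt refl] J by blast
    then have "wp c (\<lambda>t s''. J (Suc (fst s'' i)) (reg i (Suc (fst s'' i)) s'') \<and> Suc (fst s'' i) \<le> m \<and>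
        Suc (Suc t) + (m - Suc (fst s'' i)) * (T + 2) \<le> (m - fst s' i) * (T + 2)) s'"
    proof (rule wp_mono)
      fix t s''
      assume *: "t \<le> T \<and> fst s'' i = fst s' i \<and> J (Suc (fst s' i)) (reg i (Suc (fst s' i)) s'')"
      have "m - fst s' i = Suc (m - Suc (fst s' i))"
        using lt by simp
      then have "(m - fst s' i) * (T + 2) = (T + 2) + (m - Suc (fst s' i)) * (T + 2)"
        by simp
      then have "Suc (Suc t) + (m - Suc (fst s' i)) * (T + 2) \<le> (m - fst s' i) * (T + 2)"
        using * by linarith
      moreover have "fst s'' i = fst s' i"
        using * by simp
      ultimately show "J (Suc (fst s'' i)) (reg i (Suc (fst s'' i)) s'') \<and> Suc (fst s'' i) \<le> m \<and>
        Suc (Suc t) + (m - Suc (fst s'' i)) * (T + 2) \<le> (m - fst s' i) * (T + 2)"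
        using * lt by simp
    qed
    then show "wp (Seq c (Assign i (Succ (Var i))))
        (\<lambda>t s''. (J (fst s'' i) s'' \<and> fst s'' i \<le> m) \<and> Suc t + (m - fst s'' i) * (T + 2) \<le> (m - fst s' i) * (T + 2)) s'"
      by simp
  next
    fix t s'
    assume "J (fst s' i) s' \<and> fst s' i \<le> m" "\<not> bval (Less (Var i) e) s'"
      and t: "t \<le> Suc ((m - fst (reg i 0 s) i) * (T + 2))"
    moreover from this have "fst s' i = m"
      using bound[of "fst s' i" s'] by auto
    ultimately show "Q (Suc t) s'"
      using post[of s' "Suc t"] by auto
  qed
  then show ?thesis
    by (simp add: For_def)
qed

lemma wregs_For [simp]: "wregs (For i e c) = insert i (wregs c)"
  and warrs_For [simp]: "warrs (For i e c) = warrs c"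
  by (auto simp: For_def)

definition fill :: "name \<Rightarrow> aexp \<Rightarrow> aexp \<Rightarrow> com" where
  "fill a N e = For ''i'' N (Write a (Var ''i'') e)"

text \<open>When \<open>e\<close> is evaluated at \<open>j\<close>, the cells from \<open>j\<close>
  on are still the old ones. This permits overwriting an array by a shifted copy of itself, as
  \<open>drop_first\<close> does.\<close>

lemma wp_fill:
  assumes N: "\<And>s'. same_except {''i''} {a} s s' \<Longrightarrow> aval N s' = m"
    and e: "\<And>j s'. j < m \<Longrightarrow> fst s' ''i'' = j \<Longrightarrow> same_except {''i''} {a} s s' \<Longrightarrow>
      (\<And>l. j \<le> l \<Longrightarrow> snd s' a l = snd s a l) \<Longrightarrow> aval e s' = f j"
    and post: "\<And>t s'. same_except {''i''} {a} s s' \<Longrightarrow> snd s' a = (\<lambda>j. if j < m then f j else snd s a j) \<Longrightarrow>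
      t \<le> 3 * m + 2 \<Longrightarrow> Q t s'"
  shows "wp (fill a N e) Q s"
  unfolding fill_def
proof (rule wp_For[where m = m and T = 1 and J = "\<lambda>j s'. same_except {''i''} {a} s s' \<and>
      snd s' a = (\<lambda>l. if l < j then f l else snd s a l)"])
  fix j s'
  assume "j < m" "fst s' ''i'' = j" "same_except {''i''} {a} s s' \<and> snd s' a = (\<lambda>l. if l < j then f l else snd s a l)"
  then show "wp (Write a (Var ''i'') e) (\<lambda>t s''. t \<le> 1 \<and> fst s'' ''i'' = j \<and>
      same_except {''i''} {a} s (reg ''i'' (Suc j) s'') \<and>
      snd (reg ''i'' (Suc j) s'') a = (\<lambda>l. if l < Suc j then f l else snd s a l)) s'"
    using e[of j s'] by (auto simp: same_except_def fun_eq_iff less_Suc_eq)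
qed (use N post in \<open>auto simp: same_except_def mult.commute\<close>)

definition scatter :: "name \<Rightarrow> aexp \<Rightarrow> aexp \<Rightarrow> nat \<Rightarrow> com" where
  "scatter a N e v = For ''i'' N (Write a e (Const v))"

lemma wp_scatter:
  assumes N: "\<And>s'. same_except {''i''} {a} s s' \<Longrightarrow> aval N s' = m"
    and e: "\<And>j s'. j < m \<Longrightarrow> fst s' ''i'' = j \<Longrightarrow> same_except {''i''} {a} s s' \<Longrightarrow> aval e s' = f j"
    and post: "\<And>t s'. same_except {''i''} {a} s s' \<Longrightarrow> snd s' a = (\<lambda>w. if w \<in> f ` {..<m} then v else snd s a w) \<Longrightarrow>
      t \<le> 3 * m + 2 \<Longrightarrow> Q t s'"
  shows "wp (scatter a N e v) Q s"
  unfolding scatter_def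
proof (rule wp_For[where m = m and T = 1 and J = "\<lambda>j s'. same_except {''i''} {a} s s' \<and>
      snd s' a = (\<lambda>w. if w \<in> f ` {..<j} then v else snd s a w)"])
  fix j s'
  assume "j < m" "fst s' ''i'' = j"
    "same_except {''i''} {a} s s' \<and> snd s' a = (\<lambda>w. if w \<in> f ` {..<j} then v else snd s a w)"
  then show "wp (Write a e (Const v)) (\<lambda>t s''. t \<le> 1 \<and> fst s'' ''i'' = j \<and>
      same_except {''i''} {a} s (reg ''i'' (Suc j) s'') \<and>
      snd (reg ''i'' (Suc j) s'') a = (\<lambda>w. if w \<in> f ` {..<Suc j} then v else snd s a w)) s'"
    using e[of j s'] by (auto simp: same_except_def fun_eq_iff lessThan_Suc)
qed (use N post in \<open>auto simp: same_except_def mult.commute\<close>)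

definition search :: "name \<Rightarrow> name \<Rightarrow> aexp \<Rightarrow> bexp \<Rightarrow> com" where
  "search f x N b = Seq (Assign f (Const 0))
     (For ''i'' N (Cond b (Seq (Assign f (Const 1)) (Assign x (Var ''i''))) Skip))"

text \<open>The loop has no early exit, so \<open>x\<close> ends up holding the last hit; callers
  only use that it is some hit.\<close>

lemma wp_search:
  assumes dist: "f \<noteq> x" "f \<noteq> ''i''" "x \<noteq> ''i''"
    and N: "\<And>s'. same_except {''i'', f, x} {} s s' \<Longrightarrow> aval N s' = m"
    and b: "\<And>j s'. j < m \<Longrightarrow> fst s' ''i'' = j \<Longrightarrow> same_except {''i'', f, x} {} s s' \<Longrightarrow> bval b s' \<longleftrightarrow> P j"
    and post: "\<And>t s'. same_except {''i'', f, x} {} s s' \<Longrightarrow>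
      (fst s' f = 0 \<and> (\<forall>j<m. \<not> P j) \<or> fst s' f = 1 \<and> fst s' x < m \<and> P (fst s' x)) \<Longrightarrow>
      t \<le> 5 * m + 3 \<Longrightarrow> Q t s'"
  shows "wp (search f x N b) Q s"
proof -
  have "wp (For ''i'' N (Cond b (Seq (Assign f (Const 1)) (Assign x (Var ''i''))) Skip)) (\<lambda>t. Q (Suc t)) (reg f 0 s)"
  proof (rule wp_For[where m = m and T = 3 and J = "\<lambda>j s'. same_except {''i'', f, x} {} s s' \<and>
      (fst s' f = 0 \<and> (\<forall>l<j. \<not> P l) \<or> fst s' f = 1 \<and> fst s' x < m \<and> P (fst s' x))"])
    fix j s'
    assume "j < m" "fst s' ''i'' = j"
      "same_except {''i'', f, x} {} s s' \<and>
        (fst s' f = 0 \<and> (\<forall>l<j. \<not> P l) \<or> fst s' f = 1 \<and> fst s' x < m \<and> P (fst s' x))"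
    then show "wp (Cond b (Seq (Assign f (Const 1)) (Assign x (Var ''i''))) Skip) (\<lambda>t s''. t \<le> 3 \<and> fst s'' ''i'' = j \<and>
        same_except {''i'', f, x} {} s (reg ''i'' (Suc j) s'') \<and>
        (fst (reg ''i'' (Suc j) s'') f = 0 \<and> (\<forall>l<Suc j. \<not> P l) \<or>
         fst (reg ''i'' (Suc j) s'') f = 1 \<and> fst (reg ''i'' (Suc j) s'') x < m \<and>
         P (fst (reg ''i'' (Suc j) s'') x))) s'"
      using b[of j s'] dist by (auto simp: same_except_def less_Suc_eq)
  qed (use N post dist in \<open>auto simp: same_except_def mult.commute\<close>)
  then show ?thesis
    by (simp add: search_def)
qed

definition alist :: "store \<Rightarrow> name \<Rightarrow> nat \<Rightarrow> nat list" where
  "alist s a m = map (snd s a) [0..<m]"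

definition push :: "name \<Rightarrow> name \<Rightarrow> aexp \<Rightarrow> com" where
  "push a c e = Seq (Write a (Var c) e) (Assign c (Succ (Var c)))"

definition pushes :: "name \<Rightarrow> name \<Rightarrow> aexp \<Rightarrow> aexp \<Rightarrow> com" where
  "pushes a c N e = For ''i'' N (push a c e)"

lemma wp_pushes:
  assumes c: "c \<noteq> ''i''"
    and N: "\<And>s'. same_except {''i'', c} {a} s s' \<Longrightarrow> aval N s' = m"
    and e: "\<And>j s'. j < m \<Longrightarrow> fst s' ''i'' = j \<Longrightarrow> same_except {''i'', c} {a} s s' \<Longrightarrow> aval e s' = f j"
    and post: "\<And>t s'. same_except {''i'', c} {a} s s' \<Longrightarrow>
      alist s' a (fst s' c) = alist s a (fst s c) @ map f [0..<m] \<Longrightarrow> fst s' c = fst s c + m \<Longrightarrow>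
      t \<le> 4 * m + 2 \<Longrightarrow> Q t s'"
  shows "wp (pushes a c N e) Q s"
  unfolding pushes_def
proof (rule wp_For[where m = m and T = 2 and J = "\<lambda>j s'. same_except {''i'', c} {a} s s' \<and>
      alist s' a (fst s' c) = alist s a (fst s c) @ map f [0..<j] \<and> fst s' c = fst s c + j"])
  fix j s'
  assume J: "j < m" "fst s' ''i'' = j" "same_except {''i'', c} {a} s s' \<and>
    alist s' a (fst s' c) = alist s a (fst s c) @ map f [0..<j] \<and> fst s' c = fst s c + j"
  show "wp (push a c e) (\<lambda>t s''. t \<le> 2 \<and> fst s'' ''i'' = j \<and>
      same_except {''i'', c} {a} s (reg ''i'' (Suc j) s'') \<and>
      alist (reg ''i'' (Suc j) s'') a (fst (reg ''i'' (Suc j) s'') c) = alist s a (fst s c) @ map f [0..<Suc j] \<and>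
      fst (reg ''i'' (Suc j) s'') c = fst s c + Suc j) s'"
    using J e[of j s'] c by (auto simp: push_def alist_def same_except_def)
qed (use N post c in \<open>auto simp: same_except_def alist_def mult.commute\<close>)

definition filtered :: "name \<Rightarrow> name \<Rightarrow> aexp \<Rightarrow> bexp \<Rightarrow> com" where
  "filtered a c N b = For ''i'' N (Cond b (push a c (Var ''i'')) Skip)"

lemma wp_filtered:
  assumes c: "c \<noteq> ''i''"
    and N: "\<And>s'. same_except {''i'', c} {a} s s' \<Longrightarrow> aval N s' = m"
    and b: "\<And>j s'. j < m \<Longrightarrow> fst s' ''i'' = j \<Longrightarrow> same_except {''i'', c} {a} s s' \<Longrightarrow> bval b s' \<longleftrightarrow> P j"
    and post: "\<And>t s'. same_except {''i'', c} {a} s s' \<Longrightarrow>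
      alist s' a (fst s' c) = alist s a (fst s c) @ filter P [0..<m] \<Longrightarrow> t \<le> 5 * m + 2 \<Longrightarrow> Q t s'"
  shows "wp (filtered a c N b) Q s"
  unfolding filtered_def
proof (rule wp_For[where m = m and T = 3 and J = "\<lambda>j s'. same_except {''i'', c} {a} s s' \<and>
      alist s' a (fst s' c) = alist s a (fst s c) @ filter P [0..<j]"])
  fix j s'
  assume J: "j < m" "fst s' ''i'' = j" "same_except {''i'', c} {a} s s' \<and>
    alist s' a (fst s' c) = alist s a (fst s c) @ filter P [0..<j]"
  show "wp (Cond b (push a c (Var ''i'')) Skip) (\<lambda>t s''. t \<le> 3 \<and> fst s'' ''i'' = j \<and>
      same_except {''i'', c} {a} s (reg ''i'' (Suc j) s'') \<and>
      alist (reg ''i'' (Suc j) s'') a (fst (reg ''i'' (Suc j) s'') c) = alist s a (fst s c) @ filter P [0..<Suc j]) s'"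
    using J b[of j s'] c by (auto simp: push_def alist_def same_except_def)
qed (use N post c in \<open>auto simp: same_except_def alist_def mult.commute\<close>)

definition cfill :: "name \<Rightarrow> aexp \<Rightarrow> bexp \<Rightarrow> nat \<Rightarrow> com" where
  "cfill a N b v = For ''i'' N (Cond b (Write a (Var ''i'') (Const v)) Skip)"

lemma wp_cfill:
  assumes N: "\<And>s'. same_except {''i''} {a} s s' \<Longrightarrow> aval N s' = m"
    and b: "\<And>j s'. j < m \<Longrightarrow> fst s' ''i'' = j \<Longrightarrow> same_except {''i''} {a} s s' \<Longrightarrow>
      snd s' a j = snd s a j \<Longrightarrow> bval b s' \<longleftrightarrow> P j"
    and post: "\<And>t s'. same_except {''i''} {a} s s' \<Longrightarrow>
      snd s' a = (\<lambda>j. if j < m \<and> P j then v else snd s a j) \<Longrightarrow> t \<le> 4 * m + 2 \<Longrightarrow> Q t s'"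
  shows "wp (cfill a N b v) Q s"
  unfolding cfill_def
proof (rule wp_For[where m = m and T = 2 and J = "\<lambda>j s'. same_except {''i''} {a} s s' \<and>
      snd s' a = (\<lambda>l. if l < j \<and> P l then v else snd s a l)"])
  fix j s'
  assume "j < m" "fst s' ''i'' = j"
    "same_except {''i''} {a} s s' \<and> snd s' a = (\<lambda>l. if l < j \<and> P l then v else snd s a l)"
  then show "wp (Cond b (Write a (Var ''i'') (Const v)) Skip) (\<lambda>t s''. t \<le> 2 \<and> fst s'' ''i'' = j \<and>
      same_except {''i''} {a} s (reg ''i'' (Suc j) s'') \<and>
      snd (reg ''i'' (Suc j) s'') a = (\<lambda>l. if l < Suc j \<and> P l then v else snd s a l)) s'"
    using b[of j s'] by (auto simp: same_except_def fun_eq_iff less_Suc_eq)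
qed (use N post in \<open>auto simp: same_except_def mult.commute\<close>)

lemma writes_simps [simp]:
  "wregs (fill a N e) = {''i''}" "warrs (fill a N e) = {a}"
  "wregs (scatter a N e v) = {''i''}" "warrs (scatter a N e v) = {a}"
  "wregs (search f x N b) = {''i'', f, x}" "warrs (search f x N b) = {}"
  "wregs (pushes a c N e) = {''i'', c}" "warrs (pushes a c N e) = {a}"
  "wregs (filtered a c N b) = {''i'', c}" "warrs (filtered a c N b) = {a}"
  "wregs (cfill a N b v) = {''i''}" "warrs (cfill a N b v) = {a}"
  "wregs (push a c e) = {c}" "warrs (push a c e) = {a}"
  by (auto simp: fill_def scatter_def search_def pushes_def filtered_def cfill_def push_def)

section \<open>Restricted breadth-first search in linear time\<close>

section \<open>Breadth-first search\<close>

definition scan :: com where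
  "scan = While (Less (Var ''j'') (Read ''off'' (Succ (Var ''u''))))
     (Seq (Assign ''w'' (Read ''adj'' (Var ''j'')))
     (Seq (Cond (Less (Read ''vis'' (Var ''w'')) (Const 1))
            (Seq (Write ''vis'' (Var ''w'') (Const 1))
            (Seq (Write ''dist'' (Var ''w'') (Var ''e''))
            (Seq (Write ''par'' (Var ''w'') (Var ''u''))
                 (push ''qu'' ''qt'' (Var ''w''))))) Skip)
          (Assign ''j'' (Succ (Var ''j'')))))"

definition visit :: com where
  "visit = Seq (Assign ''u'' (Read ''qu'' (Var ''qh'')))
     (Seq (Assign ''qh'' (Succ (Var ''qh'')))
          (Cond (Less (Const 0) (Read ''ok'' (Var ''u'')))
            (Seq (Assign ''e'' (Succ (Read ''dist'' (Var ''u''))))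
            (Seq (Assign ''j'' (Read ''off'' (Var ''u''))) scan)) Skip))"

text \<open>The array \<open>''src''\<close> marks the sources and \<open>''ok''\<close> the
  vertices that may be expanded. A vertex outside \<open>''ok''\<close> can be reached but not
  passed; thus a search outside the path also reports which vertices of the path it touches.\<close>

definition bfs :: com where
  "bfs = Seq (fill ''vis'' (Var ''n'') (Read ''src'' (Var ''i'')))
     (Seq (fill ''dist'' (Var ''n'') (Const 0))
     (Seq (Assign ''qt'' (Const 0))
     (Seq (filtered ''qu'' ''qt'' (Var ''n'') (Less (Const 0) (Read ''src'' (Var ''i''))))
     (Seq (Assign ''qh'' (Const 0))
          (While (Less (Var ''qh'') (Var ''qt'')) visit)))))"

lemma scan_writes [simp]:
  "wregs scan = {''w'', ''j'', ''qt''}" "warrs scan = {''vis'', ''dist'', ''par'', ''qu''}"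
  by (auto simp: scan_def)

lemma visit_writes [simp]:
  "wregs visit = {''u'', ''qh'', ''e'', ''w'', ''j'', ''qt''}" "warrs visit = {''vis'', ''dist'', ''par'', ''qu''}"
  by (auto simp: visit_def)

lemma bfs_writes [simp]:
  "wregs bfs = {''i'', ''u'', ''qh'', ''e'', ''w'', ''j'', ''qt''}" "warrs bfs = {''vis'', ''dist'', ''par'', ''qu''}"
  by (auto simp: bfs_def)

lemma alist_regs [simp]: "alist (r, snd s) a m = alist s a m"
  by (simp add: alist_def)

locale problem = host G E for G :: "nat pair_pre_digraph" and E +
  fixes ls :: "nat list list" and k :: nat
  assumes connected: "connected (with_proj G)" and adj: "adj_lists G ls" and k_pos: "1 \<le> k"
begin

definition n :: nat where "n = length ls"
text \<open>The adjacency lists contain every edge twice, so this is linear in the size of the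
  graph; the summand 1 absorbs additive constants in the time bounds.\<close>

definition N :: nat where "N = n + length (concat ls) + 1"

abbreviation off :: "nat \<Rightarrow> nat" where "off v \<equiv> length (concat (take v ls))"

definition inp :: "store \<Rightarrow> bool" where
  "inp s \<longleftrightarrow> fst s ''n'' = n \<and> fst s ''k'' = k \<and>
     snd s ''off'' = array_of (map (\<lambda>v. off v) [0..<Suc (length ls)]) \<and>
     snd s ''adj'' = array_of (concat ls)"

lemma inp_same:
  "same_except X A s s' \<Longrightarrow> inp s \<Longrightarrow> ''n'' \<notin> X \<Longrightarrow> ''k'' \<notin> X \<Longrightarrow> ''off'' \<notin> A \<Longrightarrow> ''adj'' \<notin> A \<Longrightarrow> inp s'"
  by (simp add: inp_def same_except_def)

definition marks :: "store \<Rightarrow> name \<Rightarrow> nat set" where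
  "marks s a = {w. w < n \<and> 0 < snd s a w}"

lemma marks_same: "same_except X A s s' \<Longrightarrow> a \<notin> A \<Longrightarrow> marks s' a = marks s a"
  by (simp add: marks_def same_except_def)

lemma pverts_eq: "pverts G = {..<n}"
  using adj by (simp add: adj_lists_def n_def)

lemma E_lt: "E u w \<Longrightarrow> u < n \<and> w < n"
  using in_arcsD1[of u w] in_arcsD2[of u w] pverts_eq by (auto simp: E_def)

lemma off_Suc: "u < n \<Longrightarrow> off (Suc u) = off u + length (ls ! u)"
  by (simp add: n_def take_Suc_conv_app_nth)

lemma off_nth: "u \<le> n \<Longrightarrow> inp s \<Longrightarrow> snd s ''off'' u = off u"
  by (simp add: inp_def array_of_def n_def del: upt_Suc)

lemma off_le: "off u \<le> length (concat ls)"
  by (metis append_take_drop_id concat_append le_add1 length_append)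

lemma adj_nth:
  assumes "inp s" "u < n" "j < length (ls ! u)"
  shows "snd s ''adj'' (off u + j) = ls ! u ! j"
proof -
  have "concat ls = concat (take u ls) @ ls ! u @ concat (drop (Suc u) ls)"
    using assms(2) by (metis append.assoc concat.simps(2) concat_append id_take_nth_drop n_def)
  then have "concat ls ! (off u + j) = ls ! u ! j"
    using assms(3) by (simp add: nth_append)
  moreover have "off u + j < length (concat ls)"
    using off_Suc[OF assms(2)] off_le[of "Suc u"] assms(3) by simp
  ultimately show ?thesis
    using assms(1) by (simp add: inp_def array_of_def)
qed

lemma E_iff_nbr: "u < n \<Longrightarrow> E u w \<longleftrightarrow> w \<in> set (ls ! u)"
  using adj by (auto simp: adj_lists_def E_def n_def)

lemma sum_degrees: "(\<Sum>u<n. length (ls ! u)) = length (concat ls)"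
  by (simp add: n_def length_concat sum_list_sum_nth atLeast0LessThan)

text \<open>\<open>Vs\<close> is the set of vertices reachable from \<open>S\<close> along walks whose vertices, except the last
  one, are in \<open>K\<close>; \<open>d\<close> are the distances along these walks and \<open>p\<close> the predecessors.\<close>

definition btree :: "nat set \<Rightarrow> nat set \<Rightarrow> nat set \<Rightarrow> (nat \<Rightarrow> nat) \<Rightarrow> (nat \<Rightarrow> nat) \<Rightarrow> bool" where
  "btree S K Vs d p \<longleftrightarrow> S \<subseteq> Vs \<and> Vs \<subseteq> {..<n} \<and> (\<forall>w\<in>Vs. d w = 0 \<longleftrightarrow> w \<in> S) \<and>
     (\<forall>w\<in>Vs - S. p w \<in> Vs \<inter> K \<and> E (p w) w \<and> d w = Suc (d (p w))) \<and>
     (\<forall>u\<in>Vs \<inter> K. \<forall>w. E u w \<longrightarrow> w \<in> Vs \<and> d w \<le> Suc (d u))"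

text \<open>Sortedness by distance is what makes the labels final: the vertex at the head has the
  least label among those still to be expanded.\<close>

definition queue_inv :: "nat set \<Rightarrow> nat set \<Rightarrow> nat list \<Rightarrow> (nat \<Rightarrow> nat) \<Rightarrow> (nat \<Rightarrow> nat) \<Rightarrow> bool" where
  "queue_inv S K L d p \<longleftrightarrow> distinct L \<and> set L \<subseteq> {..<n} \<and> S \<subseteq> set L \<and> sorted (map d L) \<and>
     (\<forall>w\<in>set L. d w = 0 \<longleftrightarrow> w \<in> S) \<and>
     (\<forall>w\<in>set L - S. p w \<in> set L \<inter> K \<and> E (p w) w \<and> d w = Suc (d (p w)))"

definition scanned :: "nat set \<Rightarrow> nat list \<Rightarrow> (nat \<Rightarrow> nat) \<Rightarrow> nat set \<Rightarrow> bool" where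
  "scanned K L d A \<longleftrightarrow> (\<forall>u\<in>A \<inter> K. \<forall>w. E u w \<longrightarrow> w \<in> set L \<and> d w \<le> Suc (d u))"

lemma queue_inv_snoc:
  assumes q: "queue_inv S K L d p" and u: "u \<in> set L" "u \<in> K" "E u w" and w: "w \<notin> set L"
    and b: "\<And>x. x \<in> set L \<Longrightarrow> d x \<le> Suc (d u)"
  shows "queue_inv S K (L @ [w]) (d(w := Suc (d u))) (p(w := u))"
proof -
  have "map (d(w := Suc (d u))) L = map d L"
    using w by simp
  moreover have "sorted (map d L @ [Suc (d u)])"
    using q b by (auto simp: queue_inv_def sorted_append)
  ultimately have "sorted (map (d(w := Suc (d u))) (L @ [w]))"
    by (simp only: map_append list.map fun_upd_same)
  then show ?thesis
    using assms E_lt[of u w] by (auto simp: queue_inv_def)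
qed

lemma scanned_snoc:
  "scanned K L d A \<Longrightarrow> A \<subseteq> set L \<Longrightarrow> w \<notin> set L \<Longrightarrow> scanned K (L @ [w]) (d(w := v)) A"
  unfolding scanned_def by fastforce

text \<open>The number \<open>h\<close> of finished vertices is a parameter and not the register
  \<open>''qh''\<close>, which is already advanced while the vertex at position \<open>h\<close> is
  still being scanned.\<close>

definition bfs_state :: "nat set \<Rightarrow> nat set \<Rightarrow> nat \<Rightarrow> store \<Rightarrow> bool" where
  "bfs_state S K h s \<longleftrightarrow> inp s \<and> marks s ''src'' = S \<and> marks s ''ok'' = K \<and>
     (let L = alist s ''qu'' (fst s ''qt'') in
       h \<le> length L \<and> set L = marks s ''vis'' \<and> queue_inv S K L (snd s ''dist'') (snd s ''par'') \<and>
       scanned K L (snd s ''dist'') (set (take h L)))"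

abbreviation queue :: "store \<Rightarrow> nat list" where
  "queue s \<equiv> alist s ''qu'' (fst s ''qt'')"

lemma wp_scan:
  assumes st: "bfs_state S K h s" and h: "h < fst s ''qt''" and u: "queue s ! h = u" "u \<in> K"
    and reg: "fst s ''u'' = u" "fst s ''e'' = Suc (snd s ''dist'' u)" "fst s ''j'' = off u"
    and b: "\<And>x. x \<in> set (queue s) \<Longrightarrow> snd s ''dist'' x \<le> Suc (snd s ''dist'' u)"
  shows "wp scan (\<lambda>t s'. bfs_state S K (Suc h) s' \<and> take (Suc h) (queue s') = take (Suc h) (queue s) \<and>
    (\<forall>x\<in>set (queue s'). snd s' ''dist'' x \<le> Suc (snd s' ''dist'' u)) \<and>
    fst s' ''qh'' = fst s ''qh'' \<and> t \<le> 9 * length (ls ! u) + 1) s"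
proof -
  have uL: "u \<in> set (queue s)"
    using u h by (metis (no_types, lifting) alist_def diff_zero length_map length_upt nth_mem)
  then have un: "u < n"
    using st by (auto simp: bfs_state_def Let_def queue_inv_def)
  define I where "I s' \<longleftrightarrow> bfs_state S K h s' \<and> h < fst s' ''qt'' \<and> fst s' ''u'' = u \<and>
      take (Suc h) (queue s') = take (Suc h) (queue s) \<and> u \<in> set (queue s') \<and>
      fst s' ''e'' = Suc (snd s' ''dist'' u) \<and> off u \<le> fst s' ''j'' \<and> fst s' ''j'' \<le> off (Suc u) \<and>
      fst s' ''qh'' = fst s ''qh'' \<and>
      (\<forall>x\<in>set (queue s'). snd s' ''dist'' x \<le> Suc (snd s' ''dist'' u)) \<and>
      (\<forall>l<fst s' ''j'' - off u. ls ! u ! l \<in> set (queue s'))" for s' :: store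
  show ?thesis
    unfolding scan_def
  \<comment> \<open>A new neighbour costs 8 steps and the test 1; an old one is cheaper.\<close>
  proof (rule wp_While[where I = I and \<Phi> = "\<lambda>s'. 9 * (off (Suc u) - fst s' ''j'')"])
    show "I s"
      using assms uL un off_Suc[OF un] by (auto simp: I_def)
  next
    fix s' :: store
    assume I: "I s'" and "bval (Less (Var ''j'') (Read ''off'' (Succ (Var ''u'')))) s'"
    then have inp: "inp s'" and lt: "fst s' ''j'' < off (Suc u)"
      using off_nth[of "Suc u" s'] un by (auto simp: I_def bfs_state_def)
    define l where "l = fst s' ''j'' - off u"
    have l: "l < length (ls ! u)" "fst s' ''j'' = off u + l"
      using lt I off_Suc[OF un] by (auto simp: l_def I_def)
    define w where "w = ls ! u ! l"
    have aw: "snd s' ''adj'' (fst s' ''j'') = w"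
      using adj_nth[OF inp un l(1)] l(2) by (simp add: w_def)
    have Euw: "E u w"
      using E_iff_nbr[OF un] l(1) by (simp add: w_def)
    have vis: "w \<in> set (queue s') \<longleftrightarrow> 0 < snd s' ''vis'' w"
      using I E_lt[OF Euw] by (auto simp: I_def bfs_state_def Let_def marks_def)
    have Suc_l: "(\<forall>l'<Suc l. P l') \<longleftrightarrow> (\<forall>l'<l. P l') \<and> P l" for P
      by (auto simp: less_Suc_eq)
    let ?s1 = "((fst s')(''w'' := w, ''j'' := Suc (fst s' ''j'')), snd s')"
    let ?s2 = "((fst s')(''w'' := w, ''qt'' := Suc (fst s' ''qt''), ''j'' := Suc (fst s' ''j'')),
      (snd s')(''vis'' := (snd s' ''vis'')(w := 1), ''dist'' := (snd s' ''dist'')(w := Suc (snd s' ''dist'' u)),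
        ''par'' := (snd s' ''par'')(w := u), ''qu'' := (snd s' ''qu'')(fst s' ''qt'' := w)))"
    have qlen: "length (queue s') = fst s' ''qt''"
      by (simp add: alist_def)
    have s1: "I ?s1" if "w \<in> set (queue s')"
    proof -
      have "queue ?s1 = queue s'"
        by (simp add: alist_def)
      moreover have "inp ?s1" "marks ?s1 a = marks s' a" for a
        using inp by (simp_all add: inp_def marks_def)
      moreover have "Suc (fst s' ''j'') - off u = Suc l"
        using l(2) by simp
      ultimately show ?thesis
        using I lt that l(2) by (auto simp: I_def bfs_state_def Let_def Suc_l w_def)
    qed
    have s2: "I ?s2" if new: "w \<notin> set (queue s')"
    proof -
      have uw: "u \<noteq> w" "u \<in> set (queue s')"
        using I new by (auto simp: I_def)
      have Q: "queue ?s2 = queue s' @ [w]"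
        by (simp add: alist_def)
      have inp2: "inp ?s2"
        using inp by (simp add: inp_def)
      have m2: "marks ?s2 ''src'' = marks s' ''src''" "marks ?s2 ''ok'' = marks s' ''ok''"
        "marks ?s2 ''vis'' = insert w (marks s' ''vis'')"
        using E_lt[OF Euw] by (auto simp: marks_def)
      have bs: "bfs_state S K h s'" and bd: "\<And>x. x \<in> set (queue s') \<Longrightarrow> snd s' ''dist'' x \<le> Suc (snd s' ''dist'' u)"
        using I by (auto simp: I_def)
      have "queue_inv S K (queue s') (snd s' ''dist'') (snd s' ''par'')"
        using bs by (simp add: bfs_state_def Let_def)
      from queue_inv_snoc[OF this uw(2) u(2) Euw new bd]
      have qi: "queue_inv S K (queue s' @ [w]) (snd ?s2 ''dist'') (snd ?s2 ''par'')"
        by simp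
      have "scanned K (queue s' @ [w]) (snd ?s2 ''dist'') (set (take h (queue s')))"
        using scanned_snoc[of K "queue s'" "snd s' ''dist''" "set (take h (queue s'))" w] bs new
          set_take_subset[of h "queue s'"] by (simp add: bfs_state_def Let_def)
      then have "bfs_state S K h ?s2"
        unfolding bfs_state_def Let_def Q using bs qi inp2 m2 by (simp add: bfs_state_def Let_def)
      moreover have "take (Suc h) (queue ?s2) = take (Suc h) (queue s)"
        using I qlen unfolding Q by (simp add: I_def)
      moreover have "Suc (fst s' ''j'') - off u = Suc l"
        using l(2) by simp
      moreover have "\<forall>x\<in>set (queue ?s2). snd ?s2 ''dist'' x \<le> Suc (snd ?s2 ''dist'' u)"
        unfolding Q using bd uw by auto
      ultimately show ?thesis
        using I lt l(2) uw unfolding I_def Q by (auto simp: Suc_l w_def)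
    qed
    show "wp (Seq (Assign ''w'' (Read ''adj'' (Var ''j'')))
        (Seq (Cond (Less (Read ''vis'' (Var ''w'')) (Const 1))
            (Seq (Write ''vis'' (Var ''w'') (Const 1))
            (Seq (Write ''dist'' (Var ''w'') (Var ''e''))
            (Seq (Write ''par'' (Var ''w'') (Var ''u''))
                 (push ''qu'' ''qt'' (Var ''w''))))) Skip)
          (Assign ''j'' (Succ (Var ''j'')))))
        (\<lambda>t s''. I s'' \<and> Suc t + 9 * (off (Suc u) - fst s'' ''j'') \<le> 9 * (off (Suc u) - fst s' ''j'')) s'"
    proof (cases "w \<in> set (queue s')")
      case True
      then show ?thesis
        using s1 vis aw lt by (simp add: fun_upd_twist)
    next
      case False
      moreover have "fst s' ''e'' = Suc (snd s' ''dist'' u)" "fst s' ''u'' = u"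
        using I by (auto simp: I_def)
      ultimately show ?thesis
        using s2 vis aw lt by (simp add: push_def)
    qed
  next
    fix t s'
    assume I: "I s'" and nb: "\<not> bval (Less (Var ''j'') (Read ''off'' (Succ (Var ''u'')))) s'"
      and t: "t \<le> Suc (9 * (off (Suc u) - fst s ''j''))"
    have inp: "inp s'"
      using I by (auto simp: I_def bfs_state_def)
    then have j: "fst s' ''j'' - off u = length (ls ! u)"
      using I nb off_nth[of "Suc u" s'] un off_Suc[OF un] by (auto simp: I_def)
    have bs: "bfs_state S K h s'" and hq: "h < fst s' ''qt''"
      using I by (auto simp: I_def)
    have "take (Suc h) (queue s') ! h = take (Suc h) (queue s) ! h"
      using I by (simp add: I_def)
    then have qh: "queue s' ! h = u"
      using u(1) by simp
    have "w \<in> set (queue s') \<and> snd s' ''dist'' w \<le> Suc (snd s' ''dist'' u)" if "E u w" for w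
    proof -
      have "w \<in> set (ls ! u)"
        using that E_iff_nbr[OF un] by simp
      then have "w \<in> set (queue s')"
        using I j by (auto simp: I_def in_set_conv_nth)
      then show ?thesis
        using I by (auto simp: I_def)
    qed
    moreover have "take (Suc h) (queue s') = take h (queue s') @ [u]"
      using hq qh by (simp add: take_Suc_conv_app_nth alist_def)
    ultimately have "bfs_state S K (Suc h) s'"
      using bs hq unfolding bfs_state_def Let_def scanned_def
      by (auto simp: alist_def)
    then show "bfs_state S K (Suc h) s' \<and> take (Suc h) (queue s') = take (Suc h) (queue s) \<and>
        (\<forall>x\<in>set (queue s'). snd s' ''dist'' x \<le> Suc (snd s' ''dist'' u)) \<and>
        fst s' ''qh'' = fst s ''qh'' \<and> t \<le> 9 * length (ls ! u) + 1"
      using I t reg off_Suc[OF un] by (auto simp: I_def)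
  qed
qed

lemma wp_visit:
  assumes st: "bfs_state S K h s" and h: "h < fst s ''qt''" "fst s ''qh'' = h"
    and b: "\<And>x. x \<in> set (queue s) \<Longrightarrow> snd s ''dist'' x \<le> Suc (snd s ''dist'' (queue s ! h))"
  shows "wp visit (\<lambda>t s'. bfs_state S K (Suc h) s' \<and> fst s' ''qh'' = Suc h \<and>
    take (Suc h) (queue s') = take (Suc h) (queue s) \<and>
    (\<forall>x\<in>set (queue s'). snd s' ''dist'' x \<le> Suc (snd s' ''dist'' (queue s ! h))) \<and>
    t \<le> 9 * length (ls ! (queue s ! h)) + 6) s"
proof -
  define u where "u = queue s ! h"
  have uq: "snd s ''qu'' h = u"
    using h by (simp add: u_def alist_def)
  have uL: "u \<in> set (queue s)"
    using h by (simp add: u_def alist_def)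
  then have un: "u < n"
    using st by (auto simp: bfs_state_def Let_def queue_inv_def)
  have inp: "inp s"
    using st by (simp add: bfs_state_def)
  let ?s1 = "((fst s)(''u'' := u, ''qh'' := Suc h), snd s)"
  have st1: "bfs_state S K h ((fst s)(''u'' := u, ''qh'' := Suc h, ''e'' := e, ''j'' := j), snd s)"
    "bfs_state S K h ?s1" for e j
    using st by (auto simp: bfs_state_def Let_def inp_def marks_def alist_def)
  show ?thesis
  proof (cases "u \<in> K")
    case True
    then have ok: "0 < snd s ''ok'' u"
      using st by (auto simp: bfs_state_def marks_def)
    let ?s2 = "((fst s)(''u'' := u, ''qh'' := Suc h, ''e'' := Suc (snd s ''dist'' u), ''j'' := off u), snd s)"
    have q2: "queue ?s2 = queue s"
      by (simp add: alist_def)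
    have "wp scan (\<lambda>t s'. bfs_state S K (Suc h) s' \<and> take (Suc h) (queue s') = take (Suc h) (queue ?s2) \<and>
        (\<forall>x\<in>set (queue s'). snd s' ''dist'' x \<le> Suc (snd s' ''dist'' u)) \<and>
        fst s' ''qh'' = fst ?s2 ''qh'' \<and> t \<le> 9 * length (ls ! u) + 1) ?s2"
      by (rule wp_scan[OF st1(1)]) (use h True b in \<open>auto simp: q2 u_def\<close>)
    then show ?thesis
      using uq ok off_nth[OF less_imp_le[OF un] inp] h
      by (auto simp: visit_def q2 simp flip: u_def elim!: wp_mono)
  next
    case False
    then have ok: "\<not> 0 < snd s ''ok'' u"
      using st un by (auto simp: bfs_state_def marks_def)
    have q1: "queue ?s1 = queue s"
      by (simp add: alist_def)
    have "take (Suc h) (queue s) = take h (queue s) @ [u]"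
      using h by (simp add: take_Suc_conv_app_nth u_def alist_def)
    then have "bfs_state S K (Suc h) ?s1"
      using st1(2) h False unfolding bfs_state_def Let_def scanned_def q1 by (auto simp: alist_def)
    then show ?thesis
      using uq ok h b by (simp add: visit_def q1 flip: u_def)
  qed
qed

lemma wp_bfs:
  assumes inp: "inp s" and S: "marks s ''src'' = S" and K: "marks s ''ok'' = K"
  shows "wp bfs (\<lambda>t s'. btree S K (marks s' ''vis'') (snd s' ''dist'') (snd s' ''par'') \<and> t \<le> 19 * N) s"
proof -
  \<comment> \<open>All labels in the queue exceed that of the head by at most one. Advancing the
    head preserves this because the queue is sorted.\<close>
  define I where "I s' \<longleftrightarrow> bfs_state S K (fst s' ''qh'') s' \<and> (fst s' ''qh'' < fst s' ''qt'' \<longrightarrow>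
    (\<forall>x\<in>set (queue s'). snd s' ''dist'' x \<le> Suc (snd s' ''dist'' (queue s' ! fst s' ''qh''))))" for s' :: store
  define R where "R s' = {..<n} - set (take (fst s' ''qh'') (queue s'))" for s' :: store
  \<comment> \<open>Each vertex leaves the queue at most once. Its price covers the scan of its
    list, the overhead of one visit and the test of the loop.\<close>
  define \<Phi> where "\<Phi> s' = (\<Sum>u\<in>R s'. 9 * length (ls ! u) + 7)" for s' :: store
  have loop: "wp (While (Less (Var ''qh'') (Var ''qt'')) visit)
      (\<lambda>t s'. btree S K (marks s' ''vis'') (snd s' ''dist'') (snd s' ''par'') \<and> t \<le> 9 * length (concat ls) + 7 * n + 1) s0"
    if I0: "I s0" for s0
  proof (rule wp_While[where I = I and \<Phi> = \<Phi>])
    fix s' :: store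
    assume I: "I s'" and "bval (Less (Var ''qh'') (Var ''qt'')) s'"
    then have lt: "fst s' ''qh'' < fst s' ''qt''"
      by simp
    let ?h = "fst s' ''qh''" and ?u = "queue s' ! fst s' ''qh''"
    have dist: "distinct (queue s')" and sub: "set (queue s') \<subseteq> {..<n}"
      using I by (auto simp: I_def bfs_state_def Let_def queue_inv_def)
    have take: "take (Suc ?h) (queue s') = take ?h (queue s') @ [?u]"
      using lt by (simp add: take_Suc_conv_app_nth alist_def)
    have u: "?u \<in> R s'"
    proof -
      have "distinct (take (Suc ?h) (queue s'))"
        using dist by simp
      then have "?u \<notin> set (take ?h (queue s'))"
        unfolding take by simp
      moreover have "?u \<in> set (queue s')"
        using lt by (simp add: alist_def)
      ultimately show ?thesis
        using sub by (auto simp: R_def)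
    qed
    have "wp visit (\<lambda>t s''. bfs_state S K (Suc ?h) s'' \<and> fst s'' ''qh'' = Suc ?h \<and>
        take (Suc ?h) (queue s'') = take (Suc ?h) (queue s') \<and>
        (\<forall>x\<in>set (queue s''). snd s'' ''dist'' x \<le> Suc (snd s'' ''dist'' ?u)) \<and>
        t \<le> 9 * length (ls ! ?u) + 6) s'"
      using I lt by (intro wp_visit) (auto simp: I_def)
    then show "wp visit (\<lambda>t s''. I s'' \<and> Suc t + \<Phi> s'' \<le> \<Phi> s') s'"
    proof (rule wp_mono, elim conjE)
      fix t s''
      assume bs: "bfs_state S K (Suc ?h) s''" and qh: "fst s'' ''qh'' = Suc ?h"
        and tk: "take (Suc ?h) (queue s'') = take (Suc ?h) (queue s')"
        and bd: "\<forall>x\<in>set (queue s''). snd s'' ''dist'' x \<le> Suc (snd s'' ''dist'' ?u)"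
        and t: "t \<le> 9 * length (ls ! ?u) + 6"
      have "R s'' = R s' - {?u}"
        unfolding R_def qh tk take by auto
      then have "\<Phi> s' = 9 * length (ls ! ?u) + 7 + \<Phi> s''"
        using u by (simp add: \<Phi>_def R_def sum.remove)
      moreover have "I s''"
        unfolding I_def qh
      proof (intro conjI impI ballI bs)
        fix x
        assume lt': "Suc ?h < fst s'' ''qt''" and x: "x \<in> set (queue s'')"
        have len: "length (queue s'') = fst s'' ''qt''"
          by (simp add: alist_def)
        have "queue s'' ! ?h = ?u"
          using arg_cong[OF tk, of "\<lambda>xs. xs ! ?h"] lt' by simp
        moreover have "sorted (map (snd s'' ''dist'') (queue s''))"
          using bs by (simp add: bfs_state_def Let_def queue_inv_def)
        then have "snd s'' ''dist'' (queue s'' ! ?h) \<le> snd s'' ''dist'' (queue s'' ! Suc ?h)"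
          using lt' len sorted_nth_mono[of "map (snd s'' ''dist'') (queue s'')" ?h "Suc ?h"] by simp
        ultimately show "snd s'' ''dist'' x \<le> Suc (snd s'' ''dist'' (queue s'' ! Suc ?h))"
          using bd x by fastforce
      qed
      ultimately show "I s'' \<and> Suc t + \<Phi> s'' \<le> \<Phi> s'"
        using t by simp
    qed
  next
    fix t s'
    assume I: "I s'" and "\<not> bval (Less (Var ''qh'') (Var ''qt'')) s'" and t: "t \<le> Suc (\<Phi> s0)"
    then have "fst s' ''qt'' \<le> fst s' ''qh''"
      by simp
    moreover have "bfs_state S K (fst s' ''qh'') s'"
      using I by (simp add: I_def)
    ultimately have "btree S K (marks s' ''vis'') (snd s' ''dist'') (snd s' ''par'')"
      by (auto simp: bfs_state_def Let_def btree_def queue_inv_def scanned_def alist_def)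
    moreover have "\<Phi> s0 \<le> (\<Sum>u<n. 9 * length (ls ! u) + 7)"
      unfolding \<Phi>_def R_def by (rule sum_mono2) auto
    moreover have "(\<Sum>u<n. 9 * length (ls ! u) + 7) = 9 * length (concat ls) + 7 * n"
      by (simp add: sum.distrib sum_degrees flip: sum_distrib_left)
    ultimately show "btree S K (marks s' ''vis'') (snd s' ''dist'') (snd s' ''par'') \<and> t \<le> 9 * length (concat ls) + 7 * n + 1"
      using t by simp
  qed (rule I0)
  have sn: "fst s ''n'' = n"
    using inp by (simp add: inp_def)
  have Sn: "S \<subseteq> {..<n}"
    using S by (auto simp: marks_def)
  show ?thesis
    unfolding bfs_def wp_Seq
  proof (rule wp_fill[where m = n and f = "snd s ''src''"])
    fix t1 s1
    assume s1: "same_except {''i''} {''vis''} s s1" "snd s1 ''vis'' = (\<lambda>j. if j < n then snd s ''src'' j else snd s ''vis'' j)"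
      "t1 \<le> 3 * n + 2"
    show "wp (fill ''dist'' (Var ''n'') (Const 0)) (\<lambda>t'. wp (Assign ''qt'' (Const 0))
        (\<lambda>t'a. wp (filtered ''qu'' ''qt'' (Var ''n'') (Less (Const 0) (Read ''src'' (Var ''i''))))
          (\<lambda>t'b. wp (Assign ''qh'' (Const 0)) (\<lambda>t'c. wp (While (Less (Var ''qh'') (Var ''qt'')) visit)
            (\<lambda>t'd s'. btree S K (marks s' ''vis'') (snd s' ''dist'') (snd s' ''par'') \<and>
              t1 + (t' + (t'a + (t'b + (t'c + t'd)))) \<le> 19 * N))))) s1"
    proof (rule wp_fill[where m = n and f = "\<lambda>_. 0"])
      fix t2 s2
      assume s2: "same_except {''i''} {''dist''} s1 s2" "snd s2 ''dist'' = (\<lambda>j. if j < n then 0 else snd s1 ''dist'' j)"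
        "t2 \<le> 3 * n + 2"
      show "wp (Assign ''qt'' (Const 0))
        (\<lambda>t'a. wp (filtered ''qu'' ''qt'' (Var ''n'') (Less (Const 0) (Read ''src'' (Var ''i''))))
          (\<lambda>t'b. wp (Assign ''qh'' (Const 0)) (\<lambda>t'c. wp (While (Less (Var ''qh'') (Var ''qt'')) visit)
            (\<lambda>t'd s'. btree S K (marks s' ''vis'') (snd s' ''dist'') (snd s' ''par'') \<and>
              t1 + (t2 + (t'a + (t'b + (t'c + t'd)))) \<le> 19 * N)))) s2"
        unfolding wp_Assign
      proof (rule wp_filtered[where m = n and P = "\<lambda>j. 0 < snd s ''src'' j"])
        fix t3 s3
        assume s3: "same_except {''i'', ''qt''} {''qu''} ((fst s2)(''qt'' := aval (Const 0) s2), snd s2) s3"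
          "alist s3 ''qu'' (fst s3 ''qt'') = alist ((fst s2)(''qt'' := aval (Const 0) s2), snd s2) ''qu''
            (fst ((fst s2)(''qt'' := aval (Const 0) s2), snd s2) ''qt'') @ filter (\<lambda>j. 0 < snd s ''src'' j) [0..<n]"
          "t3 \<le> 5 * n + 2"
        let ?s4 = "((fst s3)(''qh'' := 0), snd s3)"
        have Q: "queue ?s4 = filter (\<lambda>j. 0 < snd s ''src'' j) [0..<n]"
          using s3(2) by (simp add: alist_def)
        have setQ: "set (queue ?s4) = S"
          unfolding Q using S by (auto simp: marks_def)
        have inp4: "inp ?s4"
          using inp s1(1) s2(1) s3(1) by (simp add: inp_def same_except_def)
        have m4: "marks ?s4 ''src'' = S" "marks ?s4 ''ok'' = K" "marks ?s4 ''vis'' = S"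
          "\<And>x. x < n \<Longrightarrow> snd ?s4 ''dist'' x = 0"
          using S K s1 s2 s3(1) by (auto simp: marks_def same_except_def)
        have d0: "snd ?s4 ''dist'' x = 0" if "x \<in> S" for x
          using m4(4)[of x] that Sn by blast
        have "map (snd ?s4 ''dist'') (queue ?s4) = map (\<lambda>_. 0) (queue ?s4)"
          using d0 setQ by (intro map_cong) auto
        then have "sorted (map (snd ?s4 ''dist'') (queue ?s4))"
          by (simp only: map_replicate_const sorted_replicate)
        moreover have "distinct (queue ?s4)"
          unfolding Q by simp
        ultimately have "queue_inv S K (queue ?s4) (snd ?s4 ''dist'') (snd ?s4 ''par'')"
          using d0 Sn unfolding queue_inv_def setQ by auto
        then have "I ?s4"
          unfolding I_def bfs_state_def Let_def using d0 setQ inp4 m4 by (simp add: scanned_def)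
        from loop[OF this]
        have "wp (While (Less (Var ''qh'') (Var ''qt'')) visit)
            (\<lambda>t'd s'. btree S K (marks s' ''vis'') (snd s' ''dist'') (snd s' ''par'') \<and>
              t1 + (t2 + (1 + (t3 + (1 + t'd)))) \<le> 19 * N) ?s4"
          by (rule wp_mono) (use s1(3) s2(3) s3(3) in \<open>auto simp: N_def\<close>)
        then show "wp (While (Less (Var ''qh'') (Var ''qt'')) visit)
            (\<lambda>t'd s'. btree S K (marks s' ''vis'') (snd s' ''dist'') (snd s' ''par'') \<and>
              t1 + (t2 + (1 + (t3 + (1 + t'd)))) \<le> 19 * N) (reg ''qh'' (aval (Const 0) s3) s3)"
          by simp
      qed (use sn s1(1) s2(1) in \<open>auto simp: same_except_def\<close>)
    qed (use sn s1(1) in \<open>auto simp: same_except_def\<close>)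
  qed (use sn in \<open>auto simp: same_except_def\<close>)
qed

end

section \<open>Balls, search trees and rearrangements of the path\<close>

section \<open>Paths, coverage and legs\<close>

text \<open>The start \<open>w\<close> is left out: it is already present as an end of the path to
  which the list is appended.\<close>

definition ancestors :: "(nat \<Rightarrow> nat) \<Rightarrow> nat \<Rightarrow> nat \<Rightarrow> nat list" where
  "ancestors p m w = map (\<lambda>i. (p ^^ Suc i) w) [0..<m]"

context problem
begin

text \<open>A closed set contains everything that is reachable from one of its elements, which turns
  the reachability notion of \<open>connected\<close> into \<open>conn\<close>.\<close>

lemma conn_all: "conn {..<n}"
  unfolding conn_def
proof (intro allI impI, elim conjE)
  fix X
  assume X: "X \<subseteq> {..<n}" "X \<noteq> {}" and cl: "\<forall>u\<in>X. \<forall>w\<in>{..<n}. E u w \<longrightarrow> w \<in> X"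
  obtain u where u: "u \<in> X" using X by blast
  have "v \<in> X" if "v < n" for v
  proof -
    have "u \<rightarrow>\<^sup>*\<^bsub>mk_symmetric (with_proj G)\<^esub> v"
      using connected u X that unfolding connected_def strongly_connected_def
      by (auto simp: pverts_eq)
    then have "u \<rightarrow>\<^sup>*\<^bsub>with_proj G\<^esub> v"
      using reachable_mk_symmetric_eq[OF pair_sym_arcs] by simp
    then show ?thesis
    proof (induction rule: reachable_induct)
      case base
      show ?case using u by simp
    next
      case (step x y)
      then show ?case
        using cl in_arcsD2[of x y] pverts_eq by (auto simp: E_def)
    qed
  qed
  then show "X = {..<n}"
    using X by auto
qed

text \<open>Closed balls; with radius \<open>k - 1\<close> around the path this is the coverage.
  They do not refer to any search tree, so that coverages of different paths can be
  compared.\<close>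

primrec Nb :: "nat set \<Rightarrow> nat \<Rightarrow> nat set" where
  "Nb S 0 = S"
| "Nb S (Suc j) = Nb S j \<union> {w. \<exists>u\<in>Nb S j. E u w}"

lemma Nb_mono: "S \<subseteq> T \<Longrightarrow> Nb S j \<subseteq> Nb T j"
  by (induction j) auto

lemma Nb_le: "i \<le> j \<Longrightarrow> Nb S i \<subseteq> Nb S j"
  by (induction j) (auto simp: le_Suc_eq)

lemma Nb_subset: "S \<subseteq> {..<n} \<Longrightarrow> Nb S j \<subseteq> {..<n}"
  using E_lt by (induction j) auto

lemma Nb_add: "u \<in> Nb S i \<Longrightarrow> v \<in> Nb {u} j \<Longrightarrow> v \<in> Nb S (i + j)"
  by (induction j arbitrary: v) auto

lemma btreeD:
  assumes "btree S K Vs d p"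
  shows "S \<subseteq> Vs" "Vs \<subseteq> {..<n}" "\<And>w. w \<in> Vs \<Longrightarrow> d w = 0 \<longleftrightarrow> w \<in> S"
    "\<And>w. w \<in> Vs \<Longrightarrow> d w \<noteq> 0 \<Longrightarrow> p w \<in> Vs \<and> p w \<in> K \<and> E (p w) w \<and> d w = Suc (d (p w))"
    "\<And>u w. u \<in> Vs \<Longrightarrow> u \<in> K \<Longrightarrow> E u w \<Longrightarrow> w \<in> Vs"
    "\<And>u w. u \<in> Vs \<Longrightarrow> u \<in> K \<Longrightarrow> E u w \<Longrightarrow> d w \<le> Suc (d u)"
  using assms by (auto simp: btree_def)

lemma btree_Nb:
  assumes bt: "btree S {..<n} Vs d p"
  shows "w \<in> Vs \<and> d w \<le> j \<longleftrightarrow> w \<in> Nb S j"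
proof (induction j arbitrary: w)
  case 0
  then show ?case
    using btreeD[OF bt] by auto
next
  case (Suc j)
  show ?case
  proof
    assume w: "w \<in> Vs \<and> d w \<le> Suc j"
    show "w \<in> Nb S (Suc j)"
    proof (cases "d w = 0")
      case True
      then show ?thesis using Suc.IH[of w] w by auto
    next
      case False
      then have "p w \<in> Nb S j" "E (p w) w"
        using btreeD(4)[OF bt, of w] w Suc.IH[of "p w"] by auto
      then show ?thesis by auto
    qed
  next
    assume "w \<in> Nb S (Suc j)"
    then consider "w \<in> Nb S j" | u where "u \<in> Nb S j" "E u w"
      by auto
    then show "w \<in> Vs \<and> d w \<le> Suc j"
    proof cases
      case 1
      then show ?thesis using Suc.IH[of w] by auto
    next
      case 2
      then have "u \<in> Vs" "d u \<le> j" "u < n"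
        using Suc.IH[of u] E_lt by auto
      then show ?thesis
        using btreeD(5,6)[OF bt, of u w] 2 by auto
    qed
  qed
qed

lemma btree_all: "btree S {..<n} Vs d p \<Longrightarrow> S \<noteq> {} \<Longrightarrow> Vs = {..<n}"
  using conn_closed[OF conn_all, of Vs] btreeD[of S "{..<n}" Vs d p] by blast

lemma btree_ancestor:
  assumes bt: "btree S K Vs d p" and w: "w \<in> Vs"
  shows "i \<le> d w \<Longrightarrow> (p ^^ i) w \<in> Vs \<and> d ((p ^^ i) w) = d w - i"
    and "i < d w \<Longrightarrow> (p ^^ Suc i) w \<in> K \<and> E ((p ^^ Suc i) w) ((p ^^ i) w)"
proof -
  show *: "(p ^^ i) w \<in> Vs \<and> d ((p ^^ i) w) = d w - i" if "i \<le> d w" for i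
    using that
  proof (induction i)
    case (Suc i)
    then have "(p ^^ i) w \<in> Vs" "d ((p ^^ i) w) \<noteq> 0"
      by auto
    from btreeD(4)[OF bt this] show ?case
      using Suc by auto
  qed (use w in simp)
  show "(p ^^ Suc i) w \<in> K \<and> E ((p ^^ Suc i) w) ((p ^^ i) w)" if "i < d w"
    using btreeD(4)[OF bt, of "(p ^^ i) w"] *[of i] that by auto
qed

lemma ancestor_root: "btree S K Vs d p \<Longrightarrow> w \<in> Vs \<Longrightarrow> (p ^^ d w) w \<in> S"
  using btree_ancestor(1)[of S K Vs d p w "d w"] btreeD(3) by fastforce

lemma Cons_ancestors: "w # ancestors p m w = map (\<lambda>i. (p ^^ i) w) [0..<Suc m]"
  unfolding ancestors_def by (simp add: map_upt_Suc del: upt_Suc)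

text \<open>Labels drop by one at each predecessor, so no vertex repeats; counting the vertices then
  bounds the label by \<open>n\<close>.\<close>

lemma ancestors_walk:
  assumes bt: "btree S K Vs d p" and w: "w \<in> Vs"
  shows "distinct (w # ancestors p (d w) w)" "successively E (w # ancestors p (d w) w)"
    "set (ancestors p (d w) w) \<subseteq> Vs \<inter> K" "last (w # ancestors p (d w) w) \<in> S" "d w < n"
proof -
  have "i = j" if "i \<le> d w" "j \<le> d w" "(p ^^ i) w = (p ^^ j) w" for i j
    using btree_ancestor(1)[OF bt w, of i] btree_ancestor(1)[OF bt w, of j] that by auto
  then have "inj_on (\<lambda>i. (p ^^ i) w) {0..<Suc (d w)}"
    by (intro inj_onI) auto
  then show dist: "distinct (w # ancestors p (d w) w)"
    unfolding Cons_ancestors by (simp add: distinct_map del: upt_Suc)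
  show "successively E (w # ancestors p (d w) w)"
    unfolding Cons_ancestors successively_conv_nth
    using btree_ancestor(2)[OF bt w] sym by (auto simp del: upt_Suc)
  show sub: "set (ancestors p (d w) w) \<subseteq> Vs \<inter> K"
    using btree_ancestor(1)[OF bt w] btree_ancestor(2)[OF bt w] by (auto simp: ancestors_def Suc_leI simp del: funpow.simps)
  show "last (w # ancestors p (d w) w) \<in> S"
    unfolding Cons_ancestors using ancestor_root[OF bt w] by simp
  have "set (w # ancestors p (d w) w) \<subseteq> {..<n}"
    using sub w btreeD(2)[OF bt] by auto
  then have "card (set (w # ancestors p (d w) w)) \<le> n"
    using card_mono[of "{..<n}"] by fastforce
  then show "d w < n"
    using distinct_card[OF dist] by (simp add: ancestors_def)
qed

definition gpath :: "nat list \<Rightarrow> bool" where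
  "gpath P \<longleftrightarrow> P \<noteq> [] \<and> distinct P \<and> set P \<subseteq> {..<n} \<and> successively E P"

lemma gpath_length: "gpath P \<Longrightarrow> length P \<le> n"
  using card_mono[of "{..<n}" "set P"] by (simp add: gpath_def distinct_card)

lemma gpath_rev: "gpath P \<Longrightarrow> gpath (rev P)"
  using E_commute by (simp add: gpath_def)

text \<open>\<open>P\<close> may be a rearrangement of the path \<open>P\<^sub>0\<close> that also uses other vertices, but none
  that can be reached from \<open>v\<close> outside \<open>P\<^sub>0\<close>.\<close>

lemma gpath_extend:
  assumes P: "gpath P" and sub: "set P0 \<subseteq> set P"
    and bt: "btree {v} ({..<n} - set P0) Vs d p" and last: "last P \<in> Vs"
    and disj: "\<And>u. u \<in> set P \<Longrightarrow> u \<in> Vs \<Longrightarrow> u \<in> set P0"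
  shows "gpath (P @ ancestors p (d (last P)) (last P)) \<and> v \<in> set (P @ ancestors p (d (last P)) (last P))"
proof -
  let ?A = "ancestors p (d (last P)) (last P)"
  note A = ancestors_walk[OF bt last]
  have ne: "P \<noteq> []"
    using P by (simp add: gpath_def)
  have "set P \<inter> set ?A = {}"
    using A(3) disj by blast
  moreover have "successively E (P @ ?A)"
    using A(2) P ne by (cases ?A) (auto simp: gpath_def successively_append_iff)
  ultimately have "gpath (P @ ?A)"
    using P A(1,3) btreeD(2)[OF bt] by (auto simp: gpath_def)
  moreover have "last (last P # ?A) = v"
    using A(4) by simp
  then have "v = last P \<or> v \<in> set ?A"
    by (metis last.simps last_in_set)
  then have "v \<in> set (P @ ?A)"
    using ne by auto
  ultimately show ?thesis by simp
qed

text \<open>\<open>P\<close> and a detour outside it from \<open>hd P\<close> to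
  \<open>last P\<close> form a cycle, which is opened between the positions \<open>a - 1\<close> and
  \<open>a\<close>; the new path ends in \<open>P ! a\<close>, where the search from
  \<open>v\<close> arrives. The second search is rooted at \<open>last P\<close>, so the ancestors
  of \<open>hd P\<close> list the detour in the right order and end with \<open>last P\<close>,
  hence the \<open>butlast\<close>.\<close>

lemma gpath_rotate:
  assumes P: "gpath P" and bt1: "btree {v} ({..<n} - set P) Vs1 d1 p1"
    and bt2: "btree {last P} (insert (last P) ({..<n} - set P)) Vs2 d2 p2"
    and ends: "hd P \<notin> Vs1" "last P \<notin> Vs1" "hd P \<in> Vs2" and a: "a < length P" "P ! a \<in> Vs1"
    and P': "P' = rev (take a P) @ ancestors p2 (d2 (hd P)) (hd P) @ rev (drop a (butlast P))"
  shows "gpath P' \<and> set P \<subseteq> set P' \<and> last P' = P ! a \<and> (\<forall>u\<in>set P'. u \<in> Vs1 \<longrightarrow> u \<in> set P)"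
proof -
  define A where "A = ancestors p2 (d2 (hd P)) (hd P)"
  note W = ancestors_walk[OF bt2 ends(3)]
  have ne: "P \<noteq> []" and dist: "distinct P" and suc: "successively E P" and Pn: "set P \<subseteq> {..<n}"
    using P by (auto simp: gpath_def)
  have a0: "0 < a" and al: "Suc a < length P"
  proof -
    show "0 < a"
      using a ends ne by (metis hd_conv_nth neq0_conv)
    have "a \<noteq> length P - 1"
      using a ends ne by (metis last_conv_nth)
    then show "Suc a < length P"
      using a by linarith
  qed
  have hl: "hd P \<noteq> last P"
    using dist al by (simp add: hd_conv_nth last_conv_nth ne nth_eq_iff_index_eq)
  have Ane: "A \<noteq> []"
    using W(4) hl by (auto simp: A_def)
  have lastA: "last A = last P"
    using W(4) Ane by (simp add: A_def)
  have A_out: "u \<in> {..<n} - set P \<or> u = last P" if "u \<in> set A" for u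
    using W(3) that by (auto simp: A_def)
  \<comment> \<open>If the search from \<open>v\<close> reached a vertex of the detour outside
    \<open>P\<close>, it could run back along the detour and would reach
    \<open>hd P\<close>.\<close>
  have A_Vs1: "u \<notin> Vs1" if "u \<in> set A" for u
  proof -
    have "(p2 ^^ i) (hd P) \<notin> Vs1" if "i \<le> d2 (hd P)" for i
      using that
    proof (induction i)
      case 0
      then show ?case using ends by simp
    next
      case (Suc i)
      show ?case
      proof
        assume in1: "(p2 ^^ Suc i) (hd P) \<in> Vs1"
        have "(p2 ^^ Suc i) (hd P) \<in> set A"
          using Suc.prems by (auto simp: A_def ancestors_def)
        then have "(p2 ^^ Suc i) (hd P) \<in> {..<n} - set P"
          using A_out in1 ends(2) by metis
        then have "(p2 ^^ i) (hd P) \<in> Vs1"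
          using btreeD(5)[OF bt1 in1] btree_ancestor(2)[OF bt2 ends(3), of i] Suc.prems by auto
        then show False
          using Suc by simp
      qed
    qed
    then show ?thesis
      using that by (auto simp: A_def ancestors_def Suc_leI simp del: funpow.simps)
  qed
  have split: "P = take a P @ drop a (butlast P) @ [last P]"
    using al ne by (metis (no_types, lifting) append_assoc append_butlast_last_id append_take_drop_id
        butlast_conv_take le_less_Suc_eq drop_append diff_is_0_eq' drop0 length_butlast less_Suc_eq_le
        less_diff_conv nat_less_le not_less_eq plus_1_eq_Suc add.commute Suc_le_eq)
  define B C where "B = take a P" and "C = drop a (butlast P)"
  have PBC: "P = B @ C @ [last P]"
    using split by (simp add: B_def C_def)
  have Bne: "B \<noteq> []" and Cne: "C \<noteq> []"
    using a0 al ne by (auto simp: B_def C_def)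
  have hdB: "hd B = hd P"
    using Bne by (metis PBC hd_append2)
  have hdC: "hd C = P ! a"
    using al by (simp add: C_def hd_drop_conv_nth nth_butlast)
  have sucB: "successively E (rev B)" and sucC: "successively E (rev C)" and lC: "E (last C) (last P)"
  proof -
    have *: "successively E B" "successively E C" "E (last C) (last P)"
      using suc Cne by (subst (asm) PBC, simp add: successively_append_iff)+
    show "successively E (rev B)" "successively E (rev C)"
      using *(1,2) E_commute by (auto simp: successively_rev elim: successively_mono)
    show "E (last C) (last P)" by (fact *)
  qed
  have sucA: "successively E A" "E (hd P) (hd A)"
    using W(2) Ane by (cases A; simp add: A_def)+
  have "successively E (rev B @ A @ rev C)"
    using sucA sucB sucC lC lastA hdB Bne Cne Ane sym
    by (auto simp: successively_append_iff last_rev hd_rev)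
  moreover have "distinct (rev B @ A @ rev C)"
  proof -
    have "distinct (B @ C @ [last P])"
      using dist PBC by simp
    moreover have "distinct A"
      using W(1) by (simp add: A_def)
    moreover have "u \<notin> set B \<union> set C" if "u \<in> set A" for u
      using A_out[OF that] dist by (subst (asm) PBC, subst (asm) (2) PBC) auto
    ultimately show ?thesis by auto
  qed
  moreover have "set P \<subseteq> set (rev B @ A @ rev C)"
    using lastA Ane last_in_set[OF Ane] by (subst PBC) auto
  moreover have "set (rev B @ A @ rev C) \<subseteq> {..<n}"
    using Pn A_out ne last_in_set[OF ne] by (subst (asm) PBC) auto
  moreover have "u \<in> set P" if "u \<in> set (rev B @ A @ rev C)" "u \<in> Vs1" for u
    using that A_Vs1 by (subst PBC) auto
  ultimately show ?thesis
    using Cne hdC unfolding P' A_def[symmetric] B_def[symmetric] C_def[symmetric] gpath_def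
    by (auto simp: last_rev)
qed

text \<open>Listed from the root outwards, so that the position of a vertex is its distance.\<close>

definition geodesic :: "(nat \<Rightarrow> nat) \<Rightarrow> (nat \<Rightarrow> nat) \<Rightarrow> nat \<Rightarrow> nat list" where
  "geodesic d p w = rev (w # ancestors p (d w) w)"

text \<open>The labels of adjacent vertices differ by at most one, and along this list the labels
  are the positions; hence there are no chords.\<close>

lemma geodesic:
  assumes bt: "btree S {..<n} {..<n} d p" and w: "w < n"
  shows "length (geodesic d p w) = Suc (d w)"
    and "i \<le> d w \<Longrightarrow> d (geodesic d p w ! i) = i"
    and "geodesic d p w ! 0 \<in> S"
    and "geodesic d p w ! d w = w"
    and "set (geodesic d p w) \<subseteq> {..<n}"
    and "ipath (geodesic d p w)"
proof -
  have wV: "w \<in> {..<n}" using w by simp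
  let ?g = "geodesic d p w"
  show len: "length ?g = Suc (d w)"
    by (simp add: geodesic_def ancestors_def)
  have nth: "?g ! i = (p ^^ (d w - i)) w" if "i \<le> d w" for i
    using that unfolding geodesic_def Cons_ancestors by (simp add: rev_nth less_Suc_eq_le nth_upt[of 0 "d w - i" "Suc (d w)", simplified] del: upt_Suc)
  show d: "d (?g ! i) = i" if "i \<le> d w" for i
    using btree_ancestor(1)[OF bt wV, of "d w - i"] nth[OF that] that by simp
  show "?g ! 0 \<in> S"
    using nth[of 0] ancestor_root[OF bt wV] by simp
  show "?g ! d w = w"
    using nth[of "d w"] by simp
  show sub: "set ?g \<subseteq> {..<n}"
    using ancestors_walk(3)[OF bt wV] w by (auto simp: geodesic_def)
  have suc: "successively E ?g"
    using ancestors_walk(2)[OF bt wV] E_commute unfolding geodesic_def successively_rev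
    by (auto elim: successively_mono)
  have in_n: "?g ! i < n" if "i \<le> d w" for i
    using subsetD[OF sub nth_mem, of i] that len by simp
  show "ipath ?g"
    unfolding ipath_def
  proof (intro conjI allI impI)
    show "distinct ?g"
      using ancestors_walk(1)[OF bt wV] by (simp add: geodesic_def)
    fix i j
    assume i: "i < length ?g" and j: "j < length ?g"
    show "E (?g ! i) (?g ! j) \<longleftrightarrow> i = Suc j \<or> j = Suc i"
    proof
      assume e: "E (?g ! i) (?g ! j)"
      then have "j \<le> Suc i" "i \<le> Suc j"
        using btreeD(6)[OF bt, of "?g ! i" "?g ! j"] btreeD(6)[OF bt, of "?g ! j" "?g ! i"]
          d[of i] d[of j] i j len in_n sym by auto
      moreover have "i \<noteq> j"
        using e irrefl by auto
      ultimately show "i = Suc j \<or> j = Suc i" by linarith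
    next
      assume "i = Suc j \<or> j = Suc i"
      then show "E (?g ! i) (?g ! j)"
        using suc i j sym by (auto simp: successively_conv_nth)
    qed
  qed
qed

lemma geodesic_far:
  assumes bt: "btree S {..<n} {..<n} d p" and w: "w < n" and i: "2 \<le> i" "i \<le> d w" and u: "u \<in> S"
  shows "\<not> E (geodesic d p w ! i) u" "geodesic d p w ! i \<notin> S"
proof -
  have "d u = 0" "u < n"
    using btreeD(1,3)[OF bt] u by auto
  then show "\<not> E (geodesic d p w ! i) u"
    using btreeD(6)[OF bt, of u "geodesic d p w ! i"] geodesic(2)[OF bt w i(2)] i sym by auto
  show "geodesic d p w ! i \<notin> S"
    using btreeD(1,3)[OF bt] geodesic(2)[OF bt w i(2)] i by fastforce
qed

text \<open>A vertex of the coverage that is lost with the end \<open>x\<close> hangs on \<open>x\<close> alone.\<close>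

lemma private_leg:
  assumes bt: "btree S {..<n} {..<n} d p" and w: "w < n"
    and x: "x \<in> S" "y \<in> S" "y \<noteq> x" "E y x"
    and cov: "d w < k" "w \<notin> Nb (S - {x}) (k - 1)"
  shows "d w = k - 1" "geodesic d p w ! 0 = x"
    "\<And>i u. 1 \<le> i \<Longrightarrow> i \<le> d w \<Longrightarrow> u \<in> S \<Longrightarrow> u \<noteq> x \<Longrightarrow> \<not> E (geodesic d p w ! i) u"
    "\<And>i. 1 \<le> i \<Longrightarrow> i \<le> d w \<Longrightarrow> geodesic d p w ! i \<notin> S"
proof -
  let ?g = "geodesic d p w"
  note g = geodesic[OF bt w]
  have up: "w \<in> Nb {?g ! i} (d w - i)" if "i \<le> d w" for i
  proof -
    have "?g ! (i + j) \<in> Nb {?g ! i} j" if "i + j \<le> d w" for j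
      using that
    proof (induction j)
      case (Suc j)
      then have "E (?g ! (i + j)) (?g ! (i + Suc j))"
        using ipath_edge[OF g(6), of "i + j" "i + Suc j"] g(1) by simp
      then show ?case using Suc by auto
    qed simp
    from this[of "d w - i"] show ?thesis
      using that g(4) by simp
  qed
  \<comment> \<open>A shortest path from another vertex of \<open>S\<close> would keep
    \<open>w\<close> covered after the removal of \<open>x\<close>.\<close>
  show root: "?g ! 0 = x"
  proof (rule ccontr)
    assume "?g ! 0 \<noteq> x"
    then have "w \<in> Nb (S - {x}) (0 + d w)"
      using up[of 0] g(3) by (intro Nb_add[of "?g ! 0"]) auto
    moreover have "d w \<le> k - 1"
      using cov by simp
    ultimately show False
      using cov Nb_le[of "d w" "k - 1" "S - {x}"] by auto
  qed
  \<comment> \<open>If \<open>w\<close> were closer, one more step would be affordable, and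
    \<open>w\<close> would stay covered from the neighbour \<open>y\<close> of
    \<open>x\<close>.\<close>
  show dk: "d w = k - 1"
  proof (rule ccontr)
    assume "d w \<noteq> k - 1"
    then have "Suc (d w) \<le> k - 1"
      using cov by simp
    moreover have "x \<in> Nb (S - {x}) 1"
      using x by auto
    then have "w \<in> Nb (S - {x}) (1 + d w)"
      using up[of 0] root by (intro Nb_add[of x]) auto
    ultimately show False
      using cov Nb_le[of "Suc (d w)" "k - 1" "S - {x}"] by auto
  qed
  fix i
  assume i: "1 \<le> i" "i \<le> d w"
  \<comment> \<open>Such an edge would give a route from \<open>u\<close> to \<open>w\<close> of
    length \<open>1 + (d w - i)\<close>, which is at most \<open>k - 1\<close> because of
    \<open>1 \<le> i\<close>.\<close>
  show "\<not> E (?g ! i) u" if "u \<in> S" "u \<noteq> x" for u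
  proof
    assume "E (?g ! i) u"
    then have "?g ! i \<in> Nb (S - {x}) 1"
      using that sym by auto
    then have "w \<in> Nb (S - {x}) (1 + (d w - i))"
      using up[OF i(2)] by (intro Nb_add[of "?g ! i"])
    moreover have "1 + (d w - i) \<le> k - 1"
      using i dk by linarith
    ultimately show False
      using cov(2) Nb_le[of "1 + (d w - i)" "k - 1" "S - {x}"] by blast
  qed
  show "?g ! i \<notin> S"
    using btreeD(1,3)[OF bt] g(2)[OF i(2)] i by fastforce
qed

end

section \<open>From legs and a minimal set to the induced subgraphs\<close>

section \<open>The obstructions\<close>

context problem
begin

text \<open>Together with the vertex that it hangs on, each leg is a path on \<open>k\<close>
  vertices, as \<open>M_family\<close> demands.\<close>

definition legs :: "nat set \<Rightarrow> nat \<Rightarrow> nat \<Rightarrow> nat \<Rightarrow> nat list \<Rightarrow> nat list \<Rightarrow> nat list \<Rightarrow> bool" where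
  "legs J a b c ra rb rc \<longleftrightarrow> pendant J a ra \<and> pendant J b rb \<and> pendant J c rc \<and>
     apart (set ra) (set rb) \<and> apart (set ra) (set rc) \<and> apart (set rb) (set rc) \<and>
     length ra = k - 1 \<and> length rb = k - 1 \<and> length rc = k - 1"

lemma legs_permute:
  "legs J a b c ra rb rc \<Longrightarrow> legs J c b a rc rb ra" "legs J a b c ra rb rc \<Longrightarrow> legs J c a b rc ra rb"
  by (auto simp: legs_def apart_commute)

definition obstruction :: "nat set \<Rightarrow> bool" where
  "obstruction U \<longleftrightarrow> U \<subseteq> {..<n} \<and> (digraph_iso (with_proj G \<restriction> U) (S_graph k) \<or>
     digraph_iso (with_proj G \<restriction> U) (T_graph k) \<or> (\<exists>H\<in>M_family k. digraph_iso (with_proj G \<restriction> U) H))"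

definition nbrs :: "nat set \<Rightarrow> nat \<Rightarrow> nat" where
  "nbrs J u = card {w \<in> J. E u w}"

text \<open>Replaces distances by a recurrence: a family of sets that starts with the sources and
  always grows by its neighbours in \<open>F\<close> is the family of balls. It will be applied to
  sets described by intervals of positions, for which the recurrence is checked by
  arithmetic.\<close>

lemma btree_ball:
  assumes bt: "btree C F Vs d p" and H0: "H 0 = C" "C \<subseteq> F"
    and step: "\<And>e. e < m \<Longrightarrow> H (Suc e) = H e \<union> {w \<in> F. \<exists>u\<in>H e. E u w}"
  shows "e \<le> m \<Longrightarrow> {w \<in> F. w \<in> Vs \<and> d w \<le> e} = H e"
proof (induction e)
  case 0
  then show ?case
    using btreeD(1,3)[OF bt] H0 by auto
next
  case (Suc e)
  have "w \<in> Vs \<and> d w \<le> Suc e \<longleftrightarrow> w \<in> Vs \<and> d w \<le> e \<or> (\<exists>u\<in>F. u \<in> Vs \<and> d u \<le> e \<and> E u w)" for w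
  proof
    assume w: "w \<in> Vs \<and> d w \<le> Suc e"
    show "w \<in> Vs \<and> d w \<le> e \<or> (\<exists>u\<in>F. u \<in> Vs \<and> d u \<le> e \<and> E u w)"
    proof (cases "d w = 0")
      case False
      then show ?thesis
        using btreeD(4)[OF bt, of w] w by auto
    qed (use w in auto)
  next
    assume "w \<in> Vs \<and> d w \<le> e \<or> (\<exists>u\<in>F. u \<in> Vs \<and> d u \<le> e \<and> E u w)"
    then show "w \<in> Vs \<and> d w \<le> Suc e"
    proof
      assume "\<exists>u\<in>F. u \<in> Vs \<and> d u \<le> e \<and> E u w"
      then obtain u where "u \<in> F" "u \<in> Vs" "d u \<le> e" "E u w"
        by blast
      then show ?thesis
        using btreeD(5,6)[OF bt, of u w] by auto
    qed simp
  qed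
  then have "{w \<in> F. w \<in> Vs \<and> d w \<le> Suc e} = {w \<in> F. w \<in> Vs \<and> d w \<le> e} \<union>
      {w \<in> F. \<exists>u\<in>{w \<in> F. w \<in> Vs \<and> d w \<le> e}. E u w}"
    by blast
  then show ?case
    using Suc step[of e] by simp
qed

lemma branched_E:
  assumes "branched M Z A"
  shows "\<And>i j. i < length M \<Longrightarrow> j < length M \<Longrightarrow> E (M ! i) (M ! j) \<longleftrightarrow> i = Suc j \<or> j = Suc i"
    and "\<And>i j. i < length Z \<Longrightarrow> j < length Z \<Longrightarrow> E (Z ! i) (Z ! j) \<longleftrightarrow> i = Suc j \<or> j = Suc i"
    and "\<And>i j. i < length M \<Longrightarrow> j < length Z \<Longrightarrow> E (M ! i) (Z ! j) \<longleftrightarrow> j = 0 \<and> i \<in> A"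
    and "\<And>i j. i < length M \<Longrightarrow> j < length Z \<Longrightarrow> E (Z ! j) (M ! i) \<longleftrightarrow> j = 0 \<and> i \<in> A"
  by (simp_all add: E_def branchedD[OF assms])

lemma branched_attach:
  assumes "branched M Z A" "i \<in> A"
  shows "0 < i" "Suc i < length M"
proof -
  have "i \<in> {0<..<length M - 1}"
    using assms unfolding branched_def by blast
  then show "0 < i" "Suc i < length M"
    by auto
qed

lemma branched_nbrs_M:
  assumes br: "branched M Z A" and i: "i < length M"
  shows "i \<notin> A \<Longrightarrow> {w \<in> set M \<union> set Z. E (M ! i) w} \<subseteq> {M ! (i - 1), M ! Suc i}"
    and "i \<in> A \<Longrightarrow> {w \<in> set M \<union> set Z. E (M ! i) w} = {M ! (i - 1), M ! Suc i, Z ! 0}"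
proof -
  note B = branched_E[OF br]
  show "{w \<in> set M \<union> set Z. E (M ! i) w} \<subseteq> {M ! (i - 1), M ! Suc i}" if "i \<notin> A"
    using that i by (auto simp: in_set_conv_nth B)
  show "{w \<in> set M \<union> set Z. E (M ! i) w} = {M ! (i - 1), M ! Suc i, Z ! 0}" if "i \<in> A"
  proof -
    have "0 < i" "Suc i < length M" "0 < length Z"
      using br branched_attach[OF br that] by (auto simp: branched_def)
    then have "M ! (i - 1) \<in> set M" "M ! Suc i \<in> set M" "Z ! 0 \<in> set Z"
      "E (M ! i) (M ! (i - 1))" "E (M ! i) (M ! Suc i)" "E (M ! i) (Z ! 0)"
      using that i B(1)[of i "i - 1"] B(1)[of i "Suc i"] B(3)[of i 0] by simp_all
    moreover have "{w \<in> set M \<union> set Z. E (M ! i) w} \<subseteq> {M ! (i - 1), M ! Suc i, Z ! 0}"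
      using that i by (auto simp: in_set_conv_nth B)
    ultimately show ?thesis
      by blast
  qed
qed

lemma branched_nbrs_Z:
  assumes br: "branched M Z A" and j: "j < length Z"
  shows "0 < j \<Longrightarrow> {w \<in> set M \<union> set Z. E (Z ! j) w} \<subseteq> {Z ! (j - 1), Z ! Suc j}"
    and "{w \<in> set M \<union> set Z. E (Z ! 0) w} = (!) M ` A \<union> (if 1 < length Z then {Z ! 1} else {})"
proof -
  note B = branched_E[OF br]
  have A: "\<And>i. i \<in> A \<Longrightarrow> i < length M"
    using branched_attach[OF br] by (simp add: Suc_lessD)
  show "{w \<in> set M \<union> set Z. E (Z ! j) w} \<subseteq> {Z ! (j - 1), Z ! Suc j}" if "0 < j"
    using that j by (auto simp: in_set_conv_nth B)
  have "0 < length Z"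
    using j by linarith
  then show "{w \<in> set M \<union> set Z. E (Z ! 0) w} = (!) M ` A \<union> (if 1 < length Z then {Z ! 1} else {})"
    using A by (auto simp: in_set_conv_nth B)
qed

lemma card_le_pair: "X \<subseteq> {a, b} \<Longrightarrow> card X \<le> 2"
  using card_mono[of "{a, b}" X] by (simp add: card_insert_if split: if_splits)

lemma card_le_single: "X \<subseteq> {a} \<Longrightarrow> card X \<le> 1"
  using card_mono[of "{a}" X] by simp

text \<open>Degrees reveal the meeting place without knowledge of \<open>M\<close>, \<open>Z\<close>
  and the attachment set: an attachment vertex has two neighbours on \<open>M\<close>, since it is
  not an end, and \<open>Z ! 0\<close> as a third; the other vertices of \<open>M\<close> have at
  most two.\<close>

lemma nbrs_M:
  assumes br: "branched M Z A" and J: "J = set M \<union> set Z" and i: "i < length M"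
  shows "2 < nbrs J (M ! i) \<longleftrightarrow> i \<in> A"
proof (cases "i \<in> A")
  case True
  then have "0 < i" "Suc i < length M" "0 < length Z"
    using br branched_attach[OF br] by (auto simp: branched_def)
  then have "card {M ! (i - 1), M ! Suc i, Z ! 0} = 3"
    using branchedD(5,7)[OF br] by (simp add: card_insert_if)
  then show ?thesis
    using True branched_nbrs_M(2)[OF br i True] by (simp add: nbrs_def J)
next
  case False
  then show ?thesis
    using card_le_pair[OF branched_nbrs_M(1)[OF br i False]] by (simp add: nbrs_def J)
qed

lemma nbrs_Z:
  assumes br: "branched M Z A" and J: "J = set M \<union> set Z" and j: "j < length Z" "0 < j"
  shows "\<not> 2 < nbrs J (Z ! j)"
  using card_le_pair[OF branched_nbrs_Z(1)[OF br j]] by (simp add: nbrs_def J)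

lemma nbrs_path_ends:
  assumes br: "branched M Z A" and J: "J = set M \<union> set Z" and M: "M \<noteq> []"
  shows "nbrs J (hd M) \<le> 1" "nbrs J (last M) \<le> 1"
proof -
  note B = branched_E[OF br]
  have A: "0 \<notin> A" "length M - 1 \<notin> A"
    using br by (auto simp: branched_def)
  have pred: "length M - 1 = Suc i \<Longrightarrow> M ! i = M ! (length M - 2)" for i
    by (rule arg_cong[where f = "(!) M"]) linarith
  have "{w \<in> J. E (M ! 0) w} \<subseteq> {M ! 1}"
    using M A by (auto simp: in_set_conv_nth J B)
  moreover have "w = M ! (length M - 2)" if w: "w \<in> J" "E (M ! (length M - 1)) w" for w
  proof -
    consider i where "i < length M" "w = M ! i" | j where "j < length Z" "w = Z ! j"
      using w(1) by (auto simp: J in_set_conv_nth)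
    then show ?thesis
    proof cases
      case 1
      then show ?thesis
        using w(2) M B(1)[of "length M - 1" i] pred[of i] by auto
    next
      case 2
      then show ?thesis
        using w(2) M A B(3)[of "length M - 1" j] by auto
    qed
  qed
  then have "{w \<in> J. E (M ! (length M - 1)) w} \<subseteq> {M ! (length M - 2)}"
    by blast
  ultimately show "nbrs J (hd M) \<le> 1" "nbrs J (last M) \<le> 1"
    using M card_le_single[of "{w \<in> J. E (M ! 0) w}"] card_le_single[of "{w \<in> J. E (M ! (length M - 1)) w}"]
    by (auto simp: nbrs_def hd_conv_nth last_conv_nth)
qed

text \<open>The program knows \<open>J\<close> and \<open>F\<close>, but neither the shape nor the
  terminal that ends the branch. A terminal with two neighbours in \<open>J\<close> occurs only in
  the shape of \<open>M_class\<close>, and then all of \<open>F\<close> is the answer. Otherwise the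
  vertices with more than two neighbours are the centre of the claw or the corners of the triangle,
  and the answer is the ball of radius \<open>k\<close> around them inside \<open>F\<close>.\<close>

lemma tripod_output:
  assumes tri: "tripod_on I a b c" and J: "J = I \<union> {a, b, c}" and legs: "legs J a b c ra rb rc"
    and F: "F = J \<union> set ra \<union> set rb \<union> set rc" and Fn: "F \<subseteq> {..<n}"
  shows "(\<exists>t\<in>{a, b, c}. 1 < nbrs J t) \<and> obstruction F \<or>
    (\<forall>t\<in>{a, b, c}. \<not> 1 < nbrs J t) \<and>
    (\<forall>Vs d p. btree {u \<in> J. 2 < nbrs J u} F Vs d p \<longrightarrow> obstruction {w \<in> F. w \<in> Vs \<and> d w \<le> k})"
proof -
  obtain M Z N where tr: "tripod M Z N" and M: "M \<noteq> []" "hd M = a" "last M = b" and Z: "last Z = c"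
    and MZ: "set M \<union> set Z = J"
    using tri J unfolding tripod_on_def by blast
  have br: "branched M Z N"
    using tr by (simp add: tripod_def)
  have Z0: "Z \<noteq> []" and Nsub: "N \<subseteq> {0<..<length M - 1}"
    using br by (auto simp: branched_def)
  define t where "t = k - 1"
  have len: "length ra = t" "length rb = t" "length rc = t"
    using legs by (auto simp: legs_def t_def)
  define M' Z' N' where "M' = rev ra @ M @ rb" and "Z' = Z @ rc" and "N' = (+) t ` N"
  have br': "branched M' Z' N'"
    unfolding M'_def Z'_def N'_def len(1)[symmetric]
    by (rule branched_extend[OF br M Z]) (use legs MZ in \<open>auto simp: legs_def\<close>)
  have len': "length M' = length M + 2 * t" "length Z' = length Z + t"
    by (simp_all add: M'_def Z'_def len)
  have Z'0: "Z' \<noteq> []"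
    using Z0 by (simp add: Z'_def)
  have F': "F = set M' \<union> set Z'"
    using F MZ by (auto simp: M'_def Z'_def)
  have kt: "k = Suc t"
    using k_pos by (simp add: t_def)
  have ends: "nbrs J a \<le> 1" "nbrs J b \<le> 1"
    using nbrs_path_ends[OF br MZ[symmetric] M(1)] M by auto
  note B' = branched_E[OF br']
  show ?thesis
  proof (cases "length Z = 1 \<and> 2 \<le> card N")
    case True
    have "card N' = card N"
      unfolding N'_def by (intro card_image inj_onI) simp
    moreover have "N' \<subseteq> {k - 1<..<length M' - k}"
      using len' kt by (auto simp: N'_def dest!: subsetD[OF Nsub])
    moreover have "length Z' = k"
      using True len' kt by simp
    ultimately have "\<exists>H\<in>M_family k. digraph_iso (with_proj G \<restriction> F) H"
      using M_iso[OF br' k_pos] True Fn unfolding F' by (simp add: pverts_eq)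
    then have "obstruction F"
      using Fn by (simp add: obstruction_def)
    moreover have "1 < nbrs J c"
    proof -
      have "c = Z ! 0"
        using Z True Z0 by (simp add: last_conv_nth)
      moreover have "inj_on ((!) M) N"
        using branchedD(5)[OF br] branched_attach(2)[OF br] by (meson Suc_lessD inj_onI)
      ultimately show ?thesis
        using branched_nbrs_Z(2)[OF br, of 0] True Z0 MZ by (simp add: nbrs_def card_image)
    qed
    ultimately show ?thesis by blast
  next
    case False
    have Jm: "u \<in> J \<longleftrightarrow> (\<exists>i<length M. u = M ! i) \<or> (\<exists>j<length Z. u = Z ! j)" for u
      unfolding MZ[symmetric] by (auto simp: in_set_conv_nth)
    have Fm: "u \<in> F \<longleftrightarrow> (\<exists>i<length M'. u = M' ! i) \<or> (\<exists>j<length Z'. u = Z' ! j)" for u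
      unfolding F' by (auto simp: in_set_conv_nth)
    have Jc: "2 < nbrs J (M ! i) \<longleftrightarrow> i \<in> N" if "i < length M" for i
      using nbrs_M[OF br MZ[symmetric] that] .
    have Jz: "\<not> 2 < nbrs J (Z ! j)" if "j < length Z" "j \<noteq> 0" for j
      using nbrs_Z[OF br MZ[symmetric]] that by simp
    have JZ0: "{w \<in> J. E (Z ! 0) w} = (!) M ` N \<union> (if 1 < length Z then {Z ! 1} else {})"
      using branched_nbrs_Z(2)[OF br, of 0] Z0 MZ by simp
    have Zc: "nbrs J c \<le> 1" if "1 < length Z"
    proof -
      have "c = Z ! (length Z - 1)"
        using Z Z0 by (simp add: last_conv_nth)
      moreover have "w = Z ! (length Z - 2)" if w: "w \<in> J" "E (Z ! (length Z - 1)) w" for w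
      proof -
        have pred: "length Z - 1 = Suc j \<Longrightarrow> Z ! j = Z ! (length Z - 2)" for j
          by (rule arg_cong[where f = "(!) Z"]) linarith
        consider i where "i < length M" "w = M ! i" | j where "j < length Z" "w = Z ! j"
          using w(1) Jm by blast
        then show ?thesis
        proof cases
          case 1
          then show ?thesis
            using w(2) Z0 \<open>1 < length Z\<close> branched_E(4)[OF br, of i "length Z - 1"] by auto
        next
          case 2
          then show ?thesis
            using w(2) \<open>1 < length Z\<close> Z0 branched_E(2)[OF br, of "length Z - 1" j] pred[of j] by auto
        qed
      qed
      then have "{w \<in> J. E (Z ! (length Z - 1)) w} \<subseteq> {Z ! (length Z - 2)}"
        by blast
      ultimately show ?thesis
        using card_le_single by (simp add: nbrs_def)
    qed
    consider (S) m where "N = {m}" | (T) m where "N = {m, Suc m}" "1 < length Z"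
      using tr False by (auto simp: tripod_def)
    then show ?thesis
    proof cases
      case S
      have m: "0 < m" "Suc m < length M"
        using Nsub S by auto
      define m' where "m' = t + m"
      have N': "N' = {m'}"
        by (simp add: N'_def S m'_def)
      have "nbrs J c \<le> 1"
      proof (cases "1 < length Z")
        case False
        then have "c = Z ! 0"
          using Z Z0 by (cases Z) auto
        then show ?thesis
          using JZ0 False by (simp add: nbrs_def S)
      qed (rule Zc)
      moreover have "obstruction {w \<in> F. w \<in> Vs \<and> d w \<le> k}" if bt: "btree {u \<in> J. 2 < nbrs J u} F Vs d p" for Vs d p
      proof -
        \<comment> \<open>With a single attachment, \<open>Z ! 0\<close> has at most one more
          neighbour, so the attachment vertex on \<open>M\<close> is the only vertex of degree above
          two.\<close>
        have "nbrs J (Z ! 0) \<le> 2"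
          using card_le_pair[of _ "M ! m" "Z ! 1"] JZ0 by (auto simp: nbrs_def S)
        then have "\<not> 2 < nbrs J (Z ! j)" if "j < length Z" for j
          using Jz[OF that] by (cases "j = 0") auto
        then have "u = M ! m" if "u \<in> J" "2 < nbrs J u" for u
          using that Jc S by (auto simp: Jm)
        moreover have "M ! m \<in> J" "2 < nbrs J (M ! m)"
          using m MZ Jc[of m] S by auto
        ultimately have "{u \<in> J. 2 < nbrs J u} = {M ! m}"
          by blast
        moreover have "M' ! m' = M ! m"
          using m len by (simp add: M'_def m'_def nth_append)
        ultimately have C: "{u \<in> J. 2 < nbrs J u} = {M' ! m'}"
          by (simp only:)
        \<comment> \<open>The ball of radius \<open>e\<close> in positions. \<open>Z' ! 0\<close>
          enters at radius 1, hence the strict bound on the second interval.\<close>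
        define H where "H e = (!) M' ` {m' - e..m' + e} \<union> (!) Z' ` {..<e}" for e
        \<comment> \<open>The attachment is at least one step away from either end of
          \<open>M\<close>, and the leg adds \<open>k - 1\<close> steps: just enough for radius
          \<open>k\<close>.\<close>
        have fit: "k \<le> m'" "m' + k < length M'" "k \<le> length Z'"
          using m len' kt Z0 by (auto simp: m'_def Suc_le_eq)
        have step: "H (Suc e) = H e \<union> {w \<in> F. \<exists>u\<in>H e. E u w}" if e: "e < k" for e
        proof (intro subset_antisym subsetI)
          fix w
          assume "w \<in> H (Suc e)"
          moreover have "{m' - Suc e..m' + Suc e} \<subseteq> insert (m' - Suc e) (insert (Suc (m' + e)) {m' - e..m' + e})"
            by auto
          ultimately consider "w \<in> H e" | "w = M' ! (m' - Suc e)" | "w = M' ! Suc (m' + e)" | "w = Z' ! e"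
            unfolding H_def lessThan_Suc by blast
          then show "w \<in> H e \<union> {w \<in> F. \<exists>u\<in>H e. E u w}"
          proof cases
            case 2
            have "E (M' ! (m' - e)) w" "w \<in> F"
              using 2 e fit by (auto simp: B' F')
            moreover have "M' ! (m' - e) \<in> H e"
              by (auto simp: H_def)
            ultimately show ?thesis by blast
          next
            case 3
            have "E (M' ! (m' + e)) w" "w \<in> F"
              using 3 e fit by (auto simp: B' F')
            moreover have "M' ! (m' + e) \<in> H e"
              by (auto simp: H_def)
            ultimately show ?thesis by blast
          next
            case 4
            have "w \<in> F"
              using 4 e fit by (auto simp: F')
            moreover have "\<exists>u\<in>H e. E u w"
            proof (cases e)
              case 0
              then show ?thesis
                using 4 e fit Z'0 by (auto simp: H_def B' N')
            next
              case (Suc e')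
              then have "Z' ! e' \<in> H e" "E (Z' ! e') w"
                using 4 e fit by (auto simp: H_def B')
              then show ?thesis by blast
            qed
            ultimately show ?thesis by blast
          qed blast
        next
          fix w
          assume "w \<in> H e \<union> {w \<in> F. \<exists>u\<in>H e. E u w}"
          then consider "w \<in> H e" | u where "w \<in> F" "u \<in> H e" "E u w"
            by blast
          then show "w \<in> H (Suc e)"
          proof cases
            case 1
            then show ?thesis
              by (auto simp: H_def)
          next
            case 2
            have "u \<in> (!) M' ` {m' - e..m' + e} \<or> u \<in> (!) Z' ` {..<e}"
              using 2 by (simp add: H_def)
            moreover have "(\<exists>i<length M'. w = M' ! i) \<or> (\<exists>j<length Z'. w = Z' ! j)"
              using 2 Fm by simp
            ultimately show ?thesis
              using 2(3) e fit unfolding H_def by (elim disjE imageE exE conjE) (auto simp: B' N')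
          qed
        qed
        have "M' ! m' \<in> F"
          using fit by (simp add: F')
        then have "{w \<in> F. w \<in> Vs \<and> d w \<le> k} = H k"
          using btree_ball[OF bt, of H k k] step C by (simp add: H_def)
        moreover have "H k \<subseteq> {..<n}"
          using calculation Fn by auto
        ultimately show ?thesis
          using S_iso[OF br'[unfolded N'] k_pos fit, of "H k"] by (auto simp: obstruction_def H_def pverts_eq)
      qed
      ultimately show ?thesis
        using ends by auto
    next
      case T
      have m: "0 < m" "Suc (Suc m) < length M"
        using Nsub T by auto
      define m' where "m' = t + m"
      have N': "N' = {m', Suc m'}"
        by (simp add: N'_def T m'_def)
      moreover have "obstruction {w \<in> F. w \<in> Vs \<and> d w \<le> k}" if bt: "btree {u \<in> J. 2 < nbrs J u} F Vs d p" for Vs d p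
      proof -
        have "card {M ! m, M ! Suc m, Z ! 1} = 3"
          using m T branchedD(5,7)[OF br] by (simp add: card_insert_if)
        moreover have "{w \<in> J. E (Z ! 0) w} = {M ! m, M ! Suc m, Z ! 1}"
          using JZ0 T by auto
        ultimately have "2 < nbrs J (Z ! 0)"
          by (simp add: nbrs_def)
        moreover have "u \<in> {M ! m, M ! Suc m, Z ! 0}" if u: "u \<in> J" "2 < nbrs J u" for u
        proof -
          consider i where "i < length M" "u = M ! i" | j where "j < length Z" "u = Z ! j"
            using iffD1[OF Jm u(1)] by blast
          then show ?thesis
          proof cases
            case 1
            then have "i = m \<or> i = Suc m"
              using u(2) Jc[of i] T(1) by simp
            then show ?thesis
              using 1(2) by auto
          next
            case 2
            then have "j = 0"
              using u(2) Jz[of j] by auto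
            then show ?thesis
              using 2(2) by simp
          qed
        qed
        moreover have "M ! m \<in> J" "2 < nbrs J (M ! m)" "M ! Suc m \<in> J" "2 < nbrs J (M ! Suc m)" "Z ! 0 \<in> J"
          using m MZ Jc[of m] Jc[of "Suc m"] T Z0 by auto
        ultimately have "{u \<in> J. 2 < nbrs J u} = {M ! m, M ! Suc m, Z ! 0}"
          by blast
        moreover have "M' ! m' = M ! m" "M' ! Suc m' = M ! Suc m" "Z' ! 0 = Z ! 0"
          using m len Z0 by (auto simp: M'_def Z'_def m'_def nth_append)
        ultimately have C: "{u \<in> J. 2 < nbrs J u} = {M' ! m', M' ! Suc m', Z' ! 0}"
          by (simp only:)
        \<comment> \<open>\<open>Z' ! 0\<close> is now a corner and belongs to the ball of radius
          0.\<close>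
        define H where "H e = (!) M' ` {m' - e..Suc m' + e} \<union> (!) Z' ` {..e}" for e
        \<comment> \<open>On the third arm the missing step comes from \<open>1 < length Z\<close>:
          there is at least one vertex behind the corner before the leg begins.\<close>
        have fit: "k \<le> m'" "Suc m' + k < length M'" "k < length Z'"
          using m len' kt T by (auto simp: m'_def)
        have step: "H (Suc e) = H e \<union> {w \<in> F. \<exists>u\<in>H e. E u w}" if e: "e < k" for e
        proof (intro subset_antisym subsetI)
          fix w
          assume "w \<in> H (Suc e)"
          moreover have "{m' - Suc e..Suc m' + Suc e} \<subseteq>
              insert (m' - Suc e) (insert (Suc (Suc m' + e)) {m' - e..Suc m' + e})"
            by auto
          ultimately consider "w \<in> H e" | "w = M' ! (m' - Suc e)" | "w = M' ! Suc (Suc m' + e)" | "w = Z' ! Suc e"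
            unfolding H_def atMost_Suc by blast
          then show "w \<in> H e \<union> {w \<in> F. \<exists>u\<in>H e. E u w}"
          proof cases
            case 2
            have "E (M' ! (m' - e)) w" "w \<in> F"
              using 2 e fit by (auto simp: B' F')
            moreover have "M' ! (m' - e) \<in> H e"
              by (auto simp: H_def)
            ultimately show ?thesis by blast
          next
            case 3
            have "E (M' ! (Suc m' + e)) w" "w \<in> F"
              using 3 e fit by (auto simp: B' F')
            moreover have "M' ! (Suc m' + e) \<in> H e"
              unfolding H_def by (intro UnI1 imageI) auto
            ultimately show ?thesis by blast
          next
            case 4
            have "E (Z' ! e) w" "w \<in> F"
              using 4 e fit by (auto simp: B' F')
            moreover have "Z' ! e \<in> H e"
              by (auto simp: H_def)
            ultimately show ?thesis by blast
          qed blast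
        next
          fix w
          assume "w \<in> H e \<union> {w \<in> F. \<exists>u\<in>H e. E u w}"
          then consider "w \<in> H e" | u where "w \<in> F" "u \<in> H e" "E u w"
            by blast
          then show "w \<in> H (Suc e)"
          proof cases
            case 1
            then show ?thesis
              by (auto simp: H_def)
          next
            case 2
            have "u \<in> (!) M' ` {m' - e..Suc m' + e} \<or> u \<in> (!) Z' ` {..e}"
              using 2 by (simp add: H_def)
            moreover have "(\<exists>i<length M'. w = M' ! i) \<or> (\<exists>j<length Z'. w = Z' ! j)"
              using 2 Fm by simp
            ultimately show ?thesis
              using 2(3) e fit unfolding H_def by (elim disjE imageE exE conjE) (auto simp: B' N')
          qed
        qed
        have H0: "H 0 = {M' ! m', M' ! Suc m', Z' ! 0}"
          by (auto simp: H_def atLeastAtMostSuc_conv)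
        have "{M' ! m', M' ! Suc m', Z' ! 0} \<subseteq> F"
          using fit Z'0 by (auto simp: F')
        then have "{w \<in> F. w \<in> Vs \<and> d w \<le> k} = H k"
          using btree_ball[OF bt, of H k k] step C H0 by simp
        moreover have "H k \<subseteq> {..<n}"
          using calculation Fn by auto
        ultimately show ?thesis
          using T_iso[OF br'[unfolded N'] k_pos fit, of "H k"] by (auto simp: obstruction_def H_def pverts_eq)
      qed
      ultimately show ?thesis
        using ends Zc[OF T(2)] by auto
    qed
  qed
qed

end

lemma in_set_dropE:
  assumes "u \<in> set (drop m xs)"
  obtains i where "m \<le> i" "i < length xs" "u = xs ! i"
proof -
  obtain j where "j < length xs - m" "u = xs ! (m + j)"
    using assms by (auto simp: in_set_conv_nth)
  then show thesis
    using that[of "m + j"] by simp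
qed

context problem
begin

lemma apartI: "(\<And>u w. u \<in> X \<Longrightarrow> w \<in> Y \<Longrightarrow> u \<noteq> w \<and> \<not> E u w) \<Longrightarrow> apart X Y"
  unfolding apart_def by blast

text \<open>The two search regions separate the legs. A vertex of \<open>Vs1\<close> outside
  \<open>P\<close> has all its neighbours in \<open>Vs1\<close>. The path from \<open>q\<close> to
  \<open>v\<close> lies in \<open>Vs1\<close>, whereas the legs at \<open>x\<close> and
  \<open>y\<close> do not meet it, because from them the search would arrive at these ends. Likewise
  the leg at \<open>y\<close> lies in \<open>Vs2\<close> and the leg at \<open>x\<close> does not
  meet it. The set \<open>J\<close> is left open, as it is known only after the deletions.\<close>

lemma stuck_path:
  assumes P: "gpath P"
    and bt0: "btree (set P) {..<n} {..<n} d0 p0"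
    and bt1: "btree {v} ({..<n} - set P) Vs1 d1 p1"
    and bt2: "btree {last P} (insert (last P) ({..<n} - set P)) Vs2 d2 p2"
    and v: "v < n" "d0 v = k"
    and ends: "hd P \<notin> Vs1" "last P \<notin> Vs1" "hd P \<notin> Vs2"
    and xx: "xx < n" "d0 xx < k" "xx \<notin> Nb (set P - {hd P}) (k - 1)"
    and yy: "yy < n" "d0 yy < k" "yy \<notin> Nb (set P - {last P}) (k - 1)"
    and defs: "x = hd P" "y = last P" "q = geodesic d0 p0 v ! 1"
  shows "x \<noteq> y" "x \<noteq> q" "y \<noteq> q" "\<not> E x y" "\<not> E x q" "\<not> E y q" "q \<notin> set P" "q < n"
    and "feasible (set P - {x, y}) x y q"
    and "J \<subseteq> insert q (set P) \<Longrightarrow>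
      legs J x y q (tl (geodesic d0 p0 xx)) (tl (geodesic d0 p0 yy)) (drop 2 (geodesic d0 p0 v))"
proof -
  let ?gx = "geodesic d0 p0 xx" and ?gy = "geodesic d0 p0 yy" and ?gv = "geodesic d0 p0 v"
  note gx = geodesic[OF bt0 xx(1)] and gy = geodesic[OF bt0 yy(1)] and gv = geodesic[OF bt0 v(1), unfolded v(2)]
  have ne: "P \<noteq> []" and dist: "distinct P" and suc: "successively E P" and Pn: "set P \<subseteq> {..<n}"
    using P by (auto simp: gpath_def)
  have xP: "x \<in> set P" "y \<in> set P" and x0: "P ! 0 = x" and yl: "P ! (length P - 1) = y"
    using ne by (auto simp: defs hd_conv_nth last_conv_nth)
  have gv_lt: "?gv ! j < n" if "j \<le> k" for j
    using subsetD[OF gv(5) nth_mem, of j] gv(1) that by simp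
  have gx_lt: "?gx ! j < n" if "j \<le> d0 xx" for j
    using subsetD[OF gx(5) nth_mem, of j] gx(1) that by simp
  have gy_lt: "?gy ! j < n" if "j \<le> d0 yy" for j
    using subsetD[OF gy(5) nth_mem, of j] gy(1) that by simp
  have gv_out: "?gv ! j \<notin> set P" if "1 \<le> j" "j \<le> k" for j
    using btreeD(1,3)[OF bt0] gv(2)[of j] that by fastforce
  have gv_Vs1: "?gv ! (k - j) \<in> Vs1" if "j \<le> k" for j
    using that
  proof (induction j)
    case 0
    then show ?case using gv(4) btreeD(1)[OF bt1] by simp
  next
    case (Suc j)
    have "?gv ! (k - j) \<in> {..<n} - set P"
      using gv_out[of "k - j"] gv_lt[of "k - j"] Suc.prems by auto
    moreover have "k - j = Suc (k - Suc j)"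
      using Suc.prems by linarith
    then have "E (?gv ! (k - j)) (?gv ! (k - Suc j))"
      using ipath_edge[OF gv(6), of "k - j" "k - Suc j"] gv(1) Suc.prems by simp
    ultimately show ?case
      using btreeD(5)[OF bt1] Suc by auto
  qed
  have gv_V: "?gv ! j \<in> Vs1" if "j \<le> k" for j
    using gv_Vs1[of "k - j"] that by simp
  \<comment> \<open>The position at which the shortest path to \<open>v\<close> leaves
    \<open>P\<close>.\<close>
  define l where "l = (SOME l. l < length P \<and> P ! l = ?gv ! 0)"
  have l: "l < length P" "P ! l = ?gv ! 0"
    using gv(3) someI_ex[of "\<lambda>l. l < length P \<and> P ! l = ?gv ! 0"] unfolding l_def in_set_conv_nth by auto
  \<comment> \<open>The search from \<open>v\<close> reaches this vertex but neither end, so it is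
    an inner vertex of \<open>P\<close>. In particular \<open>P\<close> has an interior and its ends
    are different.\<close>
  have l_int: "0 < l" "Suc l < length P"
  proof -
    have "P ! l \<in> Vs1"
      using gv_V[of 0] l by simp
    then have "l \<noteq> 0" "l \<noteq> length P - 1"
      using ends x0 yl unfolding defs by metis+
    then show "0 < l" "Suc l < length P"
      using l(1) by auto
  qed
  show xy: "x \<noteq> y"
    using nth_eq_iff_index_eq[OF dist, of 0 "length P - 1"] l_int ne x0 yl by auto
  have px: "P ! 1 \<in> set P" "P ! 1 \<noteq> x" "E (P ! 1) x" and py: "P ! (length P - 2) \<in> set P"
    "P ! (length P - 2) \<noteq> y" "E (P ! (length P - 2)) y"
  proof -
    have "E (P ! 0) (P ! 1)"
      using suc l_int by (auto simp: successively_conv_nth)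
    then show "E (P ! 1) x" "P ! 1 \<noteq> x"
      using x0 sym irrefl by auto
    have "E (P ! (length P - 2)) (P ! Suc (length P - 2))"
      using suc l_int by (auto simp: successively_conv_nth)
    moreover have "Suc (length P - 2) = length P - 1"
      using l_int by linarith
    ultimately show "E (P ! (length P - 2)) y" "P ! (length P - 2) \<noteq> y"
      using yl irrefl by auto
    show "P ! 1 \<in> set P" "P ! (length P - 2) \<in> set P"
      using l_int by auto
  qed
  note lx = private_leg[OF bt0 xx(1) xP(1) px xx(2) xx(3)[folded defs]]
    and ly = private_leg[OF bt0 yy(1) xP(2) py yy(2) yy(3)[folded defs]]
  \<comment> \<open>Along the leg: a vertex of it in \<open>Vs1\<close> lies outside
    \<open>P\<close>, so its predecessor on the leg would be in \<open>Vs1\<close> as well, and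
    finally \<open>x\<close>.\<close>
  have gx_V: "?gx ! i \<notin> Vs1" if "i \<le> k - 1" for i
    using that
  proof (induction i)
    case 0
    then show ?case using lx(2) ends(1) by (simp add: defs)
  next
    case (Suc i)
    show ?case
    proof
      assume "?gx ! Suc i \<in> Vs1"
      moreover have "?gx ! Suc i \<in> {..<n} - set P"
        using lx(4)[of "Suc i"] gx_lt[of "Suc i"] Suc.prems lx(1) by auto
      moreover have "E (?gx ! Suc i) (?gx ! i)"
        using ipath_edge[OF gx(6), of "Suc i" i] gx(1) lx(1) Suc.prems by simp
      ultimately show False
        using btreeD(5)[OF bt1] Suc by auto
    qed
  qed
  have gy_V: "?gy ! i \<notin> Vs1" if "i \<le> k - 1" for i
    using that
  proof (induction i)
    case 0
    then show ?case using ly(2) ends(2) by (simp add: defs)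
  next
    case (Suc i)
    show ?case
    proof
      assume "?gy ! Suc i \<in> Vs1"
      moreover have "?gy ! Suc i \<in> {..<n} - set P"
        using ly(4)[of "Suc i"] gy_lt[of "Suc i"] Suc.prems ly(1) by auto
      moreover have "E (?gy ! Suc i) (?gy ! i)"
        using ipath_edge[OF gy(6), of "Suc i" i] gy(1) ly(1) Suc.prems by simp
      ultimately show False
        using btreeD(5)[OF bt1] Suc by auto
    qed
  qed
  have gx_V2: "?gx ! i \<notin> Vs2" if "i \<le> k - 1" for i
    using that
  proof (induction i)
    case 0
    then show ?case using lx(2) ends(3) by (simp add: defs)
  next
    case (Suc i)
    show ?case
    proof
      assume "?gx ! Suc i \<in> Vs2"
      moreover have "?gx ! Suc i \<in> insert (last P) ({..<n} - set P)"
        using lx(4)[of "Suc i"] gx_lt[of "Suc i"] Suc.prems lx(1) by auto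
      moreover have "E (?gx ! Suc i) (?gx ! i)"
        using ipath_edge[OF gx(6), of "Suc i" i] gx(1) lx(1) Suc.prems by simp
      ultimately show False
        using btreeD(5)[OF bt2] Suc by auto
    qed
  qed
  have gy_K2: "?gy ! i \<in> insert (last P) ({..<n} - set P)" if "i \<le> k - 1" for i
    using ly(4)[of i] gy_lt[of i] ly(1,2) that by (cases "i = 0") (auto simp: defs)
  have gy_V2: "?gy ! i \<in> Vs2" if "i \<le> k - 1" for i
    using that
  proof (induction i)
    case 0
    then show ?case using ly(2) btreeD(1)[OF bt2] by (simp add: defs)
  next
    case (Suc i)
    have "E (?gy ! i) (?gy ! Suc i)"
      using ipath_edge[OF gy(6), of i "Suc i"] gy(1) ly(1) Suc.prems by simp
    then show ?case
      using btreeD(5)[OF bt2] gy_K2[of i] Suc by auto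
  qed
  have xq_sep: "?gx ! i \<noteq> ?gv ! j \<and> \<not> E (?gx ! i) (?gv ! j)" if "i \<le> k - 1" "1 \<le> j" "j \<le> k" for i j
  proof -
    have "?gv ! j \<in> {..<n} - set P"
      using gv_out[of j] gv_lt[of j] that by auto
    then show ?thesis
      using gx_V[OF that(1)] gv_V[OF that(3)] btreeD(5)[OF bt1, of "?gv ! j" "?gx ! i"]
        sym[of "?gx ! i" "?gv ! j"] by metis
  qed
  have yq_sep: "?gy ! i \<noteq> ?gv ! j \<and> \<not> E (?gy ! i) (?gv ! j)" if "i \<le> k - 1" "1 \<le> j" "j \<le> k" for i j
  proof -
    have "?gv ! j \<in> {..<n} - set P"
      using gv_out[of j] gv_lt[of j] that by auto
    then show ?thesis
      using gy_V[OF that(1)] gv_V[OF that(3)] btreeD(5)[OF bt1, of "?gv ! j" "?gy ! i"]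
        sym[of "?gy ! i" "?gv ! j"] by metis
  qed
  have xy_sep: "?gx ! i \<noteq> ?gy ! j \<and> \<not> E (?gx ! i) (?gy ! j)" if "i \<le> k - 1" "j \<le> k - 1" for i j
    using gx_V2[OF that(1)] gy_V2[OF that(2)] gy_K2[OF that(2)]
      btreeD(5)[OF bt2, of "?gy ! j" "?gx ! i"] sym[of "?gx ! i" "?gy ! j"] by metis
  have k1: "1 \<le> k" by (fact k_pos)
  show "x \<noteq> q" "y \<noteq> q" "\<not> E x q" "\<not> E y q"
    using xq_sep[of 0 1] yq_sep[of 0 1] lx(2) ly(2) k1 by (auto simp: defs(3))
  show exy: "\<not> E x y"
    using xy_sep[of 0 0] lx(2) ly(2) by simp
  show qP: "q \<notin> set P" "q < n"
    using gv_out[of 1] gv_lt[of 1] k1 by (auto simp: defs(3))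
  show "feasible (set P - {x, y}) x y q"
  proof (rule feasibleI)
    have "P = x # butlast (tl P) @ [y]"
      using l_int xy unfolding defs by (cases P) (auto split: if_splits)
    then have "successively E (x # butlast (tl P) @ [y])" "distinct (x # butlast (tl P) @ [y])"
      "set P = set (x # butlast (tl P) @ [y])"
      using suc dist by simp_all
    then have "successively E (butlast (tl P))" "set (butlast (tl P)) = set P - {x, y}"
      by (auto simp: successively_Cons successively_append_iff)
    then show "conn (set P - {x, y})"
      using conn_successively by metis
    show "E x (P ! 1)" "E y (P ! (length P - 2))"
      using px py sym by auto
    show "P ! 1 \<in> set P - {x, y}" "P ! (length P - 2) \<in> set P - {x, y}"
      using px py exy sym by auto
    show "E q (?gv ! 0)"
      using ipath_edge[OF gv(6), of 1 0] gv(1) k1 by (simp add: defs(3))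
    show "?gv ! 0 \<in> set P - {x, y}"
      using gv(3) gv_V[of 0] ends by (auto simp: defs)
  qed
  assume J: "J \<subseteq> insert q (set P)"
  have in_x: "\<exists>i. 1 \<le> i \<and> i \<le> k - 1 \<and> u = ?gx ! i" if u: "u \<in> set (tl ?gx)" for u
  proof -
    have "u \<in> set (drop 1 ?gx)"
      using u by (simp only: drop_Suc One_nat_def drop0)
    then obtain i where i: "1 \<le> i" "i < length ?gx" "u = ?gx ! i"
      by (rule in_set_dropE)
    moreover have "i \<le> k - 1"
      using i(2) unfolding gx(1) lx(1) by linarith
    ultimately show ?thesis
      by blast
  qed
  have in_y: "\<exists>i. 1 \<le> i \<and> i \<le> k - 1 \<and> u = ?gy ! i" if u: "u \<in> set (tl ?gy)" for u
  proof -
    have "u \<in> set (drop 1 ?gy)"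
      using u by (simp only: drop_Suc One_nat_def drop0)
    then obtain i where i: "1 \<le> i" "i < length ?gy" "u = ?gy ! i"
      by (rule in_set_dropE)
    moreover have "i \<le> k - 1"
      using i(2) unfolding gy(1) ly(1) by linarith
    ultimately show ?thesis
      by blast
  qed
  have in_v: "\<exists>i. 2 \<le> i \<and> i \<le> k \<and> u = ?gv ! i" if u: "u \<in> set (drop 2 ?gv)" for u
  proof -
    obtain i where i: "2 \<le> i" "i < length ?gv" "u = ?gv ! i"
      using u by (rule in_set_dropE)
    moreover have "i \<le> k"
      using i(2) unfolding gv(1) by linarith
    ultimately show ?thesis
      by blast
  qed
  have "pendant J x (tl ?gx)"
    unfolding pendant_def
  proof (intro conjI ballI impI)
    have "x # tl ?gx = ?gx"
      using lx(2) gx(1) by (cases ?gx) auto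
    then show "ipath (x # tl ?gx)"
      using gx(6) by simp
    have sep: "u \<notin> insert q (set P) \<and> (\<forall>w\<in>insert q (set P). w \<noteq> x \<longrightarrow> \<not> E u w)" if u: "u \<in> set (tl ?gx)" for u
    proof -
      obtain i where i: "1 \<le> i" "i \<le> k - 1" "u = ?gx ! i"
        using in_x[OF u] by blast
      then show ?thesis
        using lx(1) lx(3)[of i] lx(4)[of i] xq_sep[of i 1] k1 by (auto simp: defs(3))
    qed
    show "set (tl ?gx) \<inter> J = {}"
      using sep J by blast
    show "\<not> E u w" if "u \<in> set (tl ?gx)" "w \<in> J" "w \<noteq> x" for u w
      using sep[OF that(1)] that J by blast
  qed
  moreover have "pendant J y (tl ?gy)"
    unfolding pendant_def
  proof (intro conjI ballI impI)
    have "y # tl ?gy = ?gy"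
      using ly(2) gy(1) by (cases ?gy) auto
    then show "ipath (y # tl ?gy)"
      using gy(6) by simp
    have sep: "u \<notin> insert q (set P) \<and> (\<forall>w\<in>insert q (set P). w \<noteq> y \<longrightarrow> \<not> E u w)" if u: "u \<in> set (tl ?gy)" for u
    proof -
      obtain i where i: "1 \<le> i" "i \<le> k - 1" "u = ?gy ! i"
        using in_y[OF u] by blast
      then show ?thesis
        using ly(1) ly(3)[of i] ly(4)[of i] yq_sep[of i 1] k1 by (auto simp: defs(3))
    qed
    show "set (tl ?gy) \<inter> J = {}"
      using sep J by blast
    show "\<not> E u w" if "u \<in> set (tl ?gy)" "w \<in> J" "w \<noteq> y" for u w
      using sep[OF that(1)] that J by blast
  qed
  moreover have "pendant J q (drop 2 ?gv)"
    unfolding pendant_def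
  proof (intro conjI ballI impI)
    \<comment> \<open>\<open>q\<close> is at position 1; the vertices from position 2 on are too far
      from \<open>P\<close> to see it.\<close>
    have "q # drop 2 ?gv = drop 1 ?gv"
      using Cons_nth_drop_Suc[of 1 ?gv] gv(1) k1 by (simp add: defs(3) numeral_2_eq_2)
    then show "ipath (q # drop 2 ?gv)"
      using ipath_drop[OF gv(6), of 1] by simp
    have sep: "u \<notin> insert q (set P) \<and> (\<forall>w\<in>insert q (set P). w \<noteq> q \<longrightarrow> \<not> E u w)" if u: "u \<in> set (drop 2 ?gv)" for u
    proof -
      obtain i where i: "2 \<le> i" "i \<le> k" "u = ?gv ! i"
        using in_v[OF u] by blast
      moreover have "?gv ! i \<noteq> ?gv ! 1"
        using nth_eq_iff_index_eq[OF ipath_distinct[OF gv(6)], of i 1] i gv(1) by auto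
      ultimately show ?thesis
        using geodesic_far[OF bt0 v(1), of i] v(2) by (auto simp: defs(3))
    qed
    show "set (drop 2 ?gv) \<inter> J = {}"
      using sep J by blast
    show "\<not> E u w" if "u \<in> set (drop 2 ?gv)" "w \<in> J" "w \<noteq> q" for u w
      using sep[OF that(1)] that J by blast
  qed
  moreover have "apart (set (tl ?gx)) (set (tl ?gy))"
  proof (rule apartI)
    fix u w
    assume u: "u \<in> set (tl ?gx)" and w: "w \<in> set (tl ?gy)"
    obtain i where i: "1 \<le> i" "i \<le> k - 1" "u = ?gx ! i"
      using in_x[OF u] by blast
    obtain j where j: "1 \<le> j" "j \<le> k - 1" "w = ?gy ! j"
      using in_y[OF w] by blast
    show "u \<noteq> w \<and> \<not> E u w"
      using xy_sep[of i j] i j by simp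
  qed
  moreover have "apart (set (tl ?gx)) (set (drop 2 ?gv))"
  proof (rule apartI)
    fix u w
    assume u: "u \<in> set (tl ?gx)" and w: "w \<in> set (drop 2 ?gv)"
    obtain i where i: "1 \<le> i" "i \<le> k - 1" "u = ?gx ! i"
      using in_x[OF u] by blast
    obtain j where j: "2 \<le> j" "j \<le> k" "w = ?gv ! j"
      using in_v[OF w] by blast
    show "u \<noteq> w \<and> \<not> E u w"
      using xq_sep[of i j] i j by simp
  qed
  moreover have "apart (set (tl ?gy)) (set (drop 2 ?gv))"
  proof (rule apartI)
    fix u w
    assume u: "u \<in> set (tl ?gy)" and w: "w \<in> set (drop 2 ?gv)"
    obtain i where i: "1 \<le> i" "i \<le> k - 1" "u = ?gy ! i"
      using in_y[OF u] by blast
    obtain j where j: "2 \<le> j" "j \<le> k" "w = ?gv ! j"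
      using in_v[OF w] by blast
    show "u \<noteq> w \<and> \<not> E u w"
      using yq_sep[of i j] i j by simp
  qed
  ultimately show "legs J x y q (tl ?gx) (tl ?gy) (drop 2 ?gv)"
    using gx(1) gy(1) gv(1) lx(1) ly(1) by (simp add: legs_def)
qed

end

section \<open>Program pieces that examine and change the path\<close>

section \<open>The steps of the algorithm\<close>

lemma alist_same: "same_except X A s s' \<Longrightarrow> a \<notin> A \<Longrightarrow> alist s' a m = alist s a m"
  by (simp add: same_except_def alist_def)

lemma set_alist: "set (alist s a m) = snd s a ` {..<m}"
  by (auto simp: alist_def)

lemma length_alist [simp]: "length (alist s a m) = m"
  by (simp add: alist_def)

lemma nth_alist [simp]: "i < m \<Longrightarrow> alist s a m ! i = snd s a i"
  by (simp add: alist_def)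

abbreviation lt0 :: "aexp \<Rightarrow> bexp" where
  "lt0 e \<equiv> Less (Const 0) e"

definition mark_out :: com where
  "mark_out = Seq (fill ''src'' (Var ''n'') (Const 0)) (scatter ''src'' (Var ''len'') (Read ''out'' (Var ''i'')) 1)"

text \<open>Searches for a vertex of the stored coverage that the present sources do not cover. The
  test of \<open>''vis''\<close> matters for a path with a single vertex: no source is left then,
  and vertices that are not visited carry the label 0.\<close>

definition probe :: "name \<Rightarrow> name \<Rightarrow> com" where
  "probe f x = Seq bfs (search f x (Var ''n'') (And (Less (Read ''d0'' (Var ''i'')) (Var ''k''))
     (Not (And (lt0 (Read ''vis'' (Var ''i''))) (Less (Read ''dist'' (Var ''i'')) (Var ''k''))))))"

text \<open>The labels and predecessors are copied to \<open>''d0''\<close> and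
  \<open>''p0''\<close>, since the legs are read off much later, when other searches have
  overwritten \<open>''dist''\<close> and \<open>''par''\<close>.\<close>

definition cover :: com where
  "cover = Seq mark_out
     (Seq (fill ''ok'' (Var ''n'') (Const 1))
     (Seq bfs
     (Seq (fill ''d0'' (Var ''n'') (Read ''dist'' (Var ''i'')))
     (Seq (fill ''p0'' (Var ''n'') (Read ''par'' (Var ''i'')))
          (search ''fv'' ''v'' (Var ''n'') (And (Not (Less (Read ''d0'' (Var ''i'')) (Var ''k'')))
             (Not (Less (Var ''k'') (Read ''d0'' (Var ''i''))))))))))"

definition climb :: "name \<Rightarrow> name \<Rightarrow> name \<Rightarrow> name \<Rightarrow> com" where
  "climb pa di a c = While (lt0 (Read di (Var ''u''))) (Seq (Assign ''u'' (Read pa (Var ''u''))) (push a c (Var ''u'')))"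

definition last_out :: aexp where
  "last_out = Read ''out'' (Minus (Var ''len'') (Const 1))"

definition first_out :: aexp where
  "first_out = Read ''out'' (Const 0)"

text \<open>The detour between the ends is copied to \<open>''mid''\<close> before the second
  search, from \<open>v\<close>, overwrites the predecessors. The first search may expand its own
  root, so only the first \<open>len - 1\<close> vertices of the path are blocked; the root is
  blocked for the second.\<close>

definition trees :: com where
  "trees = Seq (fill ''src'' (Var ''n'') (Const 0))
     (Seq (Write ''src'' last_out (Const 1))
     (Seq (fill ''ok'' (Var ''n'') (Const 1))
     (Seq (scatter ''ok'' (Minus (Var ''len'') (Const 1)) (Read ''out'' (Var ''i'')) 0)
     (Seq bfs
     (Seq (Assign ''cyc'' (Read ''vis'' first_out))
     (Seq (Assign ''u'' first_out)
     (Seq (Assign ''ml'' (Const 0))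
     (Seq (Cond (lt0 (Var ''cyc'')) (climb ''par'' ''dist'' ''mid'' ''ml'') Skip)
     (Seq (fill ''src'' (Var ''n'') (Const 0))
     (Seq (Write ''src'' (Var ''v'') (Const 1))
     (Seq (Write ''ok'' last_out (Const 0)) bfs)))))))))))"

definition extend :: com where
  "extend = Seq (Assign ''u'' last_out) (climb ''par'' ''dist'' ''out'' ''len'')"

text \<open>The pieces are assembled in \<open>''new''\<close>, because \<open>''out''\<close> is
  still being read meanwhile.\<close>

definition rotate :: com where
  "rotate = Seq (Assign ''nl'' (Const 0))
     (Seq (pushes ''new'' ''nl'' (Var ''a'') (Read ''out'' (Minus (Minus (Var ''a'') (Const 1)) (Var ''i''))))
     (Seq (pushes ''new'' ''nl'' (Var ''ml'') (Read ''mid'' (Var ''i'')))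
     (Seq (pushes ''new'' ''nl'' (Minus (Minus (Var ''len'') (Const 1)) (Var ''a''))
            (Read ''out'' (Minus (Minus (Var ''len'') (Const 2)) (Var ''i''))))
     (Seq (fill ''out'' (Var ''nl'') (Read ''new'' (Var ''i'')))
          (Assign ''len'' (Var ''nl''))))))"

lemma climb_writes [simp]:
  "wregs (climb pa di a c) = {''u'', c}" "warrs (climb pa di a c) = {a}"
  by (auto simp: climb_def)

lemma prog_writes [simp]:
  "wregs mark_out = {''i''}" "warrs mark_out = {''src''}"
  "wregs (probe f x) = wregs bfs \<union> {f, x}" "warrs (probe f x) = warrs bfs"
  "wregs cover = wregs bfs \<union> {''fv'', ''v''}" "warrs cover = warrs bfs \<union> {''src'', ''ok'', ''d0'', ''p0''}"
  "wregs trees = wregs bfs \<union> {''cyc'', ''ml''}" "warrs trees = warrs bfs \<union> {''src'', ''ok'', ''mid''}"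
  "wregs extend = {''u'', ''len''}" "warrs extend = {''out''}"
  "wregs rotate = {''nl'', ''i'', ''len''}" "warrs rotate = {''new'', ''out''}"
  by (auto simp: mark_out_def probe_def cover_def trees_def extend_def rotate_def)

context problem
begin

lemma n_pos: "0 < n"
  using connected pverts_eq unfolding connected_def strongly_connected_def by auto

lemma n_le_N: "Suc n \<le> N"
  by (simp add: N_def)

definition on_path :: "nat list \<Rightarrow> store \<Rightarrow> bool" where
  "on_path P s \<longleftrightarrow> inp s \<and> gpath P \<and> alist s ''out'' (fst s ''len'') = P"

lemma on_path_same:
  "same_except X A s s' \<Longrightarrow> on_path P s \<Longrightarrow> {''n'', ''k'', ''len''} \<inter> X = {} \<Longrightarrow> {''off'', ''adj'', ''out''} \<inter> A = {} \<Longrightarrow>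
   on_path P s'"
  using inp_same[of X A s s'] alist_same[of X A s s' "''out''"] same_exceptD(1)[of X A s s' "''len''"]
  unfolding on_path_def by auto

lemma on_pathD:
  assumes "on_path P s"
  shows "inp s" "fst s ''n'' = n" "fst s ''k'' = k" "fst s ''len'' = length P" "length P \<le> n" "0 < length P"
    "\<And>i. i < length P \<Longrightarrow> snd s ''out'' i = P ! i" "\<And>i. i < length P \<Longrightarrow> P ! i < n"
    "snd s ''out'' ` {..<length P} = set P" "distinct P" "set P \<subseteq> {..<n}" "P \<noteq> []" "gpath P"
    "aval last_out s = last P" "aval first_out s = hd P" "last P < n" "hd P < n"
proof -
  show P: "inp s" "gpath P"
    using assms by (simp_all add: on_path_def)
  show len: "fst s ''len'' = length P"
    using assms length_alist unfolding on_path_def by metis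
  show "fst s ''n'' = n" "fst s ''k'' = k"
    using P by (simp_all add: inp_def)
  show "length P \<le> n" by (rule gpath_length[OF P(2)])
  show ne: "P \<noteq> []" and d: "distinct P" and sub: "set P \<subseteq> {..<n}"
    using P by (simp_all add: gpath_def)
  then show "0 < length P" by simp
  show nth: "snd s ''out'' i = P ! i" if "i < length P" for i
    using assms that len nth_alist[of i "fst s ''len''" s "''out''"] by (simp add: on_path_def)
  show lt: "P ! i < n" if "i < length P" for i
    using sub that nth_mem by blast
  show "snd s ''out'' ` {..<length P} = set P"
    using assms len set_alist[of s "''out''" "fst s ''len''"] by (simp add: on_path_def)
  show "aval last_out s = last P" "aval first_out s = hd P"
    using ne len nth[of 0] nth[of "length P - 1"] by (auto simp: last_out_def first_out_def hd_conv_nth last_conv_nth)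
  show "last P < n" "hd P < n"
    using subsetD[OF sub last_in_set[OF ne]] subsetD[OF sub hd_in_set[OF ne]] by auto
qed

text \<open>Meant for the saved copies, which agree with the arrays of the search only on
  vertices.\<close>

lemma btree_cong:
  assumes "btree S K Vs d p" "\<And>w. w \<in> Vs \<Longrightarrow> d' w = d w" "\<And>w. w \<in> Vs \<Longrightarrow> p' w = p w"
  shows "btree S K Vs d' p'"
  unfolding btree_def
proof (intro conjI ballI allI impI)
  fix w
  assume w: "w \<in> Vs - S"
  then have *: "p w \<in> Vs" "p w \<in> K" "E (p w) w" "d w = Suc (d (p w))"
    using assms(1) by (auto simp: btree_def)
  then show "p' w \<in> Vs \<inter> K" "E (p' w) w" "d' w = Suc (d' (p' w))"
    using w assms by auto
next
  fix u w
  assume u: "u \<in> Vs \<inter> K" and e: "E u w"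
  then show "w \<in> Vs" "d' w \<le> Suc (d' u)"
    using btreeD(5,6)[OF assms(1), of u w] assms(2) by auto
qed (use assms in \<open>auto simp: btree_def\<close>)

lemma wp_mark_out:
  assumes P: "on_path P s"
  shows "wp mark_out (\<lambda>t s'. marks s' ''src'' = set P \<and> t \<le> 6 * N) s"
  unfolding mark_out_def wp_Seq
proof (rule wp_fill[where m = n and f = "\<lambda>_. 0"])
  fix t1 s1
  assume s1: "same_except {''i''} {''src''} s s1" "snd s1 ''src'' = (\<lambda>j. if j < n then 0 else snd s ''src'' j)"
    "t1 \<le> 3 * n + 2"
  have P1: "on_path P s1"
    by (rule on_path_same[OF s1(1) P]) auto
  show "wp (scatter ''src'' (Var ''len'') (Read ''out'' (Var ''i'')) 1)
      (\<lambda>t' s'. marks s' ''src'' = set P \<and> t1 + t' \<le> 6 * N) s1"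
  proof (rule wp_scatter[where m = "length P" and f = "snd s1 ''out''"])
    fix t2 and s2 :: store
    assume s2: "snd s2 ''src'' = (\<lambda>w. if w \<in> snd s1 ''out'' ` {..<length P} then 1 else snd s1 ''src'' w)"
      "t2 \<le> 3 * length P + 2"
    show "marks s2 ''src'' = set P \<and> t1 + t2 \<le> 6 * N"
      using s2 s1(2,3) on_pathD(5,11)[OF P1] n_le_N by (auto simp: marks_def on_pathD(9)[OF P1])
  qed (use on_pathD(4)[OF P1] in \<open>auto simp: same_except_def\<close>)
qed (use on_pathD(2)[OF P] in \<open>auto simp: same_except_def\<close>)

lemma wp_probe:
  assumes P: "on_path P s" and src: "marks s ''src'' = S" and ok: "marks s ''ok'' = {..<n}"
    and bt: "btree (set P) {..<n} {..<n} (snd s ''d0'') (snd s ''p0'')"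
    and fx: "f \<noteq> x" "f \<notin> insert ''n'' (insert ''k'' (wregs bfs))" "x \<notin> insert ''n'' (insert ''k'' (wregs bfs))"
  shows "wp (probe f x) (\<lambda>t s'. (fst s' f = 0 \<and> Nb (set P) (k - 1) \<subseteq> Nb S (k - 1) \<or>
      fst s' f = 1 \<and> fst s' x < n \<and> snd s ''d0'' (fst s' x) < k \<and> fst s' x \<notin> Nb S (k - 1)) \<and> t \<le> 24 * N) s"
  unfolding probe_def wp_Seq
proof (rule wp_call[OF wp_bfs[OF on_pathD(1)[OF P] src ok]])
  fix t1 s1
  assume s1: "btree S {..<n} (marks s1 ''vis'') (snd s1 ''dist'') (snd s1 ''par'') \<and> t1 \<le> 19 * N"
    and same: "same_except (wregs bfs) (warrs bfs) s s1"
  have P1: "on_path P s1"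
    by (rule on_path_same[OF same P]) auto
  have d0: "snd s1 ''d0'' = snd s ''d0''"
    using same by (simp add: same_except_def)
  have lt_k: "a < k \<longleftrightarrow> a \<le> k - 1" for a
    using k_pos by linarith
  have near: "0 < snd s1 ''vis'' j \<and> snd s1 ''dist'' j < k \<longleftrightarrow> j \<in> Nb S (k - 1)" if "j < n" for j
    using btree_Nb[OF conjunct1[OF s1], of j "k - 1"] that lt_k by (auto simp: marks_def)
  have near0: "snd s ''d0'' j < k \<longleftrightarrow> j \<in> Nb (set P) (k - 1)" if "j < n" for j
    using btree_Nb[OF bt, of j "k - 1"] that lt_k by auto
  let ?P = "\<lambda>j. snd s ''d0'' j < k \<and> j \<notin> Nb S (k - 1)"
  show "wp (search f x (Var ''n'') (And (Less (Read ''d0'' (Var ''i'')) (Var ''k''))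
      (Not (And (lt0 (Read ''vis'' (Var ''i''))) (Less (Read ''dist'' (Var ''i'')) (Var ''k''))))))
      (\<lambda>t' s'. (fst s' f = 0 \<and> Nb (set P) (k - 1) \<subseteq> Nb S (k - 1) \<or>
      fst s' f = 1 \<and> fst s' x < n \<and> snd s ''d0'' (fst s' x) < k \<and> fst s' x \<notin> Nb S (k - 1)) \<and> t1 + t' \<le> 24 * N) s1"
  proof (rule wp_search[where m = n and P = ?P])
    fix j and s' :: store
    assume "j < n" "fst s' ''i'' = j" "same_except {''i'', f, x} {} s1 s'"
    then show "bval (And (Less (Read ''d0'' (Var ''i'')) (Var ''k''))
      (Not (And (lt0 (Read ''vis'' (Var ''i''))) (Less (Read ''dist'' (Var ''i'')) (Var ''k''))))) s' \<longleftrightarrow> ?P j"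
      using near[of j] d0 fx on_pathD(3)[OF P1] by (auto simp: same_except_def)
  next
    fix t2 and s2 :: store
    assume "fst s2 f = 0 \<and> (\<forall>j<n. \<not> ?P j) \<or> fst s2 f = 1 \<and> fst s2 x < n \<and> ?P (fst s2 x)" "t2 \<le> 5 * n + 3"
    moreover have "Nb (set P) (k - 1) \<subseteq> {..<n}"
      using Nb_subset on_pathD(11)[OF P] by blast
    ultimately show "(fst s2 f = 0 \<and> Nb (set P) (k - 1) \<subseteq> Nb S (k - 1) \<or>
      fst s2 f = 1 \<and> fst s2 x < n \<and> snd s ''d0'' (fst s2 x) < k \<and> fst s2 x \<notin> Nb S (k - 1)) \<and> t1 + t2 \<le> 24 * N"
      using near0 s1 n_le_N by auto
  qed (use fx on_pathD(2)[OF P1] in \<open>auto simp: same_except_def\<close>)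
qed

lemma wp_cover:
  assumes P: "on_path P s"
  shows "wp cover (\<lambda>t s'. marks s' ''src'' = set P \<and> marks s' ''ok'' = {..<n} \<and>
      btree (set P) {..<n} {..<n} (snd s' ''d0'') (snd s' ''p0'') \<and>
      (fst s' ''fv'' = 0 \<and> (\<forall>w<n. snd s' ''d0'' w \<noteq> k) \<or>
       fst s' ''fv'' = 1 \<and> fst s' ''v'' < n \<and> snd s' ''d0'' (fst s' ''v'') = k) \<and> t \<le> 39 * N) s"
  unfolding cover_def wp_Seq
proof (rule wp_call[OF wp_mark_out[OF P]])
  fix t1 s1
  assume s1: "marks s1 ''src'' = set P \<and> t1 \<le> 6 * N" and same1: "same_except (wregs mark_out) (warrs mark_out) s s1"
  have P1: "on_path P s1"
    by (rule on_path_same[OF same1 P]) auto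
  show "wp (fill ''ok'' (Var ''n'') (Const 1)) (\<lambda>t'. wp bfs (\<lambda>t'a. wp (fill ''d0'' (Var ''n'') (Read ''dist'' (Var ''i'')))
      (\<lambda>t'b. wp (fill ''p0'' (Var ''n'') (Read ''par'' (Var ''i'')))
      (\<lambda>t'c. wp (search ''fv'' ''v'' (Var ''n'') (And (Not (Less (Read ''d0'' (Var ''i'')) (Var ''k'')))
             (Not (Less (Var ''k'') (Read ''d0'' (Var ''i''))))))
      (\<lambda>t'd s'. marks s' ''src'' = set P \<and> marks s' ''ok'' = {..<n} \<and>
      btree (set P) {..<n} {..<n} (snd s' ''d0'') (snd s' ''p0'') \<and>
      (fst s' ''fv'' = 0 \<and> (\<forall>w<n. snd s' ''d0'' w \<noteq> k) \<or>
       fst s' ''fv'' = 1 \<and> fst s' ''v'' < n \<and> snd s' ''d0'' (fst s' ''v'') = k) \<and>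
       t1 + (t' + (t'a + (t'b + (t'c + t'd)))) \<le> 39 * N))))) s1"
  proof (rule wp_fill[where m = n and f = "\<lambda>_. 1"])
    fix t2 s2
    assume same2: "same_except {''i''} {''ok''} s1 s2" and s2: "snd s2 ''ok'' = (\<lambda>j. if j < n then 1 else snd s1 ''ok'' j)"
      "t2 \<le> 3 * n + 2"
    have P2: "on_path P s2"
      by (rule on_path_same[OF same2 P1]) auto
    have m2: "marks s2 ''src'' = set P" "marks s2 ''ok'' = {..<n}"
      using s1 marks_same[OF same2, of "''src''"] s2(1) by (auto simp: marks_def)
    show "wp bfs (\<lambda>t'a. wp (fill ''d0'' (Var ''n'') (Read ''dist'' (Var ''i'')))
      (\<lambda>t'b. wp (fill ''p0'' (Var ''n'') (Read ''par'' (Var ''i'')))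
      (\<lambda>t'c. wp (search ''fv'' ''v'' (Var ''n'') (And (Not (Less (Read ''d0'' (Var ''i'')) (Var ''k'')))
             (Not (Less (Var ''k'') (Read ''d0'' (Var ''i''))))))
      (\<lambda>t'd s'. marks s' ''src'' = set P \<and> marks s' ''ok'' = {..<n} \<and>
      btree (set P) {..<n} {..<n} (snd s' ''d0'') (snd s' ''p0'') \<and>
      (fst s' ''fv'' = 0 \<and> (\<forall>w<n. snd s' ''d0'' w \<noteq> k) \<or>
       fst s' ''fv'' = 1 \<and> fst s' ''v'' < n \<and> snd s' ''d0'' (fst s' ''v'') = k) \<and>
       t1 + (t2 + (t'a + (t'b + (t'c + t'd)))) \<le> 39 * N)))) s2"
    proof (rule wp_call[OF wp_bfs[OF on_pathD(1)[OF P2] m2]])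
      fix t3 s3
      assume s3: "btree (set P) {..<n} (marks s3 ''vis'') (snd s3 ''dist'') (snd s3 ''par'') \<and> t3 \<le> 19 * N"
        and same3: "same_except (wregs bfs) (warrs bfs) s2 s3"
      have P3: "on_path P s3"
        by (rule on_path_same[OF same3 P2]) auto
      have m3: "marks s3 ''src'' = set P" "marks s3 ''ok'' = {..<n}"
        using m2 marks_same[OF same3] by auto
      have bt: "btree (set P) {..<n} {..<n} (snd s3 ''dist'') (snd s3 ''par'')"
        using s3 btree_all[OF conjunct1[OF s3]] on_pathD(12)[OF P] by simp
      show "wp (fill ''d0'' (Var ''n'') (Read ''dist'' (Var ''i'')))
      (\<lambda>t'b. wp (fill ''p0'' (Var ''n'') (Read ''par'' (Var ''i'')))
      (\<lambda>t'c. wp (search ''fv'' ''v'' (Var ''n'') (And (Not (Less (Read ''d0'' (Var ''i'')) (Var ''k'')))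
             (Not (Less (Var ''k'') (Read ''d0'' (Var ''i''))))))
      (\<lambda>t'd s'. marks s' ''src'' = set P \<and> marks s' ''ok'' = {..<n} \<and>
      btree (set P) {..<n} {..<n} (snd s' ''d0'') (snd s' ''p0'') \<and>
      (fst s' ''fv'' = 0 \<and> (\<forall>w<n. snd s' ''d0'' w \<noteq> k) \<or>
       fst s' ''fv'' = 1 \<and> fst s' ''v'' < n \<and> snd s' ''d0'' (fst s' ''v'') = k) \<and>
       t1 + (t2 + (t3 + (t'b + (t'c + t'd)))) \<le> 39 * N))) s3"
      proof (rule wp_fill[where m = n and f = "snd s3 ''dist''"])
        fix t4 s4
        assume same4: "same_except {''i''} {''d0''} s3 s4"
          and s4: "snd s4 ''d0'' = (\<lambda>j. if j < n then snd s3 ''dist'' j else snd s3 ''d0'' j)" "t4 \<le> 3 * n + 2"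
        have P4: "on_path P s4"
          by (rule on_path_same[OF same4 P3]) auto
        show "wp (fill ''p0'' (Var ''n'') (Read ''par'' (Var ''i'')))
          (\<lambda>t'c. wp (search ''fv'' ''v'' (Var ''n'') (And (Not (Less (Read ''d0'' (Var ''i'')) (Var ''k'')))
             (Not (Less (Var ''k'') (Read ''d0'' (Var ''i''))))))
          (\<lambda>t'd s'. marks s' ''src'' = set P \<and> marks s' ''ok'' = {..<n} \<and>
          btree (set P) {..<n} {..<n} (snd s' ''d0'') (snd s' ''p0'') \<and>
          (fst s' ''fv'' = 0 \<and> (\<forall>w<n. snd s' ''d0'' w \<noteq> k) \<or>
           fst s' ''fv'' = 1 \<and> fst s' ''v'' < n \<and> snd s' ''d0'' (fst s' ''v'') = k) \<and>
           t1 + (t2 + (t3 + (t4 + (t'c + t'd)))) \<le> 39 * N)) s4"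
        proof (rule wp_fill[where m = n and f = "snd s3 ''par''"])
          fix t5 s5
          assume same5: "same_except {''i''} {''p0''} s4 s5"
            and s5: "snd s5 ''p0'' = (\<lambda>j. if j < n then snd s3 ''par'' j else snd s4 ''p0'' j)" "t5 \<le> 3 * n + 2"
          have P5: "on_path P s5"
            by (rule on_path_same[OF same5 P4]) auto
          have bt5: "btree (set P) {..<n} {..<n} (snd s5 ''d0'') (snd s5 ''p0'')"
            by (rule btree_cong[OF bt]) (use same5 s4 s5 in \<open>auto simp: same_except_def\<close>)
          have m5: "marks s5 ''src'' = set P" "marks s5 ''ok'' = {..<n}"
            using m3 marks_same[OF same4] marks_same[OF same5] by auto
          show "wp (search ''fv'' ''v'' (Var ''n'') (And (Not (Less (Read ''d0'' (Var ''i'')) (Var ''k'')))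
             (Not (Less (Var ''k'') (Read ''d0'' (Var ''i''))))))
            (\<lambda>t'd s'. marks s' ''src'' = set P \<and> marks s' ''ok'' = {..<n} \<and>
            btree (set P) {..<n} {..<n} (snd s' ''d0'') (snd s' ''p0'') \<and>
            (fst s' ''fv'' = 0 \<and> (\<forall>w<n. snd s' ''d0'' w \<noteq> k) \<or>
             fst s' ''fv'' = 1 \<and> fst s' ''v'' < n \<and> snd s' ''d0'' (fst s' ''v'') = k) \<and>
             t1 + (t2 + (t3 + (t4 + (t5 + t'd)))) \<le> 39 * N) s5"
          proof (rule wp_search[where m = n and P = "\<lambda>j. snd s5 ''d0'' j = k"])
            fix t6 s6
            assume same6: "same_except {''i'', ''fv'', ''v''} {} s5 s6"
              and s6: "fst s6 ''fv'' = 0 \<and> (\<forall>j<n. snd s5 ''d0'' j \<noteq> k) \<or>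
                fst s6 ''fv'' = 1 \<and> fst s6 ''v'' < n \<and> snd s5 ''d0'' (fst s6 ''v'') = k" "t6 \<le> 5 * n + 3"
            have "snd s6 = snd s5"
              using same6 by (auto simp: same_except_def)
            then show "marks s6 ''src'' = set P \<and> marks s6 ''ok'' = {..<n} \<and>
              btree (set P) {..<n} {..<n} (snd s6 ''d0'') (snd s6 ''p0'') \<and>
              (fst s6 ''fv'' = 0 \<and> (\<forall>w<n. snd s6 ''d0'' w \<noteq> k) \<or>
               fst s6 ''fv'' = 1 \<and> fst s6 ''v'' < n \<and> snd s6 ''d0'' (fst s6 ''v'') = k) \<and>
               t1 + (t2 + (t3 + (t4 + (t5 + t6)))) \<le> 39 * N"
              using m5 bt5 s6 s1 s2(2) s3 s4(2) s5(2) n_le_N marks_same[OF same6] by auto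
          next
            fix j and s' :: store
            assume *: "fst s' ''i'' = j" "same_except {''i'', ''fv'', ''v''} {} s5 s'"
            \<comment> \<open>Equality with \<open>k\<close> has to be expressed as neither smaller
              nor larger.\<close>
            define a where "a = snd s5 ''d0'' j"
            have "snd s' ''d0'' j = a" "fst s' ''k'' = k"
              using *(2) on_pathD(3)[OF P5] by (simp_all add: same_except_def a_def)
            then have "bval (And (Not (Less (Read ''d0'' (Var ''i'')) (Var ''k'')))
             (Not (Less (Var ''k'') (Read ''d0'' (Var ''i''))))) s' \<longleftrightarrow> \<not> a < k \<and> \<not> k < a"
              using *(1) by simp
            also have "\<dots> \<longleftrightarrow> a = k"
              by linarith
            finally show "bval (And (Not (Less (Read ''d0'' (Var ''i'')) (Var ''k'')))
             (Not (Less (Var ''k'') (Read ''d0'' (Var ''i''))))) s' \<longleftrightarrow> snd s5 ''d0'' j = k"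
              by (simp only: a_def)
          qed (use on_pathD(2)[OF P5] in \<open>simp_all add: same_except_def\<close>)
        qed (use on_pathD(2)[OF P4] same4 in \<open>auto simp: same_except_def\<close>)
      qed (use on_pathD(2)[OF P3] in \<open>auto simp: same_except_def\<close>)
    qed
  qed (use on_pathD(2)[OF P1] in \<open>auto simp: same_except_def\<close>)
qed

lemma wp_climb:
  assumes bt: "btree S K Vs (snd s di) (snd s pa)" and w: "fst s ''u'' = w" "w \<in> Vs"
    and names: "a \<noteq> di" "a \<noteq> pa" "c \<noteq> ''u''"
  shows "wp (climb pa di a c) (\<lambda>t s'. alist s' a (fst s' c) =
      alist s a (fst s c) @ ancestors (snd s pa) (snd s di w) w \<and> t \<le> 4 * N) s"
proof -
  define m where "m = snd s di w"
  define I where "I s' \<longleftrightarrow> (\<exists>i\<le>m. fst s' ''u'' = (snd s pa ^^ i) w \<and>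
      alist s' a (fst s' c) = alist s a (fst s c) @ ancestors (snd s pa) i w \<and>
      snd s' di = snd s di \<and> snd s' pa = snd s pa)" for s' :: store
  have anc: "snd s di ((snd s pa ^^ i) w) = m - i" if "i \<le> m" for i
    using btree_ancestor(1)[OF bt w(2), of i] that by (simp add: m_def)
  have mn: "m < n"
    using ancestors_walk(5)[OF bt w(2)] by (simp add: m_def)
  show ?thesis
    unfolding climb_def
  \<comment> \<open>The label of the current vertex counts the remaining steps upwards; each costs 3
    and the test 1.\<close>
  proof (rule wp_While[where I = I and \<Phi> = "\<lambda>s'. 4 * snd s' di (fst s' ''u'')"])
    show "I s"
      unfolding I_def by (rule exI[of _ 0]) (simp add: w ancestors_def)
  next
    fix s'
    assume "I s'" and b: "bval (lt0 (Read di (Var ''u''))) s'"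
    then obtain i where i: "i \<le> m" "fst s' ''u'' = (snd s pa ^^ i) w"
      "alist s' a (fst s' c) = alist s a (fst s c) @ ancestors (snd s pa) i w"
      "snd s' di = snd s di" "snd s' pa = snd s pa"
      unfolding I_def by blast
    have lt: "i < m"
      using b i anc[OF i(1)] by simp
    have anc_Suc: "ancestors (snd s pa) (Suc i) w = ancestors (snd s pa) i w @ [snd s pa ((snd s pa ^^ i) w)]"
      by (simp add: ancestors_def)
    let ?x = "snd s pa ((snd s pa ^^ i) w)"
    let ?s = "((fst s')(''u'' := ?x, c := Suc (fst s' c)), (snd s')(a := (snd s' a)(fst s' c := ?x)))"
    have "alist ?s a (fst ?s c) = alist s' a (fst s' c) @ [?x]"
      using names by (simp add: alist_def)
    then have "I ?s"
      unfolding I_def using i lt names anc_Suc by (intro exI[of _ "Suc i"]) auto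
    moreover have "snd s di ?x = m - Suc i"
      using anc[of "Suc i"] lt by simp
    ultimately show "wp (Seq (Assign ''u'' (Read pa (Var ''u''))) (push a c (Var ''u'')))
        (\<lambda>t s''. I s'' \<and> Suc t + 4 * snd s'' di (fst s'' ''u'') \<le> 4 * snd s' di (fst s' ''u'')) s'"
      using i names lt anc[OF i(1)] by (simp add: push_def)
  next
    fix t s'
    assume "I s'" "\<not> bval (lt0 (Read di (Var ''u''))) s'" and t: "t \<le> Suc (4 * snd s di (fst s ''u''))"
    then obtain i where i: "i \<le> m" "fst s' ''u'' = (snd s pa ^^ i) w" "snd s' di ((snd s pa ^^ i) w) = 0"
      "alist s' a (fst s' c) = alist s a (fst s c) @ ancestors (snd s pa) i w" "snd s' di = snd s di"
      unfolding I_def by auto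
    then have "i = m"
      using anc[OF i(1)] by simp
    then show "alist s' a (fst s' c) = alist s a (fst s c) @ ancestors (snd s pa) (snd s di w) w \<and> t \<le> 4 * N"
      using i t mn n_le_N w(1) by (simp add: m_def)
  qed
qed

end

context problem
begin

lemma on_path_reg:
  "on_path P s \<Longrightarrow> x \<notin> {''n'', ''k'', ''len''} \<Longrightarrow> on_path P (reg x v s)"
  by (rule on_path_same[of "{x}" "{}" s]) (auto simp: same_except_def)

lemma on_path_array:
  "on_path P s \<Longrightarrow> a \<notin> {''off'', ''adj'', ''out''} \<Longrightarrow> on_path P (fst s, (snd s)(a := g))"
  by (rule on_path_same[of "{}" "{a}" s]) (auto simp: same_except_def)

lemma wp_set_all:
  assumes "inp s"
  shows "wp (fill a (Var ''n'') (Const c)) (\<lambda>t s'. snd s' a = (\<lambda>j. if j < n then c else snd s a j) \<and> t \<le> 3 * N) s"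
  by (rule wp_fill[where m = n and f = "\<lambda>_. c"]) (use assms n_le_N in \<open>auto simp: same_except_def inp_def\<close>)

lemma wp_trees:
  assumes P: "on_path P s" and v: "fst s ''v'' = v" "v < n" "v \<notin> set P"
  shows "wp trees (\<lambda>t s'. (\<exists>Vs d p. btree {last P} (insert (last P) ({..<n} - set P)) Vs d p \<and>
      (0 < fst s' ''cyc'' \<longleftrightarrow> hd P \<in> Vs) \<and>
      (hd P \<in> Vs \<longrightarrow> alist s' ''mid'' (fst s' ''ml'') = ancestors p (d (hd P)) (hd P))) \<and>
    btree {v} ({..<n} - set P) (marks s' ''vis'') (snd s' ''dist'') (snd s' ''par'') \<and> t \<le> 65 * N) s"
  unfolding trees_def wp_Seq
proof (rule wp_call[OF wp_set_all[OF on_pathD(1)[OF P]]], goal_cases)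
  case (1 t1 s1)
  note h1 = 1
  have P1: "on_path P s1"
    by (rule on_path_same[OF h1(2) P]) auto
  define u1 where "u1 = (fst s1, (snd s1)(''src'' := (snd s1 ''src'')(last P := 1)))"
  have Q1: "on_path P u1"
    unfolding u1_def by (rule on_path_array[OF P1]) simp
  have w1: "wp (Write ''src'' last_out (Const 1)) Q s1 = Q 1 u1" for Q
    using on_pathD(14)[OF P1] by (simp add: u1_def)
  show ?case
    unfolding w1
  proof (rule wp_call[OF wp_set_all[OF on_pathD(1)[OF Q1]]], goal_cases)
    case (1 t2 s2)
    note h2 = 1
    have P2: "on_path P s2"
      by (rule on_path_same[OF h2(2) Q1]) auto
    show ?case
    proof (rule wp_scatter[where m = "length P - 1" and f = "snd s2 ''out''"], goal_cases)
      case (3 t3 s3)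
      note h3 = 3
      have P3: "on_path P s3"
        by (rule on_path_same[OF h3(1) P2]) auto
      have bl: "snd s2 ''out'' ` {..<length P - 1} = set (butlast P)"
      proof -
        have "snd s2 ''out'' ` {..<length P - 1} = (!) P ` {..<length P - 1}"
          using on_pathD(7)[OF P2] by (intro image_cong) auto
        also have "\<dots> = set (take (length P - 1) P)"
          by (simp add: nth_image lessThan_atLeast0)
        finally show ?thesis
          by (simp add: butlast_conv_take)
      qed
      have Pbl: "set P = insert (last P) (set (butlast P))" "last P \<notin> set (butlast P)"
        using on_pathD(10,12)[OF P] by (metis append_butlast_last_id Un_insert_right list.simps(15) set_append
            sup_bot_right empty_set) (metis append_butlast_last_id distinct_butlast not_distinct_conv_prefix
            on_pathD(10,12)[OF P] distinct_append distinct.simps(2) disjoint_iff list.set_intros(1))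
      have m3: "marks s3 ''src'' = {last P}" "marks s3 ''ok'' = insert (last P) ({..<n} - set P)"
        using h1 h2 h3 on_pathD(16)[OF P] Pbl unfolding bl u1_def marks_def
        by (auto simp: same_except_def split: if_splits)
      show ?case
      proof (rule wp_call[OF wp_bfs[OF on_pathD(1)[OF P3] m3]], goal_cases)
        case (1 t4 s4)
        note h4 = 1
        have P4: "on_path P s4"
          by (rule on_path_same[OF h4(2) P3]) auto
        define u4 where "u4 = ((fst s4)(''cyc'' := snd s4 ''vis'' (hd P), ''u'' := hd P, ''ml'' := 0), snd s4)"
        have w4: "wp (Assign ''cyc'' (Read ''vis'' first_out))
            (\<lambda>a. wp (Assign ''u'' first_out) (\<lambda>b. wp (Assign ''ml'' (Const 0)) (\<lambda>c. Q a b c))) s4 = Q 1 1 1 u4" for Q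
          using on_pathD(15)[OF P4] by (simp add: u4_def first_out_def)
        let ?Vs = "marks s4 ''vis''" and ?d = "snd s4 ''dist''" and ?p = "snd s4 ''par''"
        have bt4: "btree {last P} (insert (last P) ({..<n} - set P)) ?Vs ?d ?p"
          using h4 by simp
        have cyc: "0 < fst u4 ''cyc'' \<longleftrightarrow> hd P \<in> ?Vs"
          using on_pathD(17)[OF P] by (simp add: u4_def marks_def)
        have Q4: "on_path P u4"
          unfolding u4_def using P4 by (simp add: on_path_def inp_def alist_def)
        have C: "wp (Cond (lt0 (Var ''cyc'')) (climb ''par'' ''dist'' ''mid'' ''ml'') Skip)
            (\<lambda>t s'. (hd P \<in> ?Vs \<longrightarrow> alist s' ''mid'' (fst s' ''ml'') = ancestors ?p (?d (hd P)) (hd P)) \<and> t \<le> 5 * N) u4"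
        proof (cases "hd P \<in> ?Vs")
          case True
          have "wp (climb ''par'' ''dist'' ''mid'' ''ml'') (\<lambda>t s'. alist s' ''mid'' (fst s' ''ml'') =
              alist u4 ''mid'' (fst u4 ''ml'') @ ancestors (snd u4 ''par'') (snd u4 ''dist'' (hd P)) (hd P) \<and> t \<le> 4 * N) u4"
            by (rule wp_climb[where S = "{last P}" and K = "insert (last P) ({..<n} - set P)" and Vs = ?Vs])
              (use bt4 True in \<open>auto simp: u4_def\<close>)
          then show ?thesis
            using True cyc n_le_N by (auto simp: u4_def alist_def elim!: wp_mono)
        next
          case False
          then show ?thesis
            using cyc n_le_N by auto
        qed
        show ?case
          unfolding w4
        proof (rule wp_call[OF C], goal_cases)
          case (1 t5 s5)
          note h5 = 1
          have P5: "on_path P s5"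
            by (rule on_path_same[OF h5(2) Q4]) auto
          show ?case
          proof (rule wp_call[OF wp_set_all[OF on_pathD(1)[OF P5]]], goal_cases)
            case (1 t6 s6)
            note h6 = 1
            have P6: "on_path P s6"
              by (rule on_path_same[OF h6(2) P5]) auto
            have v6: "fst s6 ''v'' = v"
              using h1(2) h2(2) h3(1) h4(2) h5(2) h6(2) v(1) by (simp add: same_except_def u1_def u4_def)
            define u6 where "u6 = (fst s6, (snd s6)(''src'' := (snd s6 ''src'')(v := 1), ''ok'' := (snd s6 ''ok'')(last P := 0)))"
            have Q6: "on_path P u6"
              unfolding u6_def using P6 by (simp add: on_path_def inp_def alist_def)
            have w6: "wp (Write ''src'' (Var ''v'') (Const 1)) (\<lambda>a. wp (Write ''ok'' last_out (Const 0)) (\<lambda>b. Q a b)) s6 = Q 1 1 u6" for Q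
            proof -
              have "aval last_out (fst s6, (snd s6)(''src'' := g)) = last P" for g
                using on_pathD(14)[OF P6] by (simp add: last_out_def)
              then show ?thesis
                using v6 by (simp add: u6_def)
            qed
            have ok6: "snd s6 ''ok'' = snd s3 ''ok''"
              using h4(2) h5(2) h6(2) by (simp add: same_except_def u4_def)
            have "{w. w < n \<and> 0 < snd s3 ''ok'' w} = insert (last P) ({..<n} - set P)"
              using m3(2) by (simp add: marks_def)
            then have K6: "marks u6 ''ok'' = {..<n} - set P"
              unfolding marks_def u6_def using ok6 Pbl(1) by auto
            have S6: "marks u6 ''src'' = {v}"
              unfolding marks_def u6_def using h6(1) v(2) by (auto split: if_splits)
            show ?case
              unfolding w6
            proof (rule wp_call[OF wp_bfs[OF on_pathD(1)[OF Q6] S6 K6]], goal_cases)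
              case (1 t7 s7)
              have "alist s7 ''mid'' (fst s7 ''ml'') = alist s5 ''mid'' (fst s5 ''ml'')" "fst s7 ''cyc'' = fst u4 ''cyc''"
                using 1(2) h6(2) h5(2) by (auto simp: same_except_def u6_def alist_def)
              then have "btree {last P} (insert (last P) ({..<n} - set P)) ?Vs ?d ?p \<and>
                  (0 < fst s7 ''cyc'' \<longleftrightarrow> hd P \<in> ?Vs) \<and>
                  (hd P \<in> ?Vs \<longrightarrow> alist s7 ''mid'' (fst s7 ''ml'') = ancestors ?p (?d (hd P)) (hd P))"
                using bt4 cyc h5(1) by simp
              moreover have "t1 + (1 + (t2 + (t3 + (t4 + (1 + (1 + (1 + (t5 + (t6 + (1 + (1 + t7))))))))))) \<le> 65 * N"
                using 1(1) h1(1) h2(1) h3(3) h4(1) h5(1) h6(1) on_pathD(5)[OF P] n_le_N by (elim conjE) linarith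
              ultimately show ?case
                using 1(1) by (intro conjI exI[of _ ?Vs] exI[of _ ?d] exI[of _ ?p]; simp)
            qed
          qed
        qed
      qed
    qed (use on_pathD(4)[OF P2] in \<open>auto simp: same_except_def\<close>)
  qed
qed

lemma wp_extend:
  assumes P: "on_path P s" and bt: "btree S K Vs (snd s ''dist'') (snd s ''par'')" and l: "last P \<in> Vs"
    and Q: "Q = P @ ancestors (snd s ''par'') (snd s ''dist'' (last P)) (last P)" "gpath Q"
  shows "wp extend (\<lambda>t s'. on_path Q s' \<and> t \<le> 5 * N) s"
proof -
  let ?s = "reg ''u'' (last P) s"
  have "wp (climb ''par'' ''dist'' ''out'' ''len'') (\<lambda>t s'. alist s' ''out'' (fst s' ''len'') =
      alist ?s ''out'' (fst ?s ''len'') @ ancestors (snd ?s ''par'') (snd ?s ''dist'' (last P)) (last P) \<and> t \<le> 4 * N) ?s"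
    by (rule wp_climb[where S = S and K = K and Vs = Vs]) (use bt l in auto)
  then have "wp (climb ''par'' ''dist'' ''out'' ''len'') (\<lambda>t s'. on_path Q s' \<and> Suc t \<le> 5 * N) ?s"
  proof (rule wp_call, goal_cases)
    case (1 t s')
    have "inp s'"
      using inp_same[OF 1(2)] on_pathD(1)[OF on_path_reg[OF P, of "''u''"]] by simp
    moreover have "alist s ''out'' (fst s ''len'') = P"
      using P by (simp add: on_path_def)
    ultimately show ?case
      using 1(1) Q n_le_N by (simp add: on_path_def)
  qed
  then show ?thesis
    using on_pathD(14)[OF P] by (simp add: extend_def)
qed

lemma wp_rotate:
  assumes P: "on_path P s" and a: "fst s ''a'' = a" "a < length P" and A: "alist s ''mid'' (fst s ''ml'') = A" 
    and Q: "Q = rev (take a P) @ A @ rev (drop a (butlast P))" "gpath Q"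
  shows "wp rotate (\<lambda>t s'. on_path Q s' \<and> t \<le> 16 * N) s"
proof -
  let ?s = "reg ''nl'' 0 s"
  have P0: "on_path P ?s"
    by (rule on_path_reg[OF P]) simp
  have lA: "fst s ''ml'' = length A"
    using A length_alist by metis
  have lQ: "length Q \<le> n"
    by (rule gpath_length[OF Q(2)])
  have lens: "a \<le> n" "length A \<le> n" "length P - 1 - a \<le> n"
    using lQ on_pathD(5)[OF P] a(2) by (auto simp: Q(1))
  have r1: "map (\<lambda>i. P ! (a - 1 - i)) [0..<a] = rev (take a P)"
    using a(2) by (intro nth_equalityI) (auto simp: rev_nth)
  have r2: "map (\<lambda>i. A ! i) [0..<length A] = A"
    by (rule map_nth)
  have r3: "map (\<lambda>i. P ! (length P - 2 - i)) [0..<length P - 1 - a] = rev (drop a (butlast P))"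
    using a(2) by (intro nth_equalityI) (auto simp: rev_nth nth_butlast intro!: arg_cong[where f = "(!) P"])
  have "wp (pushes ''new'' ''nl'' (Var ''a'') (Read ''out'' (Minus (Minus (Var ''a'') (Const 1)) (Var ''i''))))
     (\<lambda>t1. wp (pushes ''new'' ''nl'' (Var ''ml'') (Read ''mid'' (Var ''i'')))
     (\<lambda>t2. wp (pushes ''new'' ''nl'' (Minus (Minus (Var ''len'') (Const 1)) (Var ''a''))
            (Read ''out'' (Minus (Minus (Var ''len'') (Const 2)) (Var ''i''))))
     (\<lambda>t3. wp (fill ''out'' (Var ''nl'') (Read ''new'' (Var ''i'')))
     (\<lambda>t4. wp (Assign ''len'' (Var ''nl''))
     (\<lambda>t5 s'. on_path Q s' \<and> 1 + (t1 + (t2 + (t3 + (t4 + t5)))) \<le> 16 * N))))) ?s"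
  proof (rule wp_pushes[where m = a and f = "\<lambda>i. P ! (a - 1 - i)"], goal_cases)
    case (4 t1 s1)
    note h1 = 4
    have P1: "on_path P s1"
      by (rule on_path_same[OF h1(1) P0]) auto
    show ?case
    proof (rule wp_pushes[where m = "length A" and f = "\<lambda>i. A ! i"], goal_cases)
      case (3 j s')
      then have "snd s' ''mid'' j = snd s ''mid'' j"
        using h1(1) by (auto simp: same_except_def)
      then show ?case
        using 3 arg_cong[OF A, of "\<lambda>xs. xs ! j"] lA by simp
    next
      case (4 t2 s2)
      note h2 = 4
      have P2: "on_path P s2"
        by (rule on_path_same[OF h2(1) P1]) auto
      show ?case
      proof (rule wp_pushes[where m = "length P - 1 - a" and f = "\<lambda>i. P ! (length P - 2 - i)"], goal_cases)
        case (3 j s')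
        then have "snd s' ''out'' = snd s2 ''out''" "fst s' ''len'' = length P"
          using on_pathD(4)[OF P2] by (auto simp: same_except_def)
        then show ?case
          using 3 on_pathD(7)[OF P2, of "length P - 2 - j"] by simp
      next
        case (4 t3 s3)
        note h3 = 4
        have P3: "on_path P s3"
          by (rule on_path_same[OF h3(1) P2]) auto
        have new: "alist s3 ''new'' (fst s3 ''nl'') = Q"
          using h1(2) h2(2) h3(2) r1 r2 r3 Q(1) by (simp add: alist_def)
        then have nl: "fst s3 ''nl'' = length Q"
          using length_alist by metis
        show ?case
        proof (rule wp_fill[where m = "length Q" and f = "\<lambda>i. Q ! i"], goal_cases)
          case (2 j s')
          then show ?case
            using arg_cong[OF new, of "\<lambda>xs. xs ! j"] nl by (simp add: same_except_def)
        next
          case (3 t4 s4)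
          have i4: "inp s4"
            using inp_same[OF 3(1) on_pathD(1)[OF P3]] by simp
          have "alist s4 ''out'' (length Q) = Q"
            using 3(2) by (intro nth_equalityI) auto
          moreover have "fst s4 ''nl'' = length Q"
            using 3(1) nl by (simp add: same_except_def)
          moreover have "1 + (t1 + (t2 + (t3 + (t4 + 1)))) \<le> 16 * N"
            using h1(4) h2(4) h3(4) 3(3) lens lQ n_le_N by simp
          ultimately show ?case
            using i4 Q(2) by (simp add: on_path_def inp_def)
        qed (use nl in \<open>auto simp: same_except_def\<close>)
      qed (use on_pathD(4)[OF P2] h1(1) h2(1) a(1) in \<open>auto simp: same_except_def\<close>)
    qed (use h1(1) lA in \<open>auto simp: same_except_def\<close>)
  next
    case (3 j s')
    then have "snd s' ''out'' = snd s ''out''" "fst s' ''a'' = a"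
      using a(1) by (auto simp: same_except_def)
    then show ?case
      using 3 on_pathD(7)[OF P, of "a - 1 - j"] a(2) by simp
  qed (use a(1) in \<open>auto simp: same_except_def\<close>)
  then show ?thesis
    by (simp add: rotate_def)
qed

end

section \<open>Program pieces that extract the obstruction\<close>

definition test :: com where
  "test = Seq (search ''fr'' ''r'' (Var ''n'') (lt0 (Read ''I'' (Var ''i''))))
     (Seq (fill ''src'' (Var ''n'') (Const 0))
     (Seq (Cond (lt0 (Var ''fr'')) (Write ''src'' (Var ''r'') (Const 1)) Skip)
     (Seq (fill ''ok'' (Var ''n'') (Read ''I'' (Var ''i'')))
     (Seq bfs
     (Seq (search ''bad'' ''b'' (Var ''n'') (And (lt0 (Read ''I'' (Var ''i''))) (Not (lt0 (Read ''vis'' (Var ''i''))))))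
          (Cond (And (Less (Var ''bad'') (Const 1)) (And (lt0 (Read ''vis'' (Var ''x'')))
              (And (lt0 (Read ''vis'' (Var ''y''))) (lt0 (Read ''vis'' (Var ''q''))))))
            (Assign ''good'' (Const 1)) (Assign ''good'' (Const 0))))))))"

definition prune :: com where
  "prune = Seq (Assign ''g'' (Const 0))
     (While (Less (Var ''g'') (Var ''n''))
       (Cond (lt0 (Read ''I'' (Var ''g'')))
         (Seq (Write ''I'' (Var ''g'') (Const 0))
         (Seq test
              (Cond (lt0 (Var ''good'')) (Assign ''g'' (Const 0))
                (Seq (Write ''I'' (Var ''g'') (Const 1)) (Assign ''g'' (Succ (Var ''g'')))))))
         (Assign ''g'' (Succ (Var ''g'')))))"

definition degree :: com where
  "degree = Seq (Assign ''j'' (Read ''off'' (Var ''i'')))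
     (While (Less (Var ''j'') (Read ''off'' (Succ (Var ''i''))))
       (Seq (Cond (lt0 (Read ''I'' (Read ''adj'' (Var ''j''))))
              (Write ''cnt'' (Var ''i'') (Succ (Read ''cnt'' (Var ''i'')))) Skip)
            (Assign ''j'' (Succ (Var ''j'')))))"

definition count :: com where
  "count = Seq (fill ''cnt'' (Var ''n'') (Const 0)) (For ''i'' (Var ''n'') degree)"

text \<open>When this runs, the marks \<open>''I''\<close> include the three terminals, which
  \<open>finish\<close> adds before counting.\<close>

definition trim :: com where
  "trim = Seq (fill ''src'' (Var ''n'') (Const 0))
     (Seq (cfill ''src'' (Var ''n'') (And (lt0 (Read ''I'' (Var ''i''))) (Less (Const 2) (Read ''cnt'' (Var ''i'')))) 1)
     (Seq (fill ''ok'' (Var ''n'') (Read ''F'' (Var ''i'')))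
     (Seq bfs
          (cfill ''F'' (Var ''n'') (Not (And (lt0 (Read ''vis'' (Var ''i'')))
            (Not (Less (Var ''k'') (Read ''dist'' (Var ''i'')))))) 0))))"

definition leg :: "name \<Rightarrow> com" where
  "leg x = Seq (push ''fl'' ''fn'' (Var x)) (Seq (Assign ''u'' (Var x)) (climb ''p0'' ''d0'' ''fl'' ''fn''))"

text \<open>Each leg is stored from its far end inwards. The one of \<open>v\<close> comes last, so
  that its foot on the path can be cut off by shortening the list; afterwards \<open>q\<close> is
  the last entry.\<close>

definition collect :: com where
  "collect = Seq (Assign ''fn'' (Const 0)) (Seq (leg ''xx'') (Seq (leg ''yy'') (Seq (leg ''v'')
     (Seq (Assign ''fn'' (Minus (Var ''fn'') (Const 1)))
     (Seq (Assign ''q'' (Read ''fl'' (Minus (Var ''fn'') (Const 1))))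
     (Seq (Assign ''x'' first_out) (Assign ''y'' last_out)))))))"

lemma finish_writes [simp]:
  "wregs test = wregs bfs \<union> {''fr'', ''r'', ''bad'', ''b'', ''good''}" "warrs test = warrs bfs \<union> {''src'', ''ok''}"
  "wregs prune = wregs test \<union> {''g''}" "warrs prune = warrs test \<union> {''I''}"
  "wregs degree = {''j''}" "warrs degree = {''cnt''}"
  "wregs count = {''i'', ''j''}" "warrs count = {''cnt''}"
  "wregs trim = wregs bfs" "warrs trim = warrs bfs \<union> {''src'', ''ok'', ''F''}"
  "wregs (leg x) = {''fn'', ''u''}" "warrs (leg x) = {''fl''}"
  "wregs collect = {''fn'', ''u'', ''q'', ''x'', ''y''}" "warrs collect = {''fl''}"
  by (auto simp: test_def prune_def degree_def count_def trim_def leg_def collect_def)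

context problem
begin

lemma inp_array: "inp s \<Longrightarrow> a \<notin> {''off'', ''adj''} \<Longrightarrow> inp (fst s, (snd s)(a := g))"
  by (auto simp: inp_def)

lemma inp_reg: "inp s \<Longrightarrow> x \<notin> {''n'', ''k''} \<Longrightarrow> inp (reg x v s)"
  by (auto simp: inp_def)

lemma inpD: "inp s \<Longrightarrow> fst s ''n'' = n" "inp s \<Longrightarrow> fst s ''k'' = k"
  by (simp_all add: inp_def)

text \<open>One search that expands only \<open>I\<close> decides feasibility: connectedness lets it
  spread over all of \<open>I\<close>, and a terminal can be entered only from a neighbour in
  \<open>I\<close>. For empty \<open>I\<close> there is no source, nothing is reached, and both
  sides are false.\<close>

lemma btree_feasible:
  assumes bt: "btree S I Vs d p" and S: "S = {} \<and> I = {} \<or> S = {r} \<and> r \<in> I"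
    and notin: "x \<notin> I" "y \<notin> I" "q \<notin> I"
  shows "feasible I x y q \<longleftrightarrow> I \<subseteq> Vs \<and> x \<in> Vs \<and> y \<in> Vs \<and> q \<in> Vs"
proof
  assume f: "feasible I x y q"
  then have r: "S = {r}" "r \<in> I"
    using S by (auto simp: feasible_def)
  have "Vs \<inter> I = I"
    by (rule conn_closed) (use f r btreeD(1,5)[OF bt] in \<open>auto simp: feasible_def\<close>)
  then have "I \<subseteq> Vs"
    by blast
  moreover have "w \<in> Vs" if "\<exists>u\<in>I. E w u" for w
    using that \<open>I \<subseteq> Vs\<close> btreeD(5)[OF bt] sym by blast
  ultimately show "I \<subseteq> Vs \<and> x \<in> Vs \<and> y \<in> Vs \<and> q \<in> Vs"
    using f by (simp add: feasible_def)
next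
  assume R: "I \<subseteq> Vs \<and> x \<in> Vs \<and> y \<in> Vs \<and> q \<in> Vs"
  have "S \<noteq> {}"
    using ancestor_root[OF bt, of x] R by auto
  then have r: "S = {r}" "r \<in> I"
    using S by auto
  have nb: "\<exists>u\<in>I. E w u" if "w \<in> Vs" "w \<notin> I" for w
  proof -
    have "d w \<noteq> 0"
      using btreeD(3)[OF bt that(1)] that(2) r by auto
    then show ?thesis
      using btreeD(4)[OF bt that(1)] sym by blast
  qed
  have "conn I"
    unfolding conn_def
  proof (intro allI impI, elim conjE)
    fix X
    assume X: "X \<subseteq> I" "X \<noteq> {}" and cl: "\<forall>u\<in>X. \<forall>w\<in>I. E u w \<longrightarrow> w \<in> X"
    obtain u where u: "u \<in> X" using X by blast
    have uV: "u \<in> Vs" using u X R by blast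
    \<comment> \<open>The predecessors lead from \<open>u\<close> to the source without leaving
      \<open>I\<close>, so the closed set \<open>X\<close> contains the source; from there it fills
      \<open>I\<close> by induction on the label.\<close>
    have "(p ^^ i) u \<in> X" if "i \<le> d u" for i
      using that
    proof (induction i)
      case (Suc i)
      then have "(p ^^ Suc i) u \<in> I" "E ((p ^^ i) u) ((p ^^ Suc i) u)"
        using btree_ancestor(2)[OF bt uV, of i] sym by auto
      then show ?case
        using Suc cl by auto
    qed (use u in simp)
    then have rX: "r \<in> X"
      using ancestor_root[OF bt uV] r by fastforce
    have "w \<in> X" if "w \<in> I" for w
      using that
    proof (induction "d w" arbitrary: w rule: less_induct)
      case less
      have w: "w \<in> Vs" using less.prems R by blast
      show ?case
      proof (cases "d w = 0")
        case True
        then show ?thesis using btreeD(3)[OF bt w] r rX by auto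
      next
        case False
        then have "p w \<in> X" "E (p w) w"
          using btreeD(4)[OF bt w False] less.hyps[of "p w"] by auto
        then show ?thesis using cl less.prems by blast
      qed
    qed
    then show "X = I" using X by blast
  qed
  then show "feasible I x y q"
    using nb R notin by (simp add: feasible_def)
qed

lemma wp_test:
  assumes inp: "inp s" and I: "marks s ''I'' = I"
    and notin: "{fst s ''x'', fst s ''y'', fst s ''q''} \<inter> I = {}" "fst s ''x'' < n" "fst s ''y'' < n" "fst s ''q'' < n"
  shows "wp test (\<lambda>t s'. (0 < fst s' ''good'' \<longleftrightarrow> feasible I (fst s ''x'') (fst s ''y'') (fst s ''q'')) \<and> t \<le> 37 * N) s"
  unfolding test_def wp_Seq
proof (rule wp_search[where m = n and P = "\<lambda>j. j \<in> I"], goal_cases)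
  case (6 t1 s1)
  note h1 = 6
  have i1: "inp s1"
    using inp_same[OF h1(1) inp] by simp
  show ?case
  proof (rule wp_call[OF wp_set_all[OF i1]], goal_cases)
    case (1 t2 s2)
    note h2 = 1
    define s3 where "s3 = (if 0 < fst s2 ''fr'' then (fst s2, (snd s2)(''src'' := (snd s2 ''src'')(fst s2 ''r'' := 1))) else s2)"
    have w3: "wp (Cond (lt0 (Var ''fr'')) (Write ''src'' (Var ''r'') (Const 1)) Skip) Q s2 = Q 2 s3" for Q
      by (simp add: s3_def numeral_2_eq_2)
    have i3: "inp s3"
      using inp_same[OF h2(2) i1] by (auto simp: s3_def inp_def)
    show ?case
      unfolding w3
    proof (rule wp_fill[where m = n and f = "snd s3 ''I''"], goal_cases)
      case (3 t4 s4)
      note h4 = 3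
      have i4: "inp s4"
        using inp_same[OF h4(1) i3] by simp
      have Is: "snd s4 ''I'' = snd s ''I''" "snd s3 ''I'' = snd s ''I''"
        using h1(1) h2(2) h4(1) by (auto simp: same_except_def s3_def)
      have ok4: "marks s4 ''ok'' = I"
        using h4(2) Is I by (auto simp: marks_def)
      define S where "S = marks s4 ''src''"
      have fr: "fst s2 ''fr'' = fst s1 ''fr''" "fst s2 ''r'' = fst s1 ''r''"
        using h2(2) by (auto simp: same_except_def)
      have src4: "snd s4 ''src'' = snd s3 ''src''"
        using h4(1) by (simp add: same_except_def)
      have In: "I \<subseteq> {..<n}"
        using I by (auto simp: marks_def)
      have S: "S = {} \<and> I = {} \<or> S = {fst s1 ''r''} \<and> fst s1 ''r'' \<in> I"
        using h1(2)
      proof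
        assume *: "fst s1 ''fr'' = 0 \<and> (\<forall>j<n. j \<notin> I)"
        then have "S = {}"
          using h2(1) fr src4 by (auto simp: S_def marks_def s3_def)
        then show ?thesis using * In by auto
      next
        assume *: "fst s1 ''fr'' = 1 \<and> fst s1 ''r'' < n \<and> fst s1 ''r'' \<in> I"
        then have "S = {fst s1 ''r''}"
          using h2(1) fr src4 by (auto simp: S_def marks_def s3_def split: if_splits)
        then show ?thesis using * by auto
      qed
      show ?case
      proof (rule wp_call[OF wp_bfs[OF i4 S_def[symmetric] ok4]], goal_cases)
        case (1 t5 s5)
        note h5 = 1
        have i5: "inp s5"
          using inp_same[OF h5(2) i4] by simp
        let ?V = "marks s5 ''vis''"
        have I5: "snd s5 ''I'' = snd s ''I''"
          using h5(2) Is by (simp add: same_except_def)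
        have vis: "0 < snd s5 ''vis'' w \<longleftrightarrow> w \<in> ?V" if "w < n" for w
          using that by (simp add: marks_def)
        have Iw: "0 < snd s ''I'' w \<longleftrightarrow> w \<in> I" if "w < n" for w
          using that I by (auto simp: marks_def)
        have xyq: "fst s5 ''x'' = fst s ''x''" "fst s5 ''y'' = fst s ''y''" "fst s5 ''q'' = fst s ''q''"
          using h1(1) h2(2) h4(1) h5(2) by (auto simp: same_except_def s3_def)
        have feas: "feasible I (fst s ''x'') (fst s ''y'') (fst s ''q'') \<longleftrightarrow>
            I \<subseteq> ?V \<and> fst s ''x'' \<in> ?V \<and> fst s ''y'' \<in> ?V \<and> fst s ''q'' \<in> ?V"
          by (rule btree_feasible[OF conjunct1[OF h5(1)] S]) (use notin in auto)
        show ?case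
        proof (rule wp_search[where m = n and P = "\<lambda>j. j \<in> I \<and> j \<notin> ?V"], goal_cases)
          case (5 j s')
          then show ?case
            using vis[of j] Iw[of j] I5 by (auto simp: same_except_def)
        next
          case (6 t6 s6)
          have "fst s6 ''bad'' < 1 \<longleftrightarrow> I \<subseteq> ?V"
            using 6(2) In by auto
          moreover have "snd s6 ''vis'' = snd s5 ''vis''" "fst s6 ''x'' = fst s ''x''" "fst s6 ''y'' = fst s ''y''"
            "fst s6 ''q'' = fst s ''q''"
            using 6(1) xyq by (auto simp: same_except_def)
          moreover have "t1 + (t2 + (2 + (t4 + (t5 + (t6 + 2))))) \<le> 37 * N"
            using h1(3) h2(1) h4(3) h5(1) 6(3) n_le_N by (elim conjE) linarith
          ultimately show ?case
            using feas vis notin by (simp add: numeral_2_eq_2)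
        qed (use inpD(1)[OF i5] in \<open>auto simp: same_except_def\<close>)
      qed
    qed (use inpD(1)[OF i3] in \<open>auto simp: same_except_def\<close>)
  qed
next
  case (5 j s')
  then show ?case
    using I by (auto simp: same_except_def marks_def)
qed (use inpD(1)[OF inp] in \<open>auto simp: same_except_def\<close>)

lemma wp_prune:
  assumes inp: "inp s" and xyq: "fst s ''x'' = x" "fst s ''y'' = y" "fst s ''q'' = q" "x < n" "y < n" "q < n"
    and notin: "{x, y, q} \<inter> marks s ''I'' = {}" and feas: "feasible (marks s ''I'') x y q"
  shows "wp prune (\<lambda>t s'. marks s' ''I'' \<subseteq> marks s ''I'' \<and> feasible (marks s' ''I'') x y q \<and>
    (\<forall>w\<in>marks s' ''I''. \<not> feasible (marks s' ''I'' - {w}) x y q) \<and> t \<le> 130 * (n\<^sup>2 * N)) s"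
proof -
  define J where "J s' = marks s' ''I''" for s' :: store
  define Inv where "Inv s' \<longleftrightarrow> inp s' \<and> fst s' ''x'' = x \<and> fst s' ''y'' = y \<and> fst s' ''q'' = q \<and>
    J s' \<subseteq> marks s ''I'' \<and> feasible (J s') x y q \<and> fst s' ''g'' \<le> n \<and>
    (\<forall>w\<in>J s'. w < fst s' ''g'' \<longrightarrow> \<not> feasible (J s' - {w}) x y q)" for s' :: store
  \<comment> \<open>A deletion resets \<open>g\<close>, which adds at most \<open>n\<close> to the
    second summand, but it lowers the first by \<open>n + 1\<close>. One test with its bookkeeping
    fits into \<open>43 * N\<close>.\<close>
  define Phi where "Phi s' = (card (J s') * Suc n + (n - fst s' ''g'')) * (43 * N)" for s' :: store
  have finJ: "finite (J s')" and cardJ: "card (J s') \<le> n" for s'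
    using card_mono[of "{..<n}" "J s'"] by (auto simp: J_def marks_def intro: finite_subset[of _ "{..<n}"])
  let ?body = "Cond (lt0 (Read ''I'' (Var ''g'')))
         (Seq (Write ''I'' (Var ''g'') (Const 0))
         (Seq test
              (Cond (lt0 (Var ''good'')) (Assign ''g'' (Const 0))
                (Seq (Write ''I'' (Var ''g'') (Const 1)) (Assign ''g'' (Succ (Var ''g'')))))))
         (Assign ''g'' (Succ (Var ''g'')))"
  have step: "wp ?body (\<lambda>t s''. Inv s'' \<and> Suc t + Phi s'' \<le> Phi s') s'"
    if inv: "Inv s'" and lt: "fst s' ''g'' < n" for s'
  proof -
    define g where "g = fst s' ''g''"
    have gn: "g < n" using lt by (simp add: g_def)
    have i': "inp s'" using inv by (simp add: Inv_def)
    have Suc_g: "n - g = Suc (n - Suc g)"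
      using gn by simp
    have incr: "Suc t + Phi s'' \<le> Phi s'" if "J s'' = J s'" "fst s'' ''g'' = Suc g" "t \<le> 42 * N" for t s''
    proof -
      have "card (J s') * Suc n + (n - g) = Suc (card (J s') * Suc n + (n - Suc g))"
        using Suc_g by simp
      then have "Phi s' = 43 * N + Phi s''"
        using that(1,2) by (simp add: Phi_def flip: g_def)
      then show ?thesis
        using that(3) n_le_N by simp
    qed
    show ?thesis
    proof (cases "g \<in> J s'")
      case False
      have "J (reg ''g'' (Suc g) s') = J s'"
        by (simp add: J_def marks_def)
      moreover have "Inv (reg ''g'' (Suc g) s')"
        using inv gn False unfolding Inv_def calculation by (auto simp: inp_def less_Suc_eq simp flip: g_def)
      moreover have "\<not> 0 < snd s' ''I'' g"
        using False gn by (simp add: J_def marks_def)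
      ultimately show ?thesis
        using incr[of "reg ''g'' (Suc g) s'" 2] n_le_N by (simp flip: g_def)
    next
      case True
      have pos: "0 < snd s' ''I'' g"
        using True by (simp add: J_def marks_def)
      define s1 where "s1 = (fst s', (snd s')(''I'' := (snd s' ''I'')(g := 0)))"
      have J1: "J s1 = J s' - {g}"
        by (auto simp: J_def marks_def s1_def)
      have r1: "fst s1 = fst s'"
        by (simp add: s1_def)
      have i1: "inp s1"
        unfolding s1_def by (rule inp_array[OF i']) simp
      have T: "wp test (\<lambda>t s'. (0 < fst s' ''good'' \<longleftrightarrow> feasible (J s1) (fst s1 ''x'') (fst s1 ''y'') (fst s1 ''q'')) \<and> t \<le> 37 * N) s1"
        by (rule wp_test[OF i1])
          (use inv notin xyq(4-6) J1 r1 in \<open>auto simp: J_def Inv_def\<close>)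
      have "wp test (\<lambda>t. wp (Cond (lt0 (Var ''good'')) (Assign ''g'' (Const 0))
                (Seq (Write ''I'' (Var ''g'') (Const 1)) (Assign ''g'' (Succ (Var ''g'')))))
            (\<lambda>t' s''. Inv s'' \<and> Suc (Suc (1 + (t + t'))) + Phi s'' \<le> Phi s')) s1"
      proof (rule wp_call[OF T], goal_cases)
        case (1 t s2)
        have same: "same_except (wregs test) (warrs test) s1 s2" by (rule 1(2))
        have i2: "inp s2"
          using inp_same[OF same i1] by simp
        have regs: "fst s2 ''x'' = x" "fst s2 ''y'' = y" "fst s2 ''q'' = q" "fst s2 ''g'' = g"
          using inv same r1 by (auto simp: same_except_def Inv_def g_def)
        have I2: "snd s2 ''I'' = (snd s' ''I'')(g := 0)"
          using same by (simp add: same_except_def s1_def)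
        have J2: "J s2 = J s' - {g}"
          using I2 by (auto simp: J_def marks_def)
        have good: "0 < fst s2 ''good'' \<longleftrightarrow> feasible (J s' - {g}) x y q"
          using 1(1) J1 r1 inv by (simp add: Inv_def)
        have t: "t \<le> 37 * N"
          using 1(1) by simp
        show ?case
        proof (cases "0 < fst s2 ''good''")
          case True
          define s3 where "s3 = reg ''g'' 0 s2"
          have J3: "J s3 = J s' - {g}"
            using J2 by (simp add: J_def marks_def s3_def)
          have "Inv s3"
            using inv regs i2 good True unfolding Inv_def J3 by (auto simp: s3_def inp_def)
          moreover have "Suc (Suc (1 + (t + 2))) + Phi s3 \<le> Phi s'"
          proof -
            have "card (J s') = Suc (card (J s3))"
              unfolding J3 using card_Suc_Diff1[OF finJ \<open>g \<in> J s'\<close>] by linarith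
            then have "Suc (card (J s3) * Suc n + n) + (n - g) = card (J s') * Suc n + (n - g)"
              by simp
            then have "Suc (card (J s3) * Suc n + n) \<le> card (J s') * Suc n + (n - g)"
              by linarith
            then have "Suc (card (J s3) * Suc n + n) * (43 * N) \<le> Phi s'"
              unfolding Phi_def g_def[symmetric] by (rule mult_le_mono1)
            moreover have "Phi s3 = (card (J s3) * Suc n + n) * (43 * N)"
              by (simp add: Phi_def s3_def)
            ultimately show ?thesis
              using t n_le_N by simp
          qed
          ultimately show ?thesis
            using True by (simp add: s3_def numeral_2_eq_2)
        next
          case False
          define s3 where "s3 = ((fst s2)(''g'' := Suc g), (snd s2)(''I'' := (snd s2 ''I'')(g := 1)))"
          have J3: "J s3 = J s'"
            using I2 \<open>g \<in> J s'\<close> by (auto simp: J_def marks_def s3_def)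
          have "Inv s3"
            using inv regs i2 good False gn unfolding Inv_def J3
            by (auto simp: s3_def inp_def less_Suc_eq simp flip: g_def)
          moreover have "Suc (Suc (1 + (t + 3))) + Phi s3 \<le> Phi s'"
            using incr[OF J3, of "Suc (1 + (t + 3))"] t n_le_N by (simp add: s3_def)
          ultimately show ?thesis
            using False regs by (simp add: s3_def numeral_3_eq_3)
        qed
      qed
      moreover have "bval (lt0 (Read ''I'' (Var ''g''))) s'"
        using pos by (simp flip: g_def)
      moreover have "wp (Write ''I'' (Var ''g'') (Const 0)) Q s' = Q 1 s1" for Q
        by (simp add: s1_def g_def)
      ultimately show ?thesis
        unfolding wp_Cond[of "lt0 (Read ''I'' (Var ''g''))"] wp_Seq[of "Write ''I'' (Var ''g'') (Const 0)"] wp_Seq[of test]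
        by (simp only: if_True)
    qed
  qed
  have "wp (While (Less (Var ''g'') (Var ''n'')) ?body) (\<lambda>t s'. marks s' ''I'' \<subseteq> marks s ''I'' \<and>
      feasible (marks s' ''I'') x y q \<and> (\<forall>w\<in>marks s' ''I''. \<not> feasible (marks s' ''I'' - {w}) x y q) \<and>
      Suc t \<le> 130 * (n\<^sup>2 * N)) (reg ''g'' 0 s)"
  proof (rule wp_While[where I = Inv and \<Phi> = Phi])
    show "Inv (reg ''g'' 0 s)"
      using inp xyq feas by (auto simp: Inv_def J_def marks_def inp_def)
  next
    fix s'
    assume "Inv s'" "bval (Less (Var ''g'') (Var ''n'')) s'"
    then show "wp ?body (\<lambda>t s''. Inv s'' \<and> Suc t + Phi s'' \<le> Phi s') s'"
      using step[of s'] inpD(1)[of s'] by (simp add: Inv_def)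
  next
    fix t s'
    assume inv: "Inv s'" and "\<not> bval (Less (Var ''g'') (Var ''n'')) s'" and t: "t \<le> Suc (Phi (reg ''g'' 0 s))"
    then have "fst s' ''g'' = n"
      using inpD(1)[of s'] by (simp add: Inv_def)
    moreover have "w < n" if "w \<in> J s'" for w
      using that by (simp add: J_def marks_def)
    \<comment> \<open>At most \<open>n * (n + 2)\<close> units of \<open>43 * N\<close> each; with
      \<open>n * (n + 2) \<le> 3 * n\<^sup>2\<close> this makes
      \<open>129 * (n\<^sup>2 * N)\<close>, and the rest is for the initialisation and the last
      test.\<close>
    moreover have "Suc t \<le> 130 * (n\<^sup>2 * N)"
    proof -
      have "card (J (reg ''g'' 0 s)) * Suc n + n \<le> n * Suc n + n"
        using mult_le_mono1[OF cardJ[of "reg ''g'' 0 s"], of "Suc n"] by linarith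
      also have "\<dots> \<le> 3 * n\<^sup>2"
        unfolding power2_eq_square mult_Suc_right using le_square[of n] by linarith
      finally have "Phi (reg ''g'' 0 s) \<le> 3 * n\<^sup>2 * (43 * N)"
        unfolding Phi_def by (simp add: mult_le_mono1)
      moreover have "2 \<le> n\<^sup>2 * N"
        using n_pos n_le_N by (simp add: mult_le_mono[of 1 "n\<^sup>2" 2 N, simplified])
      ultimately show ?thesis
        using t by simp
    qed
    ultimately show "marks s' ''I'' \<subseteq> marks s ''I'' \<and>
      feasible (marks s' ''I'') x y q \<and> (\<forall>w\<in>marks s' ''I''. \<not> feasible (marks s' ''I'' - {w}) x y q) \<and>
      Suc t \<le> 130 * (n\<^sup>2 * N)"
      using inv by (simp add: Inv_def J_def)
  qed
  then show ?thesis
    by (simp add: prune_def)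
qed

text \<open>Each adjacency list is charged \<open>6 * N\<close> instead of its own length; the
  resulting multiple of \<open>n * N\<close> stays below the cost of pruning.\<close>

lemma wp_count:
  assumes inp: "inp s" and J: "marks s ''I'' = J"
  shows "wp count (\<lambda>t s'. (\<forall>u<n. snd s' ''cnt'' u = nbrs J u) \<and> t \<le> 12 * (n * N)) s"
  unfolding count_def wp_Seq
proof (rule wp_call[OF wp_set_all[OF inp]], goal_cases)
  case (1 t1 s1)
  note h1 = 1
  define Inv where "Inv h s' \<longleftrightarrow> same_except {''i'', ''j''} {''cnt''} s s' \<and>
    (\<forall>u<h. snd s' ''cnt'' u = nbrs J u) \<and> (\<forall>u<n. h \<le> u \<longrightarrow> snd s' ''cnt'' u = 0)" for h :: nat and s' :: store
  have inp': "inp s'" if "same_except {''i'', ''j''} {''cnt''} s s'" for s'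
    using inp_same[OF that inp] by simp
  show ?case
  proof (rule wp_For[where m = n and T = "6 * N" and J = Inv])
    show "Inv 0 (reg ''i'' 0 s1)"
      using h1 by (auto simp: Inv_def same_except_def)
  next
    fix j s'
    assume "Inv j s'"
    then show "aval (Var ''n'') s' = n"
      using inp' inpD(1) by (simp add: Inv_def)
  next
    fix u and s' :: store
    assume u: "u < n" and iu: "fst s' ''i'' = u" and inv: "Inv u s'"
    have i': "inp s'"
      using inp' inv by (simp add: Inv_def)
    define cn where "cn l = length (filter (\<lambda>w. w \<in> J) (take l (ls ! u)))" for l
    define K where "K s'' \<longleftrightarrow> same_except {''j''} {''cnt''} s' s'' \<and> off u \<le> fst s'' ''j'' \<and> fst s'' ''j'' \<le> off (Suc u) \<and>
      snd s'' ''cnt'' = (snd s' ''cnt'')(u := cn (fst s'' ''j'' - off u))" for s'' :: store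
    let ?s = "reg ''j'' (off u) s'"
    have "wp (While (Less (Var ''j'') (Read ''off'' (Succ (Var ''i''))))
       (Seq (Cond (lt0 (Read ''I'' (Read ''adj'' (Var ''j''))))
              (Write ''cnt'' (Var ''i'') (Succ (Read ''cnt'' (Var ''i'')))) Skip)
            (Assign ''j'' (Succ (Var ''j'')))))
       (\<lambda>t s''. Suc t \<le> 6 * N \<and> fst s'' ''i'' = u \<and> Inv (Suc u) (reg ''i'' (Suc u) s'')) ?s"
    proof (rule wp_While[where I = K and \<Phi> = "\<lambda>s''. 4 * (off (Suc u) - fst s'' ''j'')"])
      have "snd s' ''cnt'' u = 0"
        using inv u by (simp add: Inv_def)
      then show "K ?s"
        using off_Suc[OF u] by (auto simp: K_def same_except_def cn_def)
    next
      fix s2 :: store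
      assume K: "K s2" and b: "bval (Less (Var ''j'') (Read ''off'' (Succ (Var ''i'')))) s2"
      have same: "same_except {''j''} {''cnt''} s' s2"
        using K by (simp add: K_def)
      have i2: "inp s2"
        using inp_same[OF same i'] by simp
      have iu2: "fst s2 ''i'' = u"
        using same iu by (simp add: same_except_def)
      have lt: "fst s2 ''j'' < off (Suc u)"
        using b off_nth[of "Suc u" s2] i2 u iu2 by simp
      define l where "l = fst s2 ''j'' - off u"
      have l: "l < length (ls ! u)" "fst s2 ''j'' = off u + l"
        using lt K off_Suc[OF u] by (auto simp: l_def K_def)
      define w where "w = ls ! u ! l"
      have aw: "snd s2 ''adj'' (fst s2 ''j'') = w"
        using adj_nth[OF i2 u l(1)] l(2) by (simp add: w_def)
      have "E u w"
        using E_iff_nbr[OF u] l(1) by (simp add: w_def)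
      then have wn: "w < n"
        using E_lt by blast
      have "snd s2 ''I'' = snd s ''I''"
        using same inv by (simp add: same_except_def Inv_def)
      then have Jw: "0 < snd s2 ''I'' w \<longleftrightarrow> w \<in> J"
        using wn J by (auto simp: marks_def)
      have cn: "cn (Suc l) = (if w \<in> J then Suc (cn l) else cn l)"
        using l(1) by (simp add: cn_def take_Suc_conv_app_nth w_def)
      have c2: "snd s2 ''cnt'' = (snd s' ''cnt'')(u := cn l)"
        using K by (simp add: K_def l_def)
      have Sl: "Suc (fst s2 ''j'') - off u = Suc l"
        using l(2) by simp
      let ?s3 = "((fst s2)(''j'' := Suc (fst s2 ''j'')), (snd s2)(''cnt'' := (snd s2 ''cnt'')(u := Suc (cn l))))"
      have "K ?s3" if "w \<in> J"
        using K c2 cn that Sl lt by (auto simp: K_def same_except_def)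
      moreover have "K (reg ''j'' (Suc (fst s2 ''j'')) s2)" if "w \<notin> J"
        using K c2 cn that Sl lt by (auto simp: K_def same_except_def)
      ultimately show "wp (Seq (Cond (lt0 (Read ''I'' (Read ''adj'' (Var ''j''))))
              (Write ''cnt'' (Var ''i'') (Succ (Read ''cnt'' (Var ''i'')))) Skip)
            (Assign ''j'' (Succ (Var ''j''))))
          (\<lambda>t s''. K s'' \<and> Suc t + 4 * (off (Suc u) - fst s'' ''j'') \<le> 4 * (off (Suc u) - fst s2 ''j'')) s2"
        using aw Jw iu2 c2 lt by (cases "w \<in> J") simp_all
    next
      fix t s2
      assume K: "K s2" and b: "\<not> bval (Less (Var ''j'') (Read ''off'' (Succ (Var ''i'')))) s2"
        and t: "t \<le> Suc (4 * (off (Suc u) - fst ?s ''j''))"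
      have same: "same_except {''j''} {''cnt''} s' s2"
        using K by (simp add: K_def)
      have i2: "inp s2"
        using inp_same[OF same i'] by simp
      have iu2: "fst s2 ''i'' = u"
        using same iu by (simp add: same_except_def)
      have "fst s2 ''j'' - off u = length (ls ! u)"
        using b K off_nth[of "Suc u" s2] i2 u iu2 off_Suc[OF u] by (auto simp: K_def)
      moreover have "cn (length (ls ! u)) = nbrs J u"
      proof -
        have "distinct (ls ! u)"
          using adj u by (simp add: adj_lists_def n_def)
        then have "cn (length (ls ! u)) = card (set (filter (\<lambda>w. w \<in> J) (ls ! u)))"
          using distinct_card[of "filter (\<lambda>w. w \<in> J) (ls ! u)"] by (simp add: cn_def)
        also have "set (filter (\<lambda>w. w \<in> J) (ls ! u)) = {w \<in> J. E u w}"
          using E_iff_nbr[OF u] by auto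
        finally show ?thesis by (simp add: nbrs_def)
      qed
      ultimately have "snd s2 ''cnt'' = (snd s' ''cnt'')(u := nbrs J u)"
        using K by (simp add: K_def)
      then have "Inv (Suc u) (reg ''i'' (Suc u) s2)"
        using inv same by (auto simp: Inv_def same_except_def less_Suc_eq)
      moreover have "4 * (off (Suc u) - off u) \<le> 4 * N"
        using off_le[of "Suc u"] by (simp add: N_def)
      ultimately show "Suc t \<le> 6 * N \<and> fst s2 ''i'' = u \<and> Inv (Suc u) (reg ''i'' (Suc u) s2)"
        using t iu2 n_le_N n_pos by simp
    qed
    then show "wp degree (\<lambda>t s''. t \<le> 6 * N \<and> fst s'' ''i'' = u \<and> Inv (Suc u) (reg ''i'' (Suc u) s'')) s'"
      using off_nth[of u s'] i' u iu by (simp add: degree_def)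
  next
    fix t s'
    assume "Inv n s'" and t: "t \<le> n * (6 * N + 2) + 2"
    moreover have "t1 + t \<le> 12 * (n * N)"
    proof -
      have "N \<le> n * N"
        using n_pos by simp
      moreover have "n * (6 * N + 2) = 6 * (n * N) + 2 * n"
        by (simp add: algebra_simps)
      ultimately show ?thesis
        using t h1(1) n_le_N n_pos by linarith
    qed
    ultimately show "(\<forall>u<n. snd s' ''cnt'' u = nbrs J u) \<and> t1 + t \<le> 12 * (n * N)"
      by (simp add: Inv_def)
  qed
qed

lemma wp_trim:
  assumes inp: "inp s" and J: "marks s ''I'' = J" and F: "marks s ''F'' = F"
    and cnt: "\<And>u. u < n \<Longrightarrow> snd s ''cnt'' u = nbrs J u"
  shows "wp trim (\<lambda>t s'. (\<exists>Vs d p. btree {u \<in> J. 2 < nbrs J u} F Vs d p \<and>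
    marks s' ''F'' = {w \<in> F. w \<in> Vs \<and> d w \<le> k}) \<and> t \<le> 35 * N) s"
  unfolding trim_def wp_Seq
proof (rule wp_call[OF wp_set_all[OF inp]], goal_cases)
  case (1 t1 s1)
  note h1 = 1
  have i1: "inp s1"
    using inp_same[OF h1(2) inp] by simp
  show ?case
  proof (rule wp_cfill[where m = n and P = "\<lambda>j. j \<in> J \<and> 2 < nbrs J j"], goal_cases)
    case (2 j s')
    have "snd s' ''I'' = snd s ''I''" "snd s' ''cnt'' = snd s ''cnt''"
      using 2(3) h1(2) by (auto simp: same_except_def)
    then show ?case
      using 2(1,2) J cnt[of j] by (auto simp: marks_def)
  next
    case (3 t2 s2)
    note h2 = 3
    have i2: "inp s2"
      using inp_same[OF h2(1) i1] by simp
    show ?case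
    proof (rule wp_fill[where m = n and f = "snd s ''F''"], goal_cases)
      case (2 j s')
      then show ?case
        using h1(2) h2(1) by (auto simp: same_except_def)
    next
      case (3 t3 s3)
      note h3 = 3
      have i3: "inp s3"
        using inp_same[OF h3(1) i2] by simp
      have ok: "marks s3 ''ok'' = F"
        using h3(2) F by (auto simp: marks_def)
      have "snd s3 ''src'' = snd s2 ''src''"
        using h3(1) by (simp add: same_except_def)
      then have src: "marks s3 ''src'' = {u \<in> J. 2 < nbrs J u}"
        using h2(2) h1(1) J by (auto simp: marks_def)
      show ?case
      proof (rule wp_call[OF wp_bfs[OF i3 src ok]], goal_cases)
        case (1 t4 s4)
        note h4 = 1
        have i4: "inp s4"
          using inp_same[OF h4(2) i3] by simp
        let ?V = "marks s4 ''vis''" and ?d = "snd s4 ''dist''" and ?p = "snd s4 ''par''"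
        have F4: "snd s4 ''F'' = snd s ''F''"
          using h1(2) h2(1) h3(1) h4(2) by (simp add: same_except_def)
        show ?case
        proof (rule wp_cfill[where m = n and P = "\<lambda>j. \<not> (j \<in> ?V \<and> ?d j \<le> k)"], goal_cases)
          case (2 j s')
          have "snd s' ''vis'' = snd s4 ''vis''" "snd s' ''dist'' = ?d" "fst s' ''k'' = k"
            using 2(3) inpD(2)[OF i4] by (auto simp: same_except_def)
          then show ?case
            using 2(1,2) by (simp add: marks_def not_less)
        next
          case (3 t5 s5)
          have "marks s5 ''F'' = {w \<in> F. w \<in> ?V \<and> ?d w \<le> k}"
            using 3(2) F F4 by (auto simp: marks_def split: if_splits)
          moreover have "t1 + (t2 + (t3 + (t4 + t5))) \<le> 35 * N"
            using h1(1) h2(3) h3(3) h4(1) 3(3) n_le_N by (elim conjE) linarith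
          ultimately show ?case
            using h4(1) by (intro conjI exI[of _ ?V] exI[of _ ?d] exI[of _ ?p]; simp)
        qed (use inpD(1)[OF i4] in \<open>auto simp: same_except_def\<close>)
      qed
    qed (use inpD(1)[OF i2] in \<open>auto simp: same_except_def\<close>)
  qed (use inpD(1)[OF i1] in \<open>auto simp: same_except_def\<close>)
qed

lemma wp_leg:
  assumes bt: "btree S {..<n} {..<n} (snd s ''d0'') (snd s ''p0'')" and x: "fst s x = w" "w < n" "x \<noteq> ''fn''"
  shows "wp (leg x) (\<lambda>t s'. alist s' ''fl'' (fst s' ''fn'') =
    alist s ''fl'' (fst s ''fn'') @ rev (geodesic (snd s ''d0'') (snd s ''p0'') w) \<and> t \<le> 7 * N) s"
proof -
  let ?s = "((fst s)(''fn'' := Suc (fst s ''fn''), ''u'' := w), (snd s)(''fl'' := (snd s ''fl'')(fst s ''fn'' := w)))"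
  have "wp (climb ''p0'' ''d0'' ''fl'' ''fn'') (\<lambda>t s'. alist s' ''fl'' (fst s' ''fn'') =
      alist ?s ''fl'' (fst ?s ''fn'') @ ancestors (snd ?s ''p0'') (snd ?s ''d0'' w) w \<and> t \<le> 4 * N) ?s"
    by (rule wp_climb[where S = S and K = "{..<n}" and Vs = "{..<n}"]) (use bt x in auto)
  moreover have "alist ?s ''fl'' (fst ?s ''fn'') = alist s ''fl'' (fst s ''fn'') @ [w]"
    by (simp add: alist_def)
  ultimately have "wp (climb ''p0'' ''d0'' ''fl'' ''fn'') (\<lambda>t s'. alist s' ''fl'' (fst s' ''fn'') =
      alist s ''fl'' (fst s ''fn'') @ rev (geodesic (snd s ''d0'') (snd s ''p0'') w) \<and> Suc (Suc (Suc t)) \<le> 7 * N) ?s"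
    by (elim wp_mono) (use n_le_N in \<open>simp add: geodesic_def\<close>)
  then show ?thesis
    using x by (simp add: leg_def push_def)
qed

lemma wp_collect:
  assumes P: "on_path P s" and bt: "btree (set P) {..<n} {..<n} (snd s ''d0'') (snd s ''p0'')"
    and xx: "fst s ''xx'' = xx" "xx < n" and yy: "fst s ''yy'' = yy" "yy < n" and v: "fst s ''v'' = v" "v < n" "snd s ''d0'' v = k"
  shows "wp collect (\<lambda>t s'. alist s' ''fl'' (fst s' ''fn'') = rev (geodesic (snd s ''d0'') (snd s ''p0'') xx) @
      rev (geodesic (snd s ''d0'') (snd s ''p0'') yy) @ rev (tl (geodesic (snd s ''d0'') (snd s ''p0'') v)) \<and>
    fst s' ''q'' = geodesic (snd s ''d0'') (snd s ''p0'') v ! 1 \<and> fst s' ''x'' = hd P \<and> fst s' ''y'' = last P \<and>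
    fst s' ''fn'' \<le> 3 * n \<and> t \<le> 30 * N) s"
proof -
  let ?d = "snd s ''d0''" and ?p = "snd s ''p0''"
  let ?gx = "geodesic ?d ?p xx" and ?gy = "geodesic ?d ?p yy" and ?gv = "geodesic ?d ?p v"
  let ?s0 = "reg ''fn'' 0 s"
  have dlt: "?d w < n" if "w < n" for w
    using ancestors_walk(5)[OF bt, of w] that by simp
  have len: "length ?gx = Suc (?d xx)" "length ?gy = Suc (?d yy)" "length ?gv = Suc k"
    using geodesic(1)[OF bt xx(2)] geodesic(1)[OF bt yy(2)] geodesic(1)[OF bt v(2)] v(3) by simp_all
  have "wp (leg ''xx'') (\<lambda>t1. wp (leg ''yy'') (\<lambda>t2. wp (leg ''v'')
     (\<lambda>t3 s'. alist s' ''fl'' (fst s' ''fn'') = rev ?gx @ rev ?gy @ rev ?gv \<and> same_except {''fn'', ''u''} {''fl''} ?s0 s' \<and>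
       t1 + (t2 + t3) \<le> 21 * N))) ?s0"
  proof (rule wp_call[OF wp_leg[of "set P" _ _ xx]], goal_cases)
    case (5 t1 s1)
    note h1 = 5
    show ?case
    proof (rule wp_call[OF wp_leg[of "set P" _ _ yy]], goal_cases)
      case (5 t2 s2)
      note h2 = 5
      show ?case
      proof (rule wp_call[OF wp_leg[of "set P" _ _ v]], goal_cases)
        case (5 t3 s3)
        have "snd s1 ''d0'' = ?d" "snd s1 ''p0'' = ?p" "snd s2 ''d0'' = ?d" "snd s2 ''p0'' = ?p"
          using h1(2) h2(2) by (auto simp: same_except_def)
        then have "alist s3 ''fl'' (fst s3 ''fn'') = rev ?gx @ rev ?gy @ rev ?gv"
          using h1(1) h2(1) 5(1) by (simp add: alist_def)
        moreover have "same_except {''fn'', ''u''} {''fl''} ?s0 s3"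
          using h1(2) h2(2) 5(2) by (simp add: same_except_def)
        moreover have "t1 + (t2 + t3) \<le> 21 * N"
          using h1(1) h2(1) 5(1) by (elim conjE) linarith
        ultimately show ?case by blast
      qed (use bt v h1(2) h2(2) in \<open>auto simp: same_except_def\<close>)
    qed (use bt yy h1(2) in \<open>auto simp: same_except_def\<close>)
  qed (use bt xx in \<open>auto simp: same_except_def\<close>)
  then have "wp (leg ''xx'') (\<lambda>t1. wp (leg ''yy'') (\<lambda>t2. wp (leg ''v'') (\<lambda>t3.
     wp (Seq (Assign ''fn'' (Minus (Var ''fn'') (Const 1)))
     (Seq (Assign ''q'' (Read ''fl'' (Minus (Var ''fn'') (Const 1))))
     (Seq (Assign ''x'' first_out) (Assign ''y'' last_out)))) (\<lambda>t4 s'. alist s' ''fl'' (fst s' ''fn'') = rev ?gx @ rev ?gy @ rev (tl ?gv) \<and>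
    fst s' ''q'' = ?gv ! 1 \<and> fst s' ''x'' = hd P \<and> fst s' ''y'' = last P \<and>
    fst s' ''fn'' \<le> 3 * n \<and> 1 + (t1 + (t2 + (t3 + t4))) \<le> 30 * N)))) ?s0"
  proof (elim wp_mono, goal_cases)
    case (1 t1 s1 t2 s2 t3 s')
    have same: "same_except {''fn'', ''u''} {''fl''} ?s0 s'"
      using 1 by simp
    have P': "on_path P s'"
      by (rule on_path_same[OF same on_path_reg[OF P]]) auto
    define L where "L = rev ?gx @ rev ?gy @ rev (tl ?gv)"
    have gv: "?gv = ?gv ! 0 # tl ?gv" "tl ?gv \<noteq> []"
      using len(3) k_pos by (cases ?gv; auto)+
    \<comment> \<open>The list still ends with the foot of the leg of \<open>v\<close>; lowering
      \<open>''fn''\<close> by one removes it.\<close>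
    have AL: "alist s' ''fl'' (fst s' ''fn'') = L @ [?gv ! 0]"
      using 1 gv(1) unfolding L_def by (metis append_assoc rev.simps(2))
    then have fn: "fst s' ''fn'' = Suc (length L)"
      using length_alist by (metis length_append_singleton)
    have nthL: "snd s' ''fl'' i = L ! i" if "i < length L" for i
      using arg_cong[OF AL, of "\<lambda>xs. xs ! i"] that fn by (simp add: nth_append)
    have "alist s'' ''fl'' (length L) = L" if "snd s'' = snd s'" for s'' :: store
      using that nthL by (intro nth_equalityI) auto
    moreover have "snd s' ''fl'' (length L - 1) = ?gv ! 1"
    proof -
      have "L \<noteq> []" "last L = hd (tl ?gv)"
        using gv(2) by (auto simp: L_def last_rev)
      moreover have "hd (tl ?gv) = ?gv ! 1"
        using gv by (metis One_nat_def hd_conv_nth nth_Cons_Suc)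
      ultimately show ?thesis
        using nthL[of "length L - 1"] by (simp add: last_conv_nth)
    qed
    moreover have "length L \<le> 3 * n"
      using len dlt[OF xx(2)] dlt[OF yy(2)] dlt[OF v(2)] v(3) by (simp add: L_def)
    moreover have "snd s' ''out'' 0 = hd P" "snd s' ''out'' (fst s' ''len'' - 1) = last P"
      using on_pathD(14,15)[OF P'] by (simp_all add: first_out_def last_out_def)
    moreover have "t1 + (t2 + t3) \<le> 21 * N"
      using 1 by simp
    ultimately show ?case
      using fn n_le_N by (simp add: first_out_def last_out_def L_def)
  qed
  then show ?thesis
    by (simp add: collect_def)
qed

end

section \<open>The main loop, its potential and the running time\<close>

section \<open>The algorithm\<close>

text \<open>\<open>''F''\<close> starts with the legs and the terminals and receives the interior
  only after pruning. \<open>''I''\<close> first holds the interior of the path and later the pruned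
  set with the terminals. The path in \<open>''out''\<close> survives until the answer replaces
  it.\<close>

definition finish :: com where
  "finish = Seq collect
     (Seq (fill ''F'' (Var ''n'') (Const 0))
     (Seq (scatter ''F'' (Var ''fn'') (Read ''fl'' (Var ''i'')) 1)
     (Seq (fill ''I'' (Var ''n'') (Const 0))
     (Seq (scatter ''I'' (Minus (Var ''len'') (Const 2)) (Read ''out'' (Succ (Var ''i''))) 1)
     (Seq prune
     (Seq (cfill ''F'' (Var ''n'') (lt0 (Read ''I'' (Var ''i''))) 1)
     (Seq (Write ''I'' (Var ''x'') (Const 1))
     (Seq (Write ''I'' (Var ''y'') (Const 1))
     (Seq (Write ''I'' (Var ''q'') (Const 1))
     (Seq count
     (Seq (Cond (And (Less (Read ''cnt'' (Var ''x'')) (Const 2))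
            (And (Less (Read ''cnt'' (Var ''y'')) (Const 2)) (Less (Read ''cnt'' (Var ''q'')) (Const 2)))) trim Skip)
     (Seq (Assign ''len'' (Const 0))
     (Seq (filtered ''out'' ''len'' (Var ''n'') (lt0 (Read ''F'' (Var ''i''))))
     (Seq (Assign ''tag'' (Const 1)) (Assign ''done'' (Const 1))))))))))))))))"

text \<open>If \<open>v\<close> reaches the first vertex, a rotation with \<open>a = 0\<close> and
  the list \<open>[last P]\<close> in place of a detour reverses the path; then the reached vertex
  is the last one and \<open>extend\<close> applies.\<close>

definition grow :: com where
  "grow = Cond (lt0 (Read ''vis'' last_out)) extend
     (Cond (lt0 (Read ''vis'' first_out))
       (Seq (Assign ''a'' (Const 0)) (Seq (Assign ''ml'' (Const 1)) (Seq (Write ''mid'' (Const 0) last_out)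
         (Seq rotate extend))))
       (Cond (lt0 (Var ''cyc''))
         (Seq (search ''fa'' ''a'' (Var ''len'') (lt0 (Read ''vis'' (Read ''out'' (Var ''i''))))) (Seq rotate extend))
         finish))"

definition drop_last :: com where
  "drop_last = Assign ''len'' (Minus (Var ''len'') (Const 1))"

definition drop_first :: com where
  "drop_first = Seq (fill ''out'' (Minus (Var ''len'') (Const 1)) (Read ''out'' (Succ (Var ''i'')))) drop_last"

text \<open>\<open>cover\<close> leaves the whole path marked in \<open>''src''\<close>, so the
  sources of each probe arise by clearing a single entry.\<close>

definition round :: com where
  "round = Seq cover
     (Cond (Less (Var ''fv'') (Const 1)) (Assign ''done'' (Const 1))
     (Seq (Write ''src'' last_out (Const 0))
     (Seq (probe ''fy'' ''yy'')
     (Cond (Less (Var ''fy'') (Const 1)) drop_last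
     (Seq (Write ''src'' last_out (Const 1))
     (Seq (Write ''src'' first_out (Const 0))
     (Seq (probe ''fx'' ''xx'')
     (Cond (Less (Var ''fx'') (Const 1)) drop_first (Seq trees grow)))))))))"

definition algorithm :: com where
  "algorithm = Seq (Write ''out'' (Const 0) (Const 0)) (Seq (Assign ''len'' (Const 1))
     (While (Less (Var ''done'') (Const 1)) round))"

lemma main_writes [simp]:
  "wregs drop_last = {''len''}" "warrs drop_last = {}"
  "wregs drop_first = {''i'', ''len''}" "warrs drop_first = {''out''}"
  by (auto simp: drop_last_def drop_first_def)

context problem
begin

text \<open>The conclusion is symmetric in the terminals and hides which of them ends the branch;
  the program cannot tell and need not ask.\<close>

lemma tripod_outcome:
  assumes feas: "feasible I x y q" and del: "\<And>w. w \<in> I \<Longrightarrow> \<not> feasible (I - {w}) x y q"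
    and fin: "finite I" and notin: "{x, y, q} \<inter> I = {}" and dist: "x \<noteq> y" "x \<noteq> q" "y \<noteq> q"
    and indep: "\<not> E x y" "\<not> E x q" "\<not> E y q"
    and J: "J = I \<union> {x, y, q}" and legs: "legs J x y q ra rb rc"
    and F: "F = J \<union> set ra \<union> set rb \<union> set rc" "F \<subseteq> {..<n}"
  shows "(\<exists>t\<in>{x, y, q}. 1 < nbrs J t) \<and> obstruction F \<or>
    (\<forall>t\<in>{x, y, q}. \<not> 1 < nbrs J t) \<and>
    (\<forall>Vs d p. btree {u \<in> J. 2 < nbrs J u} F Vs d p \<longrightarrow> obstruction {w \<in> F. w \<in> Vs \<and> d w \<le> k})"
proof -
  have "tripod_on I x y q \<or> tripod_on I q y x \<or> tripod_on I q x y"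
    using feasible_minimal[OF fin feas del] by (intro minimal_tripod[OF feas _ notin dist indep]) blast
  then show ?thesis
  proof (elim disjE)
    assume "tripod_on I x y q"
    from tripod_output[OF this J legs F] show ?thesis .
  next
    assume T: "tripod_on I q y x"
    have "J = I \<union> {q, y, x}" "F = J \<union> set rc \<union> set rb \<union> set ra"
      using J F(1) by auto
    from tripod_output[OF T this(1) legs_permute(1)[OF legs] this(2) F(2)] show ?thesis
      by (simp add: disj_commute conj_commute disj_left_commute conj_left_commute)
  next
    assume T: "tripod_on I q x y"
    have "J = I \<union> {q, x, y}" "F = J \<union> set rc \<union> set ra \<union> set rb"
      using J F(1) by auto
    from tripod_output[OF T this(1) legs_permute(2)[OF legs] this(2) F(2)] show ?thesis
      by (simp add: disj_commute conj_commute disj_left_commute conj_left_commute)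
  qed
qed

lemma interior_image:
  assumes "distinct P" "hd P \<noteq> last P" "P \<noteq> []"
  shows "(\<lambda>j. P ! Suc j) ` {..<length P - 2} = set P - {hd P, last P}"
proof -
  define C where "C = butlast (tl P)"
  have P: "P = hd P # C @ [last P]"
    using assms(2,3) unfolding C_def by (cases P) (auto split: if_splits)
  have "P ! Suc j = C ! j" if "j < length C" for j
    using that by (subst P) (simp add: nth_append)
  moreover have "length P - 2 = length C"
    by (subst P) simp
  ultimately have "(\<lambda>j. P ! Suc j) ` {..<length P - 2} = (!) C ` {..<length C}"
    by (intro image_cong) auto
  also have "\<dots> = set C"
    by (metis atLeast0LessThan list.set_map map_nth set_upt)
  also have "\<dots> = set P - {hd P, last P}"
  proof -
    have "distinct (hd P # C @ [last P])"
      using assms(1) P by simp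
    moreover have "set P = set (hd P # C @ [last P])"
      using P by simp
    ultimately show ?thesis by auto
  qed
  finally show ?thesis .
qed

lemma wp_finish:
  assumes P: "on_path P s" and bt0: "btree (set P) {..<n} {..<n} (snd s ''d0'') (snd s ''p0'')"
    and v: "fst s ''v'' = v" "v < n" "snd s ''d0'' v = k"
    and xx: "fst s ''xx'' = xx" "xx < n" "snd s ''d0'' xx < k" "xx \<notin> Nb (set P - {hd P}) (k - 1)"
    and yy: "fst s ''yy'' = yy" "yy < n" "snd s ''d0'' yy < k" "yy \<notin> Nb (set P - {last P}) (k - 1)"
    and bt1: "btree {v} ({..<n} - set P) Vs1 d1 p1"
    and bt2: "btree {last P} (insert (last P) ({..<n} - set P)) Vs2 d2 p2"
    and ends: "hd P \<notin> Vs1" "last P \<notin> Vs1" "hd P \<notin> Vs2"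
  shows "wp finish (\<lambda>t s'. is_solution G k s' \<and> fst s' ''done'' = 1 \<and> t \<le> 400 * (n\<^sup>2 * N)) s"
proof -
  let ?d = "snd s ''d0''" and ?p = "snd s ''p0''"
  let ?gx = "geodesic ?d ?p xx" and ?gy = "geodesic ?d ?p yy" and ?gv = "geodesic ?d ?p v"
  define x y q where "x = hd P" and "y = last P" and "q = ?gv ! 1"
  note S = stuck_path[OF on_pathD(13)[OF P] bt0 bt1 bt2 v(2,3) ends xx(2-4) yy(2-4) x_def y_def q_def]
  have xyn: "x < n" "y < n" "x \<in> set P" "y \<in> set P"
    using on_pathD(16,17)[OF P] on_pathD(12)[OF P] by (auto simp: x_def y_def)
  note gx = geodesic[OF bt0 xx(2)] and gy = geodesic[OF bt0 yy(2)] and gv = geodesic[OF bt0 v(2)]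
  define F0 where "F0 = set ?gx \<union> set ?gy \<union> set (tl ?gv)"
  have F0n: "F0 \<subseteq> {..<n}"
    using gx(5) gy(5) gv(5) list.set_sel(2)[of ?gv] gv(1) unfolding F0_def by (cases ?gv) auto
  have F0: "F0 = {x, y, q} \<union> set (tl ?gx) \<union> set (tl ?gy) \<union> set (drop 2 ?gv)"
  proof -
    have px: "?gx ! 0 = x" "?gy ! 0 = y"
    proof -
      \<comment> \<open>\<open>private_leg\<close> wants a neighbour of the end on the path; the
        feasibility of the interior supplies one.\<close>
      obtain a where a: "a \<in> set P" "a \<noteq> x" "E a x"
        using S(9) conn_all
        by (metis (no_types, lifting) DiffE feasible_def insertCI sym)
      show "?gx ! 0 = x"
        using private_leg(2)[OF bt0 xx(2) xyn(3) a xx(3)] xx(4) by (simp add: x_def)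
      obtain b where b: "b \<in> set P" "b \<noteq> y" "E b y"
        using S(9) by (metis (no_types, lifting) DiffE feasible_def insertCI sym)
      show "?gy ! 0 = y"
        using private_leg(2)[OF bt0 yy(2) xyn(4) b yy(3)] yy(4) by (simp add: y_def)
    qed
    have "set ?gx = insert x (set (tl ?gx))" "set ?gy = insert y (set (tl ?gy))"
      using px gx(1) gy(1) by (cases ?gx; cases ?gy; auto)+
    moreover have "tl ?gv = q # drop 2 ?gv"
      using gv(1) v(3) k_pos Cons_nth_drop_Suc[of 1 ?gv] by (simp add: q_def numeral_2_eq_2 drop_Suc)
    ultimately show ?thesis
      by (auto simp: F0_def)
  qed
  show ?thesis
    unfolding finish_def wp_Seq
  proof (rule wp_call[OF wp_collect[OF P bt0 xx(1,2) yy(1,2) v]], goal_cases)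
    case (1 t1 s1)
    note h1 = 1
    have P1: "on_path P s1"
      by (rule on_path_same[OF h1(2) P]) auto
    show ?case
    proof (rule wp_call[OF wp_set_all[OF on_pathD(1)[OF P1]]], goal_cases)
      case (1 t2 s2)
      note h2 = 1
      have P2: "on_path P s2"
        by (rule on_path_same[OF h2(2) P1]) auto
      have fl2: "snd s2 ''fl'' = snd s1 ''fl''" "fst s2 ''fn'' = fst s1 ''fn''"
        using h2(2) by (auto simp: same_except_def)
      show ?case
      proof (rule wp_scatter[where m = "fst s1 ''fn''" and f = "snd s1 ''fl''"], goal_cases)
        case (3 t3 s3)
        note h3 = 3
        have P3: "on_path P s3"
          by (rule on_path_same[OF h3(1) P2]) auto
        have "snd s1 ''fl'' ` {..<fst s1 ''fn''} = F0"
          unfolding set_alist[symmetric] using h1(1) by (auto simp: F0_def)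
        then have F3: "marks s3 ''F'' = F0"
          using h3(2) h2(1) F0n by (auto simp: marks_def split: if_splits)
        show ?case
        proof (rule wp_call[OF wp_set_all[OF on_pathD(1)[OF P3]]], goal_cases)
          case (1 t4 s4)
          note h4 = 1
          have P4: "on_path P s4"
            by (rule on_path_same[OF h4(2) P3]) auto
          show ?case
          proof (rule wp_scatter[where m = "length P - 2" and f = "\<lambda>j. P ! Suc j"], goal_cases)
            case (2 j s')
            have "snd s' ''out'' = snd s4 ''out''"
              using 2(3) by (auto simp: same_except_def)
            then show ?case
              using 2(1,2) on_pathD(7)[OF P4, of "Suc j"] by simp
          next
            case (3 t5 s5)
            note h5 = 3
            have i5: "inp s5"
              using inp_same[OF h5(1) on_pathD(1)[OF P4]] by simp
            have I5: "marks s5 ''I'' = set P - {x, y}"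
              using h5(2) h4(1) interior_image[OF on_pathD(10)[OF P] _ on_pathD(12)[OF P]] S(1) on_pathD(11)[OF P]
              by (auto simp: marks_def x_def y_def split: if_splits)
            have xyq5: "fst s5 ''x'' = x" "fst s5 ''y'' = y" "fst s5 ''q'' = q"
              using h1(1) h2(2) h3(1) h4(2) h5(1) by (simp_all add: same_except_def x_def y_def q_def)
            have F5: "snd s5 ''F'' = snd s3 ''F''"
              using h4(2) h5(1) by (simp add: same_except_def)
            have notin5: "{x, y, q} \<inter> marks s5 ''I'' = {}"
              using I5 S(7) by auto
            have feas5: "feasible (marks s5 ''I'') x y q"
              unfolding I5 by (rule S(9))
            show ?case
            proof (rule wp_call[OF wp_prune[OF i5 xyq5 xyn(1,2) S(8) notin5 feas5]], goal_cases)
              case (1 t6 s6)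
              note h6 = 1
              define I where "I = marks s6 ''I''"
              have IP: "I \<subseteq> set P - {x, y}"
                using h6(1) I5 by (simp add: I_def)
              have i6: "inp s6"
                using inp_same[OF h6(2) i5] by simp
              have s6: "snd s6 ''F'' = snd s3 ''F''" "fst s6 ''x'' = x" "fst s6 ''y'' = y" "fst s6 ''q'' = q"
                using h6(2) F5 xyq5 by (auto simp: same_except_def)
              show ?case
              proof (rule wp_cfill[where m = n and P = "\<lambda>j. j \<in> I"], goal_cases)
                case (2 j s')
                have "snd s' ''I'' = snd s6 ''I''"
                  using 2(3) by (auto simp: same_except_def)
                then show ?case
                  using 2(1,2) by (simp add: I_def marks_def)
              next
                case (3 t7 s7)
                note h7 = 3
                have i7: "inp s7"
                  using inp_same[OF h7(1) i6] by simp
                define F where "F = F0 \<union> I"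
                have F7: "marks s7 ''F'' = F"
                  using h7(2) s6(1) F3 IP on_pathD(11)[OF P] by (auto simp: marks_def F_def)
                have s7: "snd s7 ''I'' = snd s6 ''I''" "fst s7 ''x'' = x" "fst s7 ''y'' = y" "fst s7 ''q'' = q"
                  using h7(1) s6 by (auto simp: same_except_def)
                define s8 where "s8 = (fst s7, (snd s7)(''I'' := (snd s7 ''I'')(x := 1, y := 1, q := 1)))"
                have w8: "wp (Write ''I'' (Var ''x'') (Const 1)) (\<lambda>a. wp (Write ''I'' (Var ''y'') (Const 1))
                    (\<lambda>b. wp (Write ''I'' (Var ''q'') (Const 1)) (\<lambda>c. Q a b c))) s7 = Q 1 1 1 s8" for Q
                  using s7 by (simp add: s8_def)
                define J where "J = I \<union> {x, y, q}"
                have i8: "inp s8"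
                  unfolding s8_def by (rule inp_array[OF i7]) simp
                have J8: "marks s8 ''I'' = J"
                  using s7(1) xyn(1,2) S(8) by (auto simp: marks_def s8_def J_def I_def)
                have legs: "legs J x y q (tl ?gx) (tl ?gy) (drop 2 ?gv)"
                  by (rule S(10)) (use IP xyn in \<open>auto simp: J_def\<close>)
                have FJ: "F = J \<union> set (tl ?gx) \<union> set (tl ?gy) \<union> set (drop 2 ?gv)"
                  unfolding F_def F0 J_def by auto
                have Fn: "F \<subseteq> {..<n}"
                  using F0n IP on_pathD(11)[OF P] by (auto simp: F_def)
                have outcome: "(\<exists>t\<in>{x, y, q}. 1 < nbrs J t) \<and> obstruction F \<or>
                    (\<forall>t\<in>{x, y, q}. \<not> 1 < nbrs J t) \<and>
                    (\<forall>Vs d p. btree {u \<in> J. 2 < nbrs J u} F Vs d p \<longrightarrow> obstruction {w \<in> F. w \<in> Vs \<and> d w \<le> k})"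
                proof (rule tripod_outcome[OF _ _ _ _ S(1-6) J_def legs FJ Fn])
                  show "feasible I x y q" "\<And>w. w \<in> I \<Longrightarrow> \<not> feasible (I - {w}) x y q"
                    using h6(1) by (simp_all add: I_def)
                  show "finite I" "{x, y, q} \<inter> I = {}"
                    using IP S(7) by (auto intro: finite_subset)
                qed
                show ?case
                  unfolding w8
                proof (rule wp_call[OF wp_count[OF i8 J8]], goal_cases)
                  case (1 t9 s9)
                  note h9 = 1
                  have i9: "inp s9"
                    using inp_same[OF h9(2) i8] by simp
                  have s9: "marks s9 ''I'' = J" "marks s9 ''F'' = F" "fst s9 ''x'' = x" "fst s9 ''y'' = y" "fst s9 ''q'' = q"
                    using marks_same[OF h9(2)] J8 F7 h9(2) s7 by (auto simp: same_except_def s8_def marks_def)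
                  have cnt: "snd s9 ''cnt'' u = nbrs J u" if "u < n" for u
                    using h9(1) that by simp
                  have T: "wp (Cond (And (Less (Read ''cnt'' (Var ''x'')) (Const 2))
                        (And (Less (Read ''cnt'' (Var ''y'')) (Const 2)) (Less (Read ''cnt'' (Var ''q'')) (Const 2)))) trim Skip)
                      (\<lambda>t s'. obstruction (marks s' ''F'') \<and> t \<le> 36 * N) s9"
                  proof (cases "\<exists>t\<in>{x, y, q}. 1 < nbrs J t")
                    case True
                    then have "obstruction F"
                      using outcome by blast
                    moreover have "\<not> bval (And (Less (Read ''cnt'' (Var ''x'')) (Const 2))
                        (And (Less (Read ''cnt'' (Var ''y'')) (Const 2)) (Less (Read ''cnt'' (Var ''q'')) (Const 2)))) s9"
                      using True s9(3-5) cnt[OF xyn(1)] cnt[OF xyn(2)] cnt[OF S(8)] by auto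
                    moreover have "Suc 1 \<le> 36 * N"
                      using n_le_N by simp
                    ultimately show ?thesis
                      unfolding wp_Cond wp_Skip using s9(2) by (simp only: if_False simp_thms)
                  next
                    case False
                    then have ob: "\<forall>Vs d p. btree {u \<in> J. 2 < nbrs J u} F Vs d p \<longrightarrow> obstruction {w \<in> F. w \<in> Vs \<and> d w \<le> k}"
                      using outcome by blast
                    have "wp trim (\<lambda>t s'. obstruction (marks s' ''F'') \<and> Suc t \<le> 36 * N) s9"
                    proof (rule wp_mono[OF wp_trim[OF i9 s9(1,2) cnt]], goal_cases)
                      case (2 t s')
                      then obtain Vs d p where T: "btree {u \<in> J. 2 < nbrs J u} F Vs d p"
                        "marks s' ''F'' = {w \<in> F. w \<in> Vs \<and> d w \<le> k}"
                        by blast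
                      have "obstruction (marks s' ''F'')"
                        unfolding T(2) using ob T(1) by blast
                      moreover have "Suc t \<le> 36 * N"
                        using 2 n_le_N by (elim conjE) linarith
                      ultimately show ?case by blast
                    qed
                    moreover have "bval (And (Less (Read ''cnt'' (Var ''x'')) (Const 2))
                        (And (Less (Read ''cnt'' (Var ''y'')) (Const 2)) (Less (Read ''cnt'' (Var ''q'')) (Const 2)))) s9"
                      using False s9(3-5) cnt[OF xyn(1)] cnt[OF xyn(2)] cnt[OF S(8)] by auto
                    ultimately show ?thesis
                      unfolding wp_Cond by (simp only: if_True)
                  qed
                  show ?case
                  proof (rule wp_call[OF T], goal_cases)
                    case (1 t10 s10)
                    note h10 = 1
                    have i10: "inp s10"
                      using h10(2) i9 by (auto simp: same_except_def inp_def)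
                    define s11 where "s11 = reg ''len'' 0 s10"
                    have w11: "wp (Assign ''len'' (Const 0)) Q s10 = Q 1 s11" for Q
                      by (simp add: s11_def)
                    show ?case
                      unfolding w11
                    proof (rule wp_filtered[where m = n and P = "\<lambda>j. j \<in> marks s10 ''F''"], goal_cases)
                      case (3 j s')
                      then show ?case
                        by (auto simp: same_except_def s11_def marks_def)
                    next
                      case (4 t12 s12)
                      define s13 where "s13 = ((fst s12)(''tag'' := 1, ''done'' := 1), snd s12)"
                      have "output_list s13 = filter (\<lambda>j. j \<in> marks s10 ''F'') [0..<n]"
                        using 4(2) by (simp add: output_list_def alist_def s13_def s11_def)
                      then have "set (output_list s13) = marks s10 ''F''" "distinct (output_list s13)"
                        by (auto simp: marks_def)
                      then have "is_solution G k s13"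
                        using h10(1) by (simp add: is_solution_def Let_def obstruction_def pverts_eq s13_def)
                      moreover have "t1 + (t2 + (t3 + (t4 + (t5 + (t6 + (t7 + (1 + (1 + (1 + (t9 + (t10 + (1 + (t12 + (1 + 1))))))))))))))
                          \<le> 400 * (n\<^sup>2 * N)"
                      proof -
                        \<comment> \<open>Pruning is the only quadratic piece; all other costs are
                          absorbed into \<open>n\<^sup>2 * N\<close>.\<close>
                        have N1: "N \<le> n\<^sup>2 * N" "n * N \<le> n\<^sup>2 * N"
                          using n_pos by (simp_all add: power2_eq_square)
                        have fn: "fst s1 ''fn'' \<le> 3 * n" "t1 \<le> 30 * N"
                          using h1(1) by simp_all
                        have "t2 \<le> 3 * N" "t4 \<le> 3 * N" "t6 \<le> 130 * (n\<^sup>2 * N)" "t9 \<le> 12 * (n * N)" "t10 \<le> 36 * N"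
                          using h2(1) h4(1) h6(1) h9(1) h10(1) by simp_all
                        then show ?thesis
                          using fn N1 h3(3) h5(3) h7(3) 4(3) on_pathD(5)[OF P] n_le_N by linarith
                      qed
                      ultimately show ?case
                        by (simp add: s13_def)
                    qed (use inpD(1)[OF i10] in \<open>auto simp: same_except_def s11_def\<close>)
                  qed
                qed
              qed (use inpD(1)[OF i6] in \<open>auto simp: same_except_def\<close>)
            qed
          qed (use on_pathD(4)[OF P4] in \<open>auto simp: same_except_def\<close>)
        qed
      qed (use fl2 in \<open>auto simp: same_except_def\<close>)
    qed
  qed
qed

text \<open>Either the path keeps all its vertices and gains \<open>v\<close>, at linear cost, or
  the run ends with an obstruction. Only the second outcome may cost \<open>n\<^sup>2 * N\<close>,
  because it occurs at most once.\<close>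

lemma wp_grow:
  assumes P: "on_path P s" and bt0: "btree (set P) {..<n} {..<n} (snd s ''d0'') (snd s ''p0'')"
    and v: "fst s ''v'' = v" "v < n" "snd s ''d0'' v = k"
    and xx: "fst s ''xx'' < n" "snd s ''d0'' (fst s ''xx'') < k" "fst s ''xx'' \<notin> Nb (set P - {hd P}) (k - 1)"
    and yy: "fst s ''yy'' < n" "snd s ''d0'' (fst s ''yy'') < k" "fst s ''yy'' \<notin> Nb (set P - {last P}) (k - 1)"
    and bt1: "btree {v} ({..<n} - set P) (marks s ''vis'') (snd s ''dist'') (snd s ''par'')"
    and bt2: "btree {last P} (insert (last P) ({..<n} - set P)) Vs2 d2 p2"
    and cyc: "0 < fst s ''cyc'' \<longleftrightarrow> hd P \<in> Vs2"
      "hd P \<in> Vs2 \<Longrightarrow> alist s ''mid'' (fst s ''ml'') = ancestors p2 (d2 (hd P)) (hd P)"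
  shows "wp grow (\<lambda>t s'. (\<exists>Q. on_path Q s' \<and> set P \<subseteq> set Q \<and> v \<in> set Q \<and> fst s' ''tag'' = fst s ''tag'' \<and>
      fst s' ''done'' = fst s ''done'' \<and> t \<le> 40 * N) \<or>
    is_solution G k s' \<and> fst s' ''done'' = 1 \<and> t \<le> 403 * (n\<^sup>2 * N)) s"
proof -
  let ?V = "marks s ''vis''" and ?d = "snd s ''dist''" and ?p = "snd s ''par''"
  let ?post = "\<lambda>t s'. (\<exists>Q. on_path Q s' \<and> set P \<subseteq> set Q \<and> v \<in> set Q \<and> fst s' ''tag'' = fst s ''tag'' \<and>
      fst s' ''done'' = fst s ''done'' \<and> t \<le> 40 * N) \<or>
    is_solution G k s' \<and> fst s' ''done'' = 1 \<and> t \<le> 403 * (n\<^sup>2 * N)"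
  have gP: "gpath P"
    by (rule on_pathD(13)[OF P])
  have lst: "bval (lt0 (Read ''vis'' last_out)) s \<longleftrightarrow> last P \<in> ?V"
    using on_pathD(14,16)[OF P] by (simp add: marks_def)
  have fst_: "bval (lt0 (Read ''vis'' first_out)) s \<longleftrightarrow> hd P \<in> ?V"
    using on_pathD(15,17)[OF P] by (simp add: marks_def)
  \<comment> \<open>The common last step of all cases: as soon as the last vertex is reached from
    \<open>v\<close>, the rearranged path can be prolonged. The condition \<open>out\<close> keeps
    the appended vertices new.\<close>
  have ext: "wp extend (\<lambda>t s'. t \<le> 5 * N \<and> (\<exists>R. on_path R s' \<and> set Q \<subseteq> set R \<and> v \<in> set R)) s'"
    if Q: "on_path Q s'" and sub: "set P \<subseteq> set Q" and same: "snd s' ''dist'' = ?d" "snd s' ''par'' = ?p"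
      and l: "last Q \<in> ?V" and out: "\<And>u. u \<in> set Q \<Longrightarrow> u \<in> ?V \<Longrightarrow> u \<in> set P" for Q s'
  proof -
    note E = gpath_extend[OF on_pathD(13)[OF Q] sub bt1 l out]
    have "wp extend (\<lambda>t s''. on_path (Q @ ancestors ?p (?d (last Q)) (last Q)) s'' \<and> t \<le> 5 * N) s'"
      by (rule wp_extend[OF Q _ l]) (use bt1 same E in auto)
    then show ?thesis
      using E by (elim wp_mono) auto
  qed
  show ?thesis
  proof (cases "last P \<in> ?V")
    case True
    have "wp extend (\<lambda>t. ?post (Suc t)) s"
    proof (rule wp_call[OF ext[OF P _ refl refl True]], goal_cases)
      case (3 t s')
      then show ?case
        using n_le_N by (intro disjI1) (auto simp: same_except_def)
    qed auto
    then show ?thesis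
      using True lst by (simp add: grow_def)
  next
    case lV: False
    have rot: "wp (Seq rotate extend) (\<lambda>t s'. t \<le> 21 * N \<and> (\<exists>R. on_path R s' \<and> set P \<subseteq> set R \<and> v \<in> set R) \<and>
        fst s' ''tag'' = fst s' ''tag'') s'"
      if s': "on_path P s'" "snd s' ''dist'' = ?d" "snd s' ''par'' = ?p" and a: "fst s' ''a'' = a" "a < length P" "P ! a \<in> ?V"
        and A: "alist s' ''mid'' (fst s' ''ml'') = A" and Q: "Q = rev (take a P) @ A @ rev (drop a (butlast P))"
        and g: "gpath Q \<and> set P \<subseteq> set Q \<and> last Q = P ! a \<and> (\<forall>u\<in>set Q. u \<in> ?V \<longrightarrow> u \<in> set P)" for s' a A Q
      unfolding wp_Seq
    proof (rule wp_call[OF wp_rotate[OF s'(1) a(1,2) A Q conjunct1[OF g]]], goal_cases)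
      case (1 t1 s1)
      note h1 = 1
      have d1: "snd s1 ''dist'' = ?d" "snd s1 ''par'' = ?p"
        using h1(2) s'(2,3) by (auto simp: same_except_def)
      have "wp extend (\<lambda>t s'. t \<le> 5 * N \<and> (\<exists>R. on_path R s' \<and> set Q \<subseteq> set R \<and> v \<in> set R)) s1"
        by (rule ext) (use h1(1) d1 g a(3) in auto)
      then show ?case
        using h1(1) g by (elim wp_mono) auto
    qed
    have rot': "wp (Seq rotate extend) (\<lambda>t. ?post (c + t)) s'"
      if R: "wp (Seq rotate extend) (\<lambda>t s'. t \<le> 21 * N \<and> (\<exists>R. on_path R s' \<and> set P \<subseteq> set R \<and> v \<in> set R) \<and>
        fst s' ''tag'' = fst s' ''tag'') s'" and c: "c \<le> 19 * N"
        and keep: "fst s' ''tag'' = fst s ''tag''" "fst s' ''done'' = fst s ''done''" for s' c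
    proof (rule wp_call[OF R], goal_cases)
      case (1 t s'')
      have "fst s'' ''tag'' = fst s ''tag''" "fst s'' ''done'' = fst s ''done''"
        using 1(2) keep by (auto simp: same_except_def)
      then show ?case
        using 1(1) c by (intro disjI1) auto
    qed
    show ?thesis
    proof (cases "hd P \<in> ?V")
      case True
      let ?s = "((fst s)(''a'' := 0, ''ml'' := 1), (snd s)(''mid'' := (snd s ''mid'')(0 := last P)))"
      have eq: "rev (take 0 P) @ [last P] @ rev (drop 0 (butlast P)) = rev P"
        using on_pathD(12)[OF P] by (metis append_butlast_last_id append_self_conv2 drop0 rev.simps(1) rev_eq_Cons_iff
            rev_rev_ident take_0 append_Cons append_Nil rev_append)
      have aux: "alist ?s ''mid'' (fst ?s ''ml'') = [last P]"
        by (simp add: alist_def)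
      have "wp (Seq rotate extend) (\<lambda>t s'. t \<le> 21 * N \<and> (\<exists>R. on_path R s' \<and> set P \<subseteq> set R \<and> v \<in> set R) \<and>
          fst s' ''tag'' = fst s' ''tag'') ?s"
      proof (rule rot[OF _ _ _ _ _ _ aux refl])
        show "on_path P ?s"
          using P by (simp add: on_path_def inp_def alist_def)
        show "gpath (rev (take 0 P) @ [last P] @ rev (drop 0 (butlast P))) \<and>
          set P \<subseteq> set (rev (take 0 P) @ [last P] @ rev (drop 0 (butlast P))) \<and>
          last (rev (take 0 P) @ [last P] @ rev (drop 0 (butlast P))) = P ! 0 \<and>
          (\<forall>u\<in>set (rev (take 0 P) @ [last P] @ rev (drop 0 (butlast P))). u \<in> ?V \<longrightarrow> u \<in> set P)"
          unfolding eq using gpath_rev[OF gP] on_pathD(12)[OF P] by (simp add: last_rev hd_conv_nth)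
        show "P ! 0 \<in> ?V" "0 < length P"
          using True on_pathD(12)[OF P] by (simp_all add: hd_conv_nth)
      qed simp_all
      from rot'[OF this, of 5]
      have R: "wp (Seq rotate extend) (\<lambda>t. ?post (5 + t)) ?s"
        using n_le_N by simp
      have "aval last_out ((fst s)(''a'' := 0, ''ml'' := 1), snd s) = last P"
        using on_pathD(14)[OF P] by (simp add: last_out_def)
      then have w: "wp (Assign ''a'' (Const 0)) (\<lambda>a. wp (Assign ''ml'' (Const 1)) (\<lambda>b. wp (Write ''mid'' (Const 0) last_out)
          (\<lambda>c. Q a b c))) s = Q 1 1 1 ?s" for Q
        by simp
      have "wp (Seq (Assign ''a'' (Const 0)) (Seq (Assign ''ml'' (Const 1)) (Seq (Write ''mid'' (Const 0) last_out)
         (Seq rotate extend)))) (\<lambda>t. ?post (2 + t)) s"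
        unfolding wp_Seq[of "Assign _ _"] wp_Seq[of "Write _ _ _"] w
        using R by (elim wp_mono) (simp add: numeral_eq_Suc)
      then show ?thesis
        using True lV lst fst_ unfolding grow_def wp_Cond by (simp only: if_True if_False) (simp add: numeral_eq_Suc)
    next
      case hV: False
      show ?thesis
      proof (cases "hd P \<in> Vs2")
        case True
        \<comment> \<open>If the search from \<open>v\<close> touched no vertex of \<open>P\<close>,
          its region would be closed and hence the whole graph, including
          \<open>hd P\<close>.\<close>
        have "\<exists>a<length P. P ! a \<in> ?V"
        proof (rule ccontr)
          assume no: "\<not> (\<exists>a<length P. P ! a \<in> ?V)"
          then have "set P \<inter> ?V = {}"
            by (auto simp: in_set_conv_nth)
          then have "?V = {..<n}"
            using btreeD(1,2,5)[OF bt1] by (intro conn_closed[OF conn_all]) blast+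
          then show False
            using hV on_pathD(17)[OF P] by simp
        qed
        then obtain a0 where a0: "a0 < length P" "P ! a0 \<in> ?V" by blast
        have "wp (search ''fa'' ''a'' (Var ''len'') (lt0 (Read ''vis'' (Read ''out'' (Var ''i'')))))
            (\<lambda>t1. wp (Seq rotate extend) (\<lambda>t. ?post (3 + t1 + t))) s"
        proof (rule wp_search[where m = "length P" and P = "\<lambda>j. P ! j \<in> ?V"], goal_cases)
          case (5 j s')
          have "snd s' ''vis'' = snd s ''vis''" "snd s' ''out'' = snd s ''out''"
            using 5(3) by (auto simp: same_except_def)
          then show ?case
            using 5(1,2) on_pathD(7,8)[OF P, of j] by (simp add: marks_def)
        next
          case (6 t1 s1)
          have P1: "on_path P s1"
            by (rule on_path_same[OF 6(1) P]) auto
          define a where "a = fst s1 ''a''"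
          have a: "a < length P" "P ! a \<in> ?V"
            using 6(2) a0 by (auto simp: a_def)
          have s1: "snd s1 = snd s" "fst s1 ''ml'' = fst s ''ml''" "fst s1 ''tag'' = fst s ''tag''" "fst s1 ''done'' = fst s ''done''"
            using 6(1) by (auto simp: same_except_def)
          have mid: "alist s1 ''mid'' (fst s1 ''ml'') = ancestors p2 (d2 (hd P)) (hd P)"
            using cyc(2)[OF True] s1 by (simp add: alist_def)
          have "wp (Seq rotate extend) (\<lambda>t s'. t \<le> 21 * N \<and> (\<exists>R. on_path R s' \<and> set P \<subseteq> set R \<and> v \<in> set R) \<and>
              fst s' ''tag'' = fst s' ''tag'') s1"
            by (rule rot[OF P1 _ _ a_def[symmetric] a mid refl gpath_rotate[OF gP bt1 bt2 hV lV True a refl]])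
              (use s1 in auto)
          from rot'[OF this, of "3 + t1"] show ?case
            using 6(3) s1 on_pathD(5)[OF P] n_le_N by simp
        qed (use on_pathD(4)[OF P] in \<open>auto simp: same_except_def\<close>)
        then have "wp (Seq (search ''fa'' ''a'' (Var ''len'') (lt0 (Read ''vis'' (Read ''out'' (Var ''i''))))) (Seq rotate extend))
            (\<lambda>t. ?post (3 + t)) s"
          unfolding wp_Seq[of "search _ _ _ _"] by (elim wp_mono) (simp add: add.assoc)
        then show ?thesis
          using True hV lV lst fst_ cyc(1) unfolding grow_def wp_Cond
          by (simp only: if_True if_False bval.simps aval.simps) (simp add: numeral_eq_Suc)
      next
        case nV: False
        have "wp finish (\<lambda>t. ?post (3 + t)) s"
        proof (rule wp_mono[OF wp_finish[OF P bt0 v refl xx refl yy bt1 bt2 hV lV nV]], goal_cases)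
          case (1 t s')
          have "1 \<le> n\<^sup>2 * N"
            using n_pos n_le_N by (simp add: Suc_le_eq)
          then have "3 + t \<le> 403 * (n\<^sup>2 * N)"
            using 1 by (elim conjE) linarith
          then show ?case
            using 1 by blast
        qed
        then show ?thesis
          using nV hV lV lst fst_ cyc(1) unfolding grow_def wp_Cond
          by (simp only: if_True if_False bval.simps aval.simps) (simp add: numeral_eq_Suc)
      qed
    qed
  qed
qed

text \<open>An uncovered vertex weighs \<open>n + 1\<close>, which exceeds every possible increase
  of the length, since paths have between 1 and \<open>n\<close> vertices.\<close>

definition mu :: "nat list \<Rightarrow> nat" where
  "mu P = (n - card (Nb (set P) (k - 1))) * Suc n + length P"

lemma Nb_finite: "set P \<subseteq> {..<n} \<Longrightarrow> finite (Nb (set P) j)" "set P \<subseteq> {..<n} \<Longrightarrow> card (Nb (set P) j) \<le> n"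
  using Nb_subset[of "set P" j] card_mono[of "{..<n}" "Nb (set P) j"] by (auto intro: finite_subset)

text \<open>Keeping the vertices of \<open>P\<close> keeps its coverage, and \<open>v\<close> is
  newly covered; the gain of \<open>n + 1\<close> pays for the longer path and one unit
  more.\<close>

lemma mu_grow:
  assumes "gpath P" "gpath Q" "set P \<subseteq> set Q" "v \<in> set Q" "v \<notin> Nb (set P) (k - 1)"
  shows "Suc (mu Q) \<le> mu P"
proof -
  have fin: "finite (Nb (set Q) (k - 1))" "card (Nb (set Q) (k - 1)) \<le> n"
    using assms(2) Nb_finite[of Q] by (simp_all add: gpath_def)
  have "v \<in> Nb (set Q) (k - 1)"
    using assms(4) Nb_le[of 0 "k - 1" "set Q"] by auto
  then have "Nb (set P) (k - 1) \<subset> Nb (set Q) (k - 1)"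
    using Nb_mono[OF assms(3), of "k - 1"] assms(5) by blast
  then have "card (Nb (set P) (k - 1)) < card (Nb (set Q) (k - 1))"
    using fin by (simp add: psubset_card_mono)
  then have "n - card (Nb (set P) (k - 1)) \<ge> Suc (n - card (Nb (set Q) (k - 1)))"
    using fin(2) by linarith
  then have *: "Suc (n - card (Nb (set Q) (k - 1))) * Suc n \<le> (n - card (Nb (set P) (k - 1))) * Suc n"
    by (rule mult_le_mono1)
  define A B where "A = n - card (Nb (set Q) (k - 1))" and "B = n - card (Nb (set P) (k - 1))"
  have "Suc n + A * Suc n \<le> B * Suc n"
    using * unfolding A_def[symmetric] B_def[symmetric] mult_Suc .
  moreover have "length Q \<le> n"
    by (rule gpath_length[OF assms(2)])
  ultimately show ?thesis
    unfolding mu_def A_def[symmetric] B_def[symmetric] by linarith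
qed

lemma mu_shrink:
  assumes "Nb (set P) (k - 1) \<subseteq> Nb (set Q) (k - 1)" "set Q \<subseteq> {..<n}" "length Q < length P"
  shows "Suc (mu Q) \<le> mu P"
proof -
  have "card (Nb (set P) (k - 1)) \<le> card (Nb (set Q) (k - 1))"
    using assms(1) Nb_finite(1)[OF assms(2)] by (simp add: card_mono)
  then have "(n - card (Nb (set Q) (k - 1))) * Suc n \<le> (n - card (Nb (set P) (k - 1))) * Suc n"
    by (intro mult_le_mono1) linarith
  then show ?thesis
    using assms(3) by (simp add: mu_def)
qed

text \<open>\<open>gdist\<close> is a least length, so one walk with at most \<open>k - 1\<close>
  edges from each vertex to the path bounds the eccentricity from above.\<close>

lemma gpath_solution:
  assumes P: "on_path P s" and cov: "\<And>w. w < n \<Longrightarrow> w \<in> Nb (set P) (k - 1)" and tag: "fst s ''tag'' = 0"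
  shows "is_solution G k s"
proof -
  have out: "output_list s = P"
    using P by (simp add: on_path_def output_list_def alist_def)
  have arcs: "set (vwalk_arcs p) \<subseteq> parcs G" if "successively E p" for p
    using that by (induction p rule: vwalk_arcs.induct) (auto simp: E_def)
  have walk: "vwalk p (with_proj G)" if "successively E p" "p \<noteq> []" "set p \<subseteq> {..<n}" for p
    using that arcs pverts_eq by (auto simp: vwalk_def)
  have gP: "P \<noteq> []" "distinct P" "set P \<subseteq> {..<n}" "successively E P"
    using on_pathD(13)[OF P] by (auto simp: gpath_def)
  have near: "\<exists>p. successively E p \<and> p \<noteq> [] \<and> set p \<subseteq> {..<n} \<and> hd p = w \<and> last p \<in> set P \<and> length p \<le> Suc j"
    if "w \<in> Nb (set P) j" for w j
    using that
  proof (induction j arbitrary: w)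
    case 0
    then show ?case
      using gP by (intro exI[of _ "[w]"]) auto
  next
    case (Suc j)
    then consider "w \<in> Nb (set P) j" | u where "u \<in> Nb (set P) j" "E u w"
      by auto
    then show ?case
    proof cases
      case 1
      from Suc.IH[OF this] obtain p where "successively E p \<and> p \<noteq> [] \<and> set p \<subseteq> {..<n} \<and> hd p = w \<and>
          last p \<in> set P \<and> length p \<le> Suc j"
        by blast
      then show ?thesis
        by (intro exI[of _ p]) auto
    next
      case 2
      from Suc.IH[OF this(1)] obtain p where "successively E p \<and> p \<noteq> [] \<and> set p \<subseteq> {..<n} \<and> hd p = u \<and>
          last p \<in> set P \<and> length p \<le> Suc j"
        by blast
      then show ?thesis
        using 2(2) E_lt[OF 2(2)] sym by (intro exI[of _ "w # p"]) (auto simp: successively_Cons)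
    qed
  qed
  have "Min ((\<lambda>u. gdist G w u) ` set P) < k" if w: "w \<in> pverts G" for w
  proof -
    obtain p where p: "successively E p" "p \<noteq> []" "set p \<subseteq> {..<n}" "hd p = w" "last p \<in> set P" "length p \<le> Suc (k - 1)"
      using near[OF cov[of w]] w pverts_eq by blast
    have "gdist G w (last p) \<le> length p - 1"
      unfolding gdist_def by (rule Least_le) (use walk p in auto)
    then have "gdist G w (last p) < k"
      using p(6) k_pos by linarith
    moreover have "Min ((\<lambda>u. gdist G w u) ` set P) \<le> gdist G w (last p)"
      using p(5) by (intro Min_le) auto
    ultimately show ?thesis by linarith
  qed
  then have "path_ecc G P < k"
    unfolding path_ecc_def using pverts_eq n_pos by (subst Max_less_iff) auto
  then show ?thesis
    using tag out walk gP by (auto simp: is_solution_def vpath_def)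
qed

lemma wp_round:
  assumes P: "on_path P s" and tag: "fst s ''tag'' = 0" and dn: "fst s ''done'' = 0"
  shows "wp round (\<lambda>t s'. (\<exists>Q. on_path Q s' \<and> Suc (mu Q) \<le> mu P \<and> fst s' ''tag'' = 0 \<and> fst s' ''done'' = 0 \<and> t \<le> 210 * N) \<or>
    is_solution G k s' \<and> fst s' ''done'' = 1 \<and> t \<le> 600 * (n\<^sup>2 * N)) s"
  unfolding round_def wp_Seq[of cover]
proof (rule wp_call[OF wp_cover[OF P]], goal_cases)
  case (1 t1 s1)
  note h1 = 1
  have P1: "on_path P s1"
    by (rule on_path_same[OF h1(2) P]) auto
  have bt0: "btree (set P) {..<n} {..<n} (snd s1 ''d0'') (snd s1 ''p0'')"
    using h1(1) by simp
  have td1: "fst s1 ''tag'' = 0" "fst s1 ''done'' = 0"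
    using h1(2) tag dn by (auto simp: same_except_def)
  have N1: "N \<le> n\<^sup>2 * N"
    using n_pos by simp
  let ?post = "\<lambda>t s'. (\<exists>Q. on_path Q s' \<and> Suc (mu Q) \<le> mu P \<and> fst s' ''tag'' = 0 \<and> fst s' ''done'' = 0 \<and> t \<le> 210 * N) \<or>
    is_solution G k s' \<and> fst s' ''done'' = 1 \<and> t \<le> 600 * (n\<^sup>2 * N)"
  show ?case
  proof (cases "fst s1 ''fv'' = 0")
    case True
    then have far: "snd s1 ''d0'' w \<noteq> k" if "w < n" for w
      using h1(1) that by simp
    \<comment> \<open>Labels drop by one along predecessors, so a vertex beyond the coverage would
      have an ancestor, possibly itself, at distance exactly \<open>k\<close>.\<close>
    have near: "w \<in> Nb (set P) (k - 1)" if "w < n" for w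
    proof (rule ccontr)
      assume "w \<notin> Nb (set P) (k - 1)"
      then have "k \<le> snd s1 ''d0'' w"
        using btree_Nb[OF bt0, of w "k - 1"] that k_pos by auto
      then have "snd s1 ''d0'' ((snd s1 ''p0'' ^^ (snd s1 ''d0'' w - k)) w) = k"
        "(snd s1 ''p0'' ^^ (snd s1 ''d0'' w - k)) w < n"
        using btree_ancestor(1)[OF bt0, of w "snd s1 ''d0'' w - k"] that by auto
      then show False
        using far by blast
    qed
    have "is_solution G k (reg ''done'' 1 s1)"
      using gpath_solution[OF on_path_reg[OF P1] near] td1 by simp
    moreover have "t1 + Suc 1 \<le> 600 * (n\<^sup>2 * N)"
      using h1(1) N1 n_le_N by (elim conjE) linarith
    ultimately show ?thesis
      using True by simp
  next
    case False
    define v where "v = fst s1 ''v''"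
    have v: "v < n" "snd s1 ''d0'' v = k"
      using False h1(1) by (auto simp: v_def)
    have vP: "v \<notin> Nb (set P) (k - 1)" "v \<notin> set P"
    proof -
      show "v \<notin> Nb (set P) (k - 1)"
        using btree_Nb[OF bt0, of v "k - 1"] v k_pos by auto
      then show "v \<notin> set P"
        using Nb_le[of 0 "k - 1" "set P"] by auto
    qed
    define s2 where "s2 = (fst s1, (snd s1)(''src'' := (snd s1 ''src'')(last P := 0)))"
    have P2: "on_path P s2"
      unfolding s2_def by (rule on_path_array[OF P1]) simp
    have m2: "marks s2 ''src'' = set P - {last P}" "marks s2 ''ok'' = {..<n}"
      using h1(1) by (auto simp: s2_def marks_def)
    have bt2: "btree (set P) {..<n} {..<n} (snd s2 ''d0'') (snd s2 ''p0'')"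
      using bt0 by (simp add: s2_def)
    have w2: "wp (Write ''src'' last_out (Const 0)) Q s1 = Q 1 s2" for Q
      using on_pathD(14)[OF P1] by (simp add: s2_def)
    have rest: "wp (Seq (probe ''fy'' ''yy'') (Cond (Less (Var ''fy'') (Const 1)) drop_last
       (Seq (Write ''src'' last_out (Const 1)) (Seq (Write ''src'' first_out (Const 0))
       (Seq (probe ''fx'' ''xx'') (Cond (Less (Var ''fx'') (Const 1)) drop_first (Seq trees grow)))))))
       (\<lambda>t s'. ?post (t1 + Suc (1 + t)) s') s2"
      unfolding wp_Seq[of "probe _ _"]
    proof (rule wp_call[OF wp_probe[OF P2 m2 bt2]], goal_cases)
      case (4 t3 s3)
      note h3 = 4
      have P3: "on_path P s3"
        by (rule on_path_same[OF h3(2) P2]) auto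
      have td3: "fst s3 ''tag'' = 0" "fst s3 ''done'' = 0" "fst s3 ''v'' = v" "snd s3 ''d0'' = snd s1 ''d0''" "snd s3 ''p0'' = snd s1 ''p0''"
        using h3(2) td1 by (auto simp: same_except_def s2_def v_def)
      have Pl: "set P - {last P} = set (butlast P)"
        using on_pathD(10,12)[OF P] by (metis append_butlast_last_id Diff_insert_absorb Un_insert_right distinct_append
            distinct.simps(2) disjoint_insert(1) list.set(1) list.set(2) set_append sup_bot_right)
      have Ph: "set P - {hd P} = set (tl P)"
        using on_pathD(10,12)[OF P] by (cases P) auto
      \<comment> \<open>Dropping the only vertex of a path would empty the coverage; hence a path
        that is shortened keeps at least one vertex.\<close>
      have ne: "Nb S (k - 1) \<noteq> {} \<Longrightarrow> S \<noteq> {}" for S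
      proof (rule ccontr)
        have "Nb {} j = {}" for j by (induction j) auto
        then show False if "Nb S (k - 1) \<noteq> {}" "\<not> S \<noteq> {}" using that by auto
      qed
      have Pcov: "Nb (set P) (k - 1) \<noteq> {}"
        using Nb_le[of 0 "k - 1" "set P"] on_pathD(12)[OF P] by auto
      show ?case
      proof (cases "fst s3 ''fy'' = 0")
        case True
        then have sub: "Nb (set P) (k - 1) \<subseteq> Nb (set (butlast P)) (k - 1)"
          using h3(1) Pl by simp
        have bne: "butlast P \<noteq> []"
          using ne[of "set (butlast P)"] sub Pcov by auto
        have g: "gpath (butlast P)"
          using on_pathD(13)[OF P] bne successively_take[of E P "length P - 1"]
          by (auto simp: gpath_def distinct_butlast butlast_conv_take dest: in_set_takeD)
        have "on_path (butlast P) (reg ''len'' (length P - 1) s3)"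
          unfolding on_path_def
        proof (intro conjI g)
          show "inp (reg ''len'' (length P - 1) s3)"
            by (rule inp_reg[OF on_pathD(1)[OF P3]]) simp
          show "alist (reg ''len'' (length P - 1) s3) ''out'' (fst (reg ''len'' (length P - 1) s3) ''len'') = butlast P"
            using on_pathD(7)[OF P3] by (intro nth_equalityI) (auto simp: nth_butlast)
        qed
        moreover have "Suc (mu (butlast P)) \<le> mu P"
          by (rule mu_shrink[OF sub]) (use g on_pathD(6)[OF P] in \<open>auto simp: gpath_def\<close>)
        ultimately have "?post (t1 + Suc (1 + (t3 + 2))) (reg ''len'' (length P - 1) s3)"
          using td3 h1(1) h3(1) n_le_N by (intro disjI1 exI[of _ "butlast P"]) auto
        then show ?thesis
          using True on_pathD(4)[OF P3] by (simp add: drop_last_def numeral_2_eq_2)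
      next
        case False
        then have yy: "fst s3 ''yy'' < n" "snd s1 ''d0'' (fst s3 ''yy'') < k" "fst s3 ''yy'' \<notin> Nb (set P - {last P}) (k - 1)"
          using h3(1) by (auto simp: s2_def)
        define s4 where "s4 = (fst s3, (snd s3)(''src'' := (snd s3 ''src'')(last P := 1, hd P := 0)))"
        have P4: "on_path P s4"
          unfolding s4_def by (rule on_path_array[OF P3]) simp
        have w4: "wp (Write ''src'' last_out (Const 1)) (\<lambda>a. wp (Write ''src'' first_out (Const 0)) (\<lambda>b. Q a b)) s3 = Q 1 1 s4" for Q
        proof -
          have "aval first_out (fst s3, (snd s3)(''src'' := g)) = hd P" for g
            using on_pathD(15)[OF P3] by (simp add: first_out_def)
          then show ?thesis
            using on_pathD(14)[OF P3] by (simp add: s4_def)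
        qed
        have m3: "marks s3 ''src'' = set P - {last P}" "marks s3 ''ok'' = {..<n}"
          using marks_same[OF h3(2)] m2 by auto
        have src3: "w < n \<and> 0 < snd s3 ''src'' w \<longleftrightarrow> w \<in> set P \<and> w \<noteq> last P" for w
          using m3(1) unfolding marks_def by blast
        \<comment> \<open>For a path with a single vertex both writes hit the same cell and the
          later one wins, which leaves no source.\<close>
        have "w \<in> marks s4 ''src'' \<longleftrightarrow> w \<in> set P - {hd P}" for w
        proof (cases "w = hd P \<or> w = last P")
          case True
          then show ?thesis
            using on_pathD(12,16)[OF P] by (auto simp: marks_def s4_def)
        next
          case False
          then show ?thesis
            using src3[of w] by (simp add: marks_def s4_def)
        qed
        then have m4: "marks s4 ''src'' = set P - {hd P}" "marks s4 ''ok'' = {..<n}"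
          using m3(2) by (blast, simp add: marks_def s4_def)
        have bt4: "btree (set P) {..<n} {..<n} (snd s4 ''d0'') (snd s4 ''p0'')"
          using bt0 td3 by (simp add: s4_def)
        have "wp (Seq (probe ''fx'' ''xx'') (Cond (Less (Var ''fx'') (Const 1)) drop_first (Seq trees grow)))
            (\<lambda>t s'. ?post (t1 + Suc (1 + (t3 + Suc (1 + (1 + t))))) s') s4"
          unfolding wp_Seq[of "probe _ _"]
        proof (rule wp_call[OF wp_probe[OF P4 m4 bt4]], goal_cases)
          case (4 t5 s5)
          note h5 = 4
          have P5: "on_path P s5"
            by (rule on_path_same[OF h5(2) P4]) auto
          have td5: "fst s5 ''tag'' = 0" "fst s5 ''done'' = 0" "fst s5 ''v'' = v" "snd s5 ''d0'' = snd s1 ''d0''" "snd s5 ''p0'' = snd s1 ''p0''"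
            "fst s5 ''yy'' = fst s3 ''yy''"
            using h5(2) td3 by (auto simp: same_except_def s4_def)
          show ?case
          proof (cases "fst s5 ''fx'' = 0")
            case True
            then have sub: "Nb (set P) (k - 1) \<subseteq> Nb (set (tl P)) (k - 1)"
              using h5(1) Ph by simp
            have tne: "tl P \<noteq> []"
              using ne[of "set (tl P)"] sub Pcov by auto
            have g: "gpath (tl P)"
              using on_pathD(13)[OF P] tne successively_drop[of E P 1]
              by (cases P) (auto simp: gpath_def)
            have "wp drop_first (\<lambda>t s'. ?post (t1 + Suc (1 + (t3 + Suc (1 + (1 + (t5 + Suc t)))))) s') s5"
              unfolding drop_first_def wp_Seq
            proof (rule wp_fill[where m = "length P - 1" and f = "\<lambda>j. P ! Suc j"], goal_cases)
              case (2 j s')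
              then show ?case
                using on_pathD(7)[OF P5, of "Suc j"] by simp
            next
              case (3 t6 s6)
              have len6: "fst s6 ''len'' = length P" "fst s6 ''tag'' = 0" "fst s6 ''done'' = 0"
                using 3(1) on_pathD(4)[OF P5] td5 by (auto simp: same_except_def)
              have "on_path (tl P) (reg ''len'' (length P - 1) s6)"
                unfolding on_path_def
              proof (intro conjI g)
                show "inp (reg ''len'' (length P - 1) s6)"
                  by (rule inp_reg[OF inp_same[OF 3(1) on_pathD(1)[OF P5]]]) auto
                show "alist (reg ''len'' (length P - 1) s6) ''out'' (fst (reg ''len'' (length P - 1) s6) ''len'') = tl P"
                  using 3(2) by (intro nth_equalityI) (auto simp: nth_tl)
              qed
              moreover have "Suc (mu (tl P)) \<le> mu P"
                by (rule mu_shrink[OF sub]) (use g on_pathD(6)[OF P] in \<open>auto simp: gpath_def\<close>)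
              ultimately have "?post (t1 + Suc (1 + (t3 + Suc (1 + (1 + (t5 + Suc (t6 + 1))))))) (reg ''len'' (length P - 1) s6)"
                using len6 h1(1) h3(1) h5(1) 3(3) on_pathD(5)[OF P] n_le_N by (intro disjI1 exI[of _ "tl P"]) auto
              then show ?case
                using len6 by (simp add: drop_last_def)
            qed (use on_pathD(4)[OF P5] in \<open>auto simp: same_except_def\<close>)
            then show ?thesis
              using True by simp
          next
            case False
            then have xx: "fst s5 ''xx'' < n" "snd s1 ''d0'' (fst s5 ''xx'') < k" "fst s5 ''xx'' \<notin> Nb (set P - {hd P}) (k - 1)"
              using h5(1) td3(4) by (auto simp: s4_def)
            have "wp (Seq trees grow) (\<lambda>t s'. ?post (t1 + Suc (1 + (t3 + Suc (1 + (1 + (t5 + Suc t)))))) s') s5"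
              unfolding wp_Seq
            proof (rule wp_call[OF wp_trees[OF P5 td5(3) v(1) vP(2)]], goal_cases)
              case (1 t6 s6)
              note h6 = 1
              have P6: "on_path P s6"
                by (rule on_path_same[OF h6(2) P5]) auto
              have td6: "fst s6 ''tag'' = 0" "fst s6 ''done'' = 0" "fst s6 ''v'' = v" "snd s6 ''d0'' = snd s1 ''d0''"
                "snd s6 ''p0'' = snd s1 ''p0''" "fst s6 ''yy'' = fst s3 ''yy''" "fst s6 ''xx'' = fst s5 ''xx''"
                using h6(2) td5 by (auto simp: same_except_def)
              from conjunct1[OF h6(1)] obtain Vs d p where
                T0: "btree {last P} (insert (last P) ({..<n} - set P)) Vs d p \<and>
                  (0 < fst s6 ''cyc'' \<longleftrightarrow> hd P \<in> Vs) \<and>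
                  (hd P \<in> Vs \<longrightarrow> alist s6 ''mid'' (fst s6 ''ml'') = ancestors p (d (hd P)) (hd P))"
                by (elim exE) (erule that)
              note T = conjunct1[OF T0] conjunct1[OF conjunct2[OF T0]] mp[OF conjunct2[OF conjunct2[OF T0]]]
              have bt1: "btree {v} ({..<n} - set P) (marks s6 ''vis'') (snd s6 ''dist'') (snd s6 ''par'')" "t6 \<le> 65 * N"
                using h6(1) by blast+
              have G: "wp grow (\<lambda>t s'. (\<exists>Q. on_path Q s' \<and> set P \<subseteq> set Q \<and> v \<in> set Q \<and> fst s' ''tag'' = fst s6 ''tag'' \<and>
                  fst s' ''done'' = fst s6 ''done'' \<and> t \<le> 40 * N) \<or>
                is_solution G k s' \<and> fst s' ''done'' = 1 \<and> t \<le> 403 * (n\<^sup>2 * N)) s6"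
                by (rule wp_grow[OF P6 _ td6(3) v(1) _ _ _ _ _ _ _ bt1(1) T]) (use bt0 v xx yy td6 in auto)
              have time: "t1 \<le> 39 * N" "t3 \<le> 24 * N" "t5 \<le> 24 * N"
                using h1(1) h3(1) h5(1) by auto
              show ?case
              proof (rule wp_mono[OF G], elim disjE exE conjE, goal_cases)
                case (1 t7 s7 Q)
                have "Suc (mu Q) \<le> mu P"
                  by (rule mu_grow[OF on_pathD(13)[OF P] on_pathD(13)[OF 1(1)] 1(2,3) vP(1)])
                moreover have "t1 + Suc (1 + (t3 + Suc (1 + (1 + (t5 + Suc (t6 + t7)))))) \<le> 210 * N"
                  using time bt1(2) 1(6) n_le_N by linarith
                ultimately show ?case
                  using 1 td6 by (intro disjI1 exI[of _ Q]) simp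
              next
                case (2 t7 s7)
                have "t1 + Suc (1 + (t3 + Suc (1 + (1 + (t5 + Suc (t6 + t7)))))) \<le> 600 * (n\<^sup>2 * N)"
                  using time bt1(2) 2(3) n_le_N N1 by linarith
                then show ?case
                  using 2 by (intro disjI2) simp
              qed
            qed
            then show ?thesis
              using False by simp
          qed
        qed auto
        then show ?thesis
          using False unfolding wp_Cond wp_Seq[of "Write _ _ _"] w4 by simp
      qed
    qed auto
    show ?thesis
      using False rest unfolding wp_Cond[of "Less (Var ''fv'') (Const 1)"] wp_Seq[of "Write _ _ _"] w2 by simp
  qed
qed

lemma wp_algorithm:
  "wp algorithm (\<lambda>t s. is_solution G k s \<and> t \<le> 1300 * (n\<^sup>2 * N)) (input_store ls k)"
proof -
  let ?s = "input_store ls k"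
  define s1 where "s1 = ((fst ?s)(''len'' := 1), (snd ?s)(''out'' := (snd ?s ''out'')(0 := 0)))"
  have P1: "on_path [0] s1"
    using n_pos by (simp add: on_path_def inp_def gpath_def alist_def s1_def input_store_def n_def)
  have z1: "fst s1 ''tag'' = 0" "fst s1 ''done'' = 0"
    by (simp_all add: s1_def input_store_def)
  define I where "I s \<longleftrightarrow> (\<exists>P. on_path P s \<and> fst s ''tag'' = 0 \<and> fst s ''done'' = 0) \<or>
    is_solution G k s \<and> fst s ''done'' = 1" for s
  define path where "path s = alist s ''out'' (fst s ''len'')" for s
  \<comment> \<open>A round that goes on lowers \<open>mu\<close> and costs at most
    \<open>210 * N\<close>, with its test at most \<open>211 * N\<close>; the second summand is kept
    for the round that ends the run.\<close>
  define Phi where "Phi s = (if fst s ''done'' = 0 then mu (path s) * (211 * N) + 601 * (n\<^sup>2 * N) else 0)" for s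
  have N1: "1 \<le> n\<^sup>2 * N"
    using n_pos n_le_N by (simp add: Suc_le_eq)
  have "wp (While (Less (Var ''done'') (Const 1)) round) (\<lambda>t s. is_solution G k s \<and> Suc (Suc t) \<le> 1300 * (n\<^sup>2 * N)) s1"
  proof (rule wp_While[where I = I and \<Phi> = Phi])
    show "I s1"
      using P1 z1 by (auto simp: I_def)
  next
    fix s
    assume "I s" "bval (Less (Var ''done'') (Const 1)) s"
    then obtain P where P: "on_path P s" "fst s ''tag'' = 0" "fst s ''done'' = 0"
      by (auto simp: I_def)
    have phi: "Phi s = mu P * (211 * N) + 601 * (n\<^sup>2 * N)"
      using P by (simp add: Phi_def path_def on_path_def)
    show "wp round (\<lambda>t s'. I s' \<and> Suc t + Phi s' \<le> Phi s) s"
    proof (rule wp_mono[OF wp_round[OF P]], elim disjE exE conjE, goal_cases)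
      case (1 t s' Q)
      have "Phi s' = mu Q * (211 * N) + 601 * (n\<^sup>2 * N)"
        using 1 by (simp add: Phi_def path_def on_path_def)
      moreover have "Suc (mu Q) * (211 * N) \<le> mu P * (211 * N)"
        using 1(2) by (rule mult_le_mono1)
      moreover have "Suc (mu Q) * (211 * N) = 211 * N + mu Q * (211 * N)"
        by simp
      ultimately have "Suc t + Phi s' \<le> Phi s"
        unfolding phi using 1(5) n_le_N by linarith
      moreover have "I s'"
        using 1 by (auto simp: I_def)
      ultimately show ?case by blast
    next
      case (2 t s')
      then have "Suc t \<le> 601 * (n\<^sup>2 * N)"
        using N1 by linarith
      moreover have "Phi s' = 0" "I s'"
        using 2 by (auto simp: I_def Phi_def)
      ultimately show ?case
        unfolding phi by linarith
    qed
  next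
    fix t s
    assume "I s" "\<not> bval (Less (Var ''done'') (Const 1)) s" and t: "t \<le> Suc (Phi s1)"
    then have sol: "is_solution G k s"
      by (auto simp: I_def)
    \<comment> \<open>The start value is at most \<open>n * (n + 1) + 1\<close>. The budget becomes
      \<open>3 * 211 + 601 = 1234\<close> units of \<open>n\<^sup>2 * N\<close>; the bound 1300
      leaves room for the few steps outside the loop body.\<close>
    have "mu [0] \<le> 3 * n\<^sup>2"
    proof -
      have "(n - card (Nb (set [0]) (k - 1))) * Suc n \<le> n * Suc n"
        by (rule mult_le_mono1) simp
      moreover have "n * Suc n + 1 \<le> 3 * n\<^sup>2"
        unfolding power2_eq_square mult_Suc_right using le_square[of n] n_pos by linarith
      ultimately show ?thesis
        by (simp add: mu_def)
    qed
    then have "mu [0] * (211 * N) \<le> 3 * n\<^sup>2 * (211 * N)"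
      by (rule mult_le_mono1)
    moreover have "3 * n\<^sup>2 * (211 * N) = 633 * (n\<^sup>2 * N)"
      by simp
    moreover have "Phi s1 = mu [0] * (211 * N) + 601 * (n\<^sup>2 * N)"
      using P1 z1 by (simp add: Phi_def path_def on_path_def)
    ultimately have "Suc (Suc t) \<le> 1300 * (n\<^sup>2 * N)"
      using t N1 by linarith
    then show "is_solution G k s \<and> Suc (Suc t) \<le> 1300 * (n\<^sup>2 * N)"
      using sol by blast
  qed
  then show ?thesis
    by (simp add: algorithm_def s1_def)
qed

text \<open>An edge comes from at most two arcs, so \<open>N\<close> is at most
  \<open>n + 2 * num_edges G + 1\<close>, and the 1 is absorbed since there is a vertex.\<close>

lemma N_bound: "N \<le> 3 * (n + num_edges G)"
proof -
  have deg: "length (ls ! u) = card {w. (u, w) \<in> parcs G}" if "u < n" for u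
    using adj that distinct_card[of "ls ! u"] by (auto simp: adj_lists_def n_def)
  have fin: "finite (parcs G)"
    by (rule pair_finite_arcs)
  have sig: "parcs G = Sigma {..<n} (\<lambda>u. {w. (u, w) \<in> parcs G})"
    using in_arcsD1 pverts_eq by auto
  have finw: "finite {w. (u, w) \<in> parcs G}" for u
    using finite_imageI[OF fin, of snd] by (rule finite_subset[rotated]) force
  have "card (Sigma {..<n} (\<lambda>u. {w. (u, w) \<in> parcs G})) = (\<Sum>u<n. card {w. (u, w) \<in> parcs G})"
    by (rule card_SigmaI) (simp_all add: finw)
  then have "card (parcs G) = (\<Sum>u<n. card {w. (u, w) \<in> parcs G})"
    by (rule trans[OF arg_cong[where f = card, OF sig]])
  then have "length (concat ls) = card (parcs G)"
    using deg sum_degrees by simp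
  also have "card (parcs G) \<le> 2 * num_edges G"
  proof -
    let ?f = "\<lambda>(u, v). {u, v}"
    have "card (parcs G) \<le> (\<Sum>e\<in>?f ` parcs G. card {a \<in> parcs G. ?f a = e})"
    proof -
      have eq: "parcs G = (\<Union>e\<in>?f ` parcs G. {a \<in> parcs G. ?f a = e})"
        by blast
      show ?thesis
        by (rule ord_eq_le_trans[OF arg_cong[where f = card, OF eq]], rule card_UN_le)
          (rule finite_imageI[OF fin])
    qed
    also have "\<dots> \<le> (\<Sum>e\<in>?f ` parcs G. 2)"
    proof (rule sum_mono)
      fix e
      assume "e \<in> ?f ` parcs G"
      then obtain a where a: "e = ?f a" by blast
      obtain u v where "a = (u, v)" by (cases a)
      with a have e: "e = {u, v}" by simp
      have "{a \<in> parcs G. ?f a = e} \<subseteq> {(u, v), (v, u)}"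
      proof
        fix b
        assume b: "b \<in> {a \<in> parcs G. ?f a = e}"
        obtain x y where xy: "b = (x, y)" by (cases b)
        have "{x, y} = {u, v}"
          using b unfolding xy e by simp
        then have "x = u \<and> y = v \<or> x = v \<and> y = u"
          by (simp only: doubleton_eq_iff)
        then show "b \<in> {(u, v), (v, u)}"
          unfolding xy by blast
      qed
      then have "card {a \<in> parcs G. ?f a = e} \<le> card {(u, v), (v, u)}"
        by (rule card_mono[rotated]) simp
      also have "\<dots> \<le> 2"
        by (rule card_insert_le_m1) simp_all
      finally show "card {a \<in> parcs G. ?f a = e} \<le> 2" .
    qed
    also have "\<dots> = 2 * num_edges G"
      by (simp add: num_edges_def)
    finally show ?thesis .
  qed
  finally have "length (concat ls) \<le> 2 * num_edges G" .
  moreover have "x + l + 1 \<le> 3 * (x + m)" if "l \<le> 2 * m" "0 < x" for x l m :: nat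
    using that by presburger
  ultimately show ?thesis
    unfolding N_def using n_pos by blast
qed

end

theorem theorem9:
  shows "\<exists>(c :: com) (C :: nat). \<forall>(G :: nat pair_pre_digraph) (ls :: nat list list) (k :: nat).
    pair_graph G \<and> connected G \<and> adj_lists G ls \<and> 1 \<le> k \<longrightarrow>
    (\<exists>t s. exec c (input_store ls k) t s \<and>
       t \<le> C * ((card (pverts G))^2 * (card (pverts G) + num_edges G)) \<and>
       is_solution G k s)"
proof (rule exI[of _ algorithm], rule exI[of _ 3900], intro allI impI, elim conjE)
  fix G :: "nat pair_pre_digraph" and ls :: "nat list list" and k :: nat
  assume "pair_graph G" "connected (with_proj G)" "adj_lists G ls" "1 \<le> k"
  then interpret problem G "\<lambda>u v. (u, v) \<in> parcs G" ls k
    by (intro problem.intro host.intro problem_axioms.intro) simp_all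
  obtain t s where ts: "exec algorithm (input_store ls k) t s" "is_solution G k s" "t \<le> 1300 * (n\<^sup>2 * N)"
    using wp_algorithm unfolding wp_def by blast
  \<comment> \<open>Passing from \<open>N\<close> to \<open>n + num_edges G\<close> costs the factor
    3 and explains \<open>3900 = 3 * 1300\<close>.\<close>
  have "n\<^sup>2 * N \<le> n\<^sup>2 * (3 * (n + num_edges G))"
    using N_bound by (rule mult_le_mono2)
  also have "\<dots> = 3 * (n\<^sup>2 * (n + num_edges G))"
    by (rule mult.left_commute)
  finally have le: "t \<le> 3900 * (n\<^sup>2 * (n + num_edges G))"
    using ts(3) by linarith
  have c: "card (pverts G) = n"
    by (simp add: pverts_eq)
  show "\<exists>t s. exec algorithm (input_store ls k) t s \<and>
      t \<le> 3900 * ((card (pverts G))\<^sup>2 * (card (pverts G) + num_edges G)) \<and> is_solution G k s"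
    unfolding c using ts(1,2) le by blast
qed

end
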